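(* The questions "Is every separably-acting von Neumann algebra singly-generated?" and "Is every countably-generated von Neumann algebra singly-generated?" are equivalent: if all separably-acting von Neumann algebras are singly-generated, then all countably-generated von Neumann algebras are singly-generated.
   Context: A von Neumann algebra is separably-acting if it has a faithful normal representation on a separable Hilbert space (equivalently, its predual is norm separable). A subset $S$ of a von Neumann algebra $\mathcal{M}$ generates $\mathcal{M}$ if $\mathcal{M}$ is the smallest von Neumann algebra (with the same unit) containing $S$. $\mathcal{M}$ is countably-generated (respectively singly-generated) if it has a countable generating set (respectively a generating set consisting of one, not necessarily self-adjoint, element). Every separably-acting von Neumann algebra is countably-generated, so the implication from a positive answer to the second question to a positive answer to the first is immediate. *)

theory Defs
  imports "HOL-Analysis.Analysis" "HOL-Algebra.Module"
begin

section \<open>Complex Hilbert spaces\<close>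

text \<open>
  Hilbert spaces are structures with an explicit carrier, so that statements can quantify over all
  of them inside a formula. The fields \<open>mult\<close> and \<open>one\<close> that \<open>module\<close> inherits from \<open>ring\<close> are
  not used.
\<close>

definition complex_ring :: "complex ring" where
  "complex_ring = \<lparr>carrier = UNIV, mult = (*), one = 1, zero = 0, add = (+)\<rparr>"

record 'a hilbert = "(complex, 'a) module" +
  hinner :: "'a \<Rightarrow> 'a \<Rightarrow> complex"

definition hnorm :: "'a hilbert \<Rightarrow> 'a \<Rightarrow> real" where
  "hnorm H x = sqrt (Re (hinner H x x))"

text \<open>The locale \<open>Metric_space\<close> requires symmetry and non-negativity also outside the carrier,
  hence the value 0 there.\<close>

definition hdist :: "'a hilbert \<Rightarrow> 'a \<Rightarrow> 'a \<Rightarrow> real" where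
  "hdist H x y = (if x \<in> carrier H \<and> y \<in> carrier H then hnorm H (x \<ominus>\<^bsub>H\<^esub> y) else 0)"

locale hilbert_space = module complex_ring H for H :: "'a hilbert" (structure) +
  assumes hinner_add_left:
      "\<lbrakk>x \<in> carrier H; y \<in> carrier H; z \<in> carrier H\<rbrakk> \<Longrightarrow>
        hinner H (x \<oplus> y) z = hinner H x z + hinner H y z"
    and hinner_smult_left:
      "\<lbrakk>x \<in> carrier H; y \<in> carrier H\<rbrakk> \<Longrightarrow> hinner H (c \<odot> x) y = c * hinner H x y"
    and hinner_commute:
      "\<lbrakk>x \<in> carrier H; y \<in> carrier H\<rbrakk> \<Longrightarrow> hinner H y x = cnj (hinner H x y)"
    and hinner_ge_zero: "x \<in> carrier H \<Longrightarrow> 0 \<le> Re (hinner H x x)"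
    and hinner_eq_zero: "\<lbrakk>x \<in> carrier H; hinner H x x = 0\<rbrakk> \<Longrightarrow> x = \<zero>"
    and complete: "Metric_space.mcomplete (carrier H) (hdist H)"

definition separable_hilbert_space :: "'a hilbert \<Rightarrow> bool" where
  "separable_hilbert_space H \<longleftrightarrow>
    hilbert_space H \<and> separable_space (Metric_space.mtopology (carrier H) (hdist H))"


section \<open>Bounded operators\<close>

text \<open>Operators are extensional functions (\<open>undefined\<close> off the carrier), so that equality of
  operators is equality of functions.\<close>

definition bounded_ops :: "'a hilbert \<Rightarrow> ('a \<Rightarrow> 'a) set" where
  "bounded_ops H = {T \<in> carrier H \<rightarrow>\<^sub>E carrier H.
     (\<forall>x\<in>carrier H. \<forall>y\<in>carrier H. T (x \<oplus>\<^bsub>H\<^esub> y) = T x \<oplus>\<^bsub>H\<^esub> T y) \<and>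
     (\<forall>c. \<forall>x\<in>carrier H. T (c \<odot>\<^bsub>H\<^esub> x) = c \<odot>\<^bsub>H\<^esub> T x) \<and>
     (\<exists>C. \<forall>x\<in>carrier H. hnorm H (T x) \<le> C * hnorm H x)}"

definition op_one :: "'a hilbert \<Rightarrow> 'a \<Rightarrow> 'a" where
  "op_one H = (\<lambda>x\<in>carrier H. x)"

definition op_add :: "'a hilbert \<Rightarrow> ('a \<Rightarrow> 'a) \<Rightarrow> ('a \<Rightarrow> 'a) \<Rightarrow> 'a \<Rightarrow> 'a" where
  "op_add H S T = (\<lambda>x\<in>carrier H. S x \<oplus>\<^bsub>H\<^esub> T x)"

definition op_scale :: "'a hilbert \<Rightarrow> complex \<Rightarrow> ('a \<Rightarrow> 'a) \<Rightarrow> 'a \<Rightarrow> 'a" where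
  "op_scale H c T = (\<lambda>x\<in>carrier H. c \<odot>\<^bsub>H\<^esub> T x)"

definition op_mult :: "'a hilbert \<Rightarrow> ('a \<Rightarrow> 'a) \<Rightarrow> ('a \<Rightarrow> 'a) \<Rightarrow> 'a \<Rightarrow> 'a" where
  "op_mult H S T = compose (carrier H) S T"

definition is_adjoint :: "'a hilbert \<Rightarrow> ('a \<Rightarrow> 'a) \<Rightarrow> ('a \<Rightarrow> 'a) \<Rightarrow> bool" where
  "is_adjoint H T S \<longleftrightarrow> T \<in> bounded_ops H \<and> S \<in> bounded_ops H \<and>
     (\<forall>x\<in>carrier H. \<forall>y\<in>carrier H. hinner H (T x) y = hinner H x (S y))"

definition star_subalgebra :: "'a hilbert \<Rightarrow> ('a \<Rightarrow> 'a) set \<Rightarrow> bool" where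
  "star_subalgebra H M \<longleftrightarrow> M \<subseteq> bounded_ops H \<and> M \<noteq> {} \<and>
     (\<forall>S\<in>M. \<forall>T\<in>M. op_add H S T \<in> M) \<and>
     (\<forall>c. \<forall>T\<in>M. op_scale H c T \<in> M) \<and>
     (\<forall>S\<in>M. \<forall>T\<in>M. op_mult H S T \<in> M) \<and>
     (\<forall>T\<in>M. \<exists>S\<in>M. is_adjoint H T S)"

definition commutant :: "'a hilbert \<Rightarrow> ('a \<Rightarrow> 'a) set \<Rightarrow> ('a \<Rightarrow> 'a) set" where
  "commutant H M = {T \<in> bounded_ops H. \<forall>S\<in>M. op_mult H T S = op_mult H S T}"


section \<open>Von Neumann algebras and generating sets\<close>

text \<open>A von Neumann algebra on \<open>H\<close> is defined as by Dixmier and Takesaki. In particular it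
  contains the identity of \<open>H\<close>, so any two von Neumann algebras on \<open>H\<close> have the same unit.\<close>

definition von_neumann_algebra :: "'a hilbert \<Rightarrow> ('a \<Rightarrow> 'a) set \<Rightarrow> bool" where
  "von_neumann_algebra H M \<longleftrightarrow>
     hilbert_space H \<and> star_subalgebra H M \<and> commutant H (commutant H M) = M"

definition generates :: "'a hilbert \<Rightarrow> ('a \<Rightarrow> 'a) set \<Rightarrow> ('a \<Rightarrow> 'a) set \<Rightarrow> bool" where
  "generates H S M \<longleftrightarrow> von_neumann_algebra H M \<and> S \<subseteq> M \<and>
     (\<forall>N. von_neumann_algebra H N \<and> S \<subseteq> N \<longrightarrow> M \<subseteq> N)"

definition countably_generated :: "'a hilbert \<Rightarrow> ('a \<Rightarrow> 'a) set \<Rightarrow> bool" where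
  "countably_generated H M \<longleftrightarrow> (\<exists>S. countable S \<and> generates H S M)"

definition singly_generated :: "'a hilbert \<Rightarrow> ('a \<Rightarrow> 'a) set \<Rightarrow> bool" where
  "singly_generated H M \<longleftrightarrow> (\<exists>T. generates H {T} M)"


section \<open>Faithful normal representations\<close>

text \<open>The \<open>\<sigma>\<close>-weak (ultraweak) topology on the bounded operators: the coarsest topology making
  all functionals \<open>T \<mapsto> \<Sum>n. \<langle>T \<xi>\<^sub>n, \<eta>\<^sub>n\<rangle>\<close> with square-summable sequences \<open>\<xi>\<close>, \<open>\<eta>\<close>
  continuous.\<close>

definition square_summable :: "'a hilbert \<Rightarrow> (nat \<Rightarrow> 'a) \<Rightarrow> bool" where
  "square_summable H \<xi> \<longleftrightarrow> range \<xi> \<subseteq> carrier H \<and> summable (\<lambda>n. (hnorm H (\<xi> n))\<^sup>2)"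

definition sigma_weak_topology :: "'a hilbert \<Rightarrow> ('a \<Rightarrow> 'a) topology" where
  "sigma_weak_topology H = topology_generated_by
     {{T \<in> bounded_ops H. (\<Sum>n. hinner H (T (\<xi> n)) (\<eta> n)) \<in> U} | \<xi> \<eta> U.
       square_summable H \<xi> \<and> square_summable H \<eta> \<and> open U}"

text \<open>Normality of a representation is its continuity for the \<open>\<sigma>\<close>-weak topologies.\<close>

definition faithful_normal_representation ::
  "'a hilbert \<Rightarrow> ('a \<Rightarrow> 'a) set \<Rightarrow> 'b hilbert \<Rightarrow> (('a \<Rightarrow> 'a) \<Rightarrow> ('b \<Rightarrow> 'b)) \<Rightarrow> bool" where
  "faithful_normal_representation H M K \<pi> \<longleftrightarrow>
     \<pi> ` M \<subseteq> bounded_ops K \<and>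
     (\<forall>S\<in>M. \<forall>T\<in>M. \<pi> (op_add H S T) = op_add K (\<pi> S) (\<pi> T)) \<and>
     (\<forall>c. \<forall>T\<in>M. \<pi> (op_scale H c T) = op_scale K c (\<pi> T)) \<and>
     (\<forall>S\<in>M. \<forall>T\<in>M. \<pi> (op_mult H S T) = op_mult K (\<pi> S) (\<pi> T)) \<and>
     (\<forall>T\<in>M. \<forall>S\<in>M. is_adjoint H T S \<longrightarrow> is_adjoint K (\<pi> T) (\<pi> S)) \<and>
     \<pi> (op_one H) = op_one K \<and>
     inj_on \<pi> M \<and>
     continuous_map (subtopology (sigma_weak_topology H) M) (sigma_weak_topology K) \<pi>"

text \<open>
  Taking the separable space \<open>K\<close> over the same type as \<open>H\<close> loses nothing. If \<open>H\<close> is nonzero, its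
  carrier, hence the type, has at least the cardinality of the continuum, so every separable Hilbert
  space has an isometric copy over this type. If \<open>H\<close> is zero, one can take \<open>K = H\<close>.
\<close>

definition separably_acting :: "'a hilbert \<Rightarrow> ('a \<Rightarrow> 'a) set \<Rightarrow> bool" where
  "separably_acting H M \<longleftrightarrow>
     (\<exists>(K :: 'a hilbert) \<pi>. separable_hilbert_space K \<and> faithful_normal_representation H M K \<pi>)"

end

theory Submission
  imports Defs
begin

text \<open>
  A separably-acting algebra is countably generated because its unit ball is weakly compact: a
  countable subset that is dense for the countably many functionals \<open>T \<mapsto> \<langle>\<pi> T d, d'\<rangle>\<close> has every
  element of the ball as a weak cluster point.

  Conversely, let \<open>M\<close> be generated by a countable self-adjoint multiplicative set \<open>A\<close>. By Zorn's lemma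
  the space is the orthogonal sum of central pieces \<open>Z x\<close>, the closed spans of \<open>M' A x\<close>. The algebra on
  \<open>Z x\<close> is represented faithfully on the separable closed span of \<open>A x\<close>, hence has a single generator;
  these are glued to an element \<open>a + \<i> b\<close> of \<open>M\<close>. The vector states \<open>\<langle>\<cdot> x, x\<rangle>\<close> of different pieces differ
  on \<open>A\<close>, so countably many central symmetries separate the pieces. Together with the binary digits of
  \<open>a\<close>, which are symmetries as well, they are the ternary digits of a single self-adjoint element \<open>t\<close>,
  and \<open>t + \<i> b\<close> generates \<open>M\<close>.
\<close>

section \<open>Inner products and orthogonal projections\<close>

text \<open>The obstacle in the converse is the size of the centre: there may be uncountably many
  central pieces. Each piece is however labelled by its state on the countable set \<open>A\<close>,
  a point of a second countable space, so countably many yes/no questions tell any two pieces apart.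

  A generator has only two self-adjoint slots. The imaginary part \<open>b\<close> stays as it is,
  so the real part must carry both \<open>a\<close> and the labels. This is why \<open>a\<close> is
  cut into digits: digits and labels are commuting symmetries, and countably many of these can be
  packed into one self-adjoint operator. Base 3 with digits 1 and -1 leaves gaps between the values,
  as in the Cantor set, so that each digit can be read back; base 2 would admit ambiguous
  expansions.

  No spectral theorem enters. Absolute values come from an iteration, digits are recovered by norm
  estimates on commutators, infinite gluing is a weak cluster point, and generation is tested by
  comparing commutants.\<close>

context hilbert_space
begin

abbreviation ip :: "'a \<Rightarrow> 'a \<Rightarrow> complex" where "ip \<equiv> hinner H"
abbreviation V :: "'a set" where "V \<equiv> carrier H"
abbreviation nrm :: "'a \<Rightarrow> real" where "nrm \<equiv> hnorm H"
abbreviation Op :: "('a \<Rightarrow> 'a) set" where "Op \<equiv> bounded_ops H"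

lemma smultV [simp, intro]: "x \<in> V \<Longrightarrow> c \<odot> x \<in> V"
  using smult_closed[of c x] by (simp add: complex_ring_def)

lemma ip_add_right [simp]: "\<lbrakk>x \<in> V; y \<in> V; z \<in> V\<rbrakk> \<Longrightarrow> ip z (x \<oplus> y) = ip z x + ip z y"
  using hinner_add_left[of x y z] hinner_commute by (metis M.add.m_closed complex_cnj_add)

lemma ip_smult_right [simp]: "\<lbrakk>x \<in> V; y \<in> V\<rbrakk> \<Longrightarrow> ip y (c \<odot> x) = cnj c * ip y x"
  using hinner_smult_left[of x y c] hinner_commute by (metis smultV complex_cnj_mult)

declare hinner_add_left [simp] hinner_smult_left [simp]

lemma ip_zero_left [simp]: "x \<in> V \<Longrightarrow> ip \<zero> x = 0"
  using hinner_add_left[of \<zero> \<zero> x] by simp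

lemma ip_zero_right [simp]: "x \<in> V \<Longrightarrow> ip x \<zero> = 0"
  using ip_add_right[of \<zero> \<zero> x] by simp

lemma ip_minus_left [simp]: "\<lbrakk>x \<in> V; y \<in> V\<rbrakk> \<Longrightarrow> ip (\<ominus> x) y = - ip x y"
  using hinner_add_left[of x "\<ominus> x" y] M.r_neg[of x]
  by (metis M.add.inv_closed add_eq_0_iff ip_zero_left)

lemma ip_minus_right [simp]: "\<lbrakk>x \<in> V; y \<in> V\<rbrakk> \<Longrightarrow> ip y (\<ominus> x) = - ip y x"
  using ip_add_right[of x "\<ominus> x" y] M.r_neg[of x]
  by (metis M.add.inv_closed add_eq_0_iff ip_zero_right)

lemma ip_diff [simp]:
  "\<lbrakk>x \<in> V; y \<in> V; z \<in> V\<rbrakk> \<Longrightarrow> ip (x \<ominus> y) z = ip x z - ip y z"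
  "\<lbrakk>x \<in> V; y \<in> V; z \<in> V\<rbrakk> \<Longrightarrow> ip z (x \<ominus> y) = ip z x - ip z y"
  by (simp_all add: a_minus_def)

lemma ip_self_zero: "x \<in> V \<Longrightarrow> ip x x = 0 \<longleftrightarrow> x = \<zero>"
  using hinner_eq_zero by auto

lemma diff_eq_zero: "\<lbrakk>x \<in> V; y \<in> V\<rbrakk> \<Longrightarrow> x \<ominus> y = \<zero> \<longleftrightarrow> x = y"
  by (metis M.minus_equality M.r_neg M.add.inv_closed M.minus_minus a_minus_def M.a_comm)

lemma vec_eqI:
  assumes "x \<in> V" "y \<in> V" "\<And>z. z \<in> V \<Longrightarrow> ip x z = ip y z"
  shows "x = y"
proof -
  have "ip (x \<ominus> y) (x \<ominus> y) = 0"
    using assms(1,2) assms(3)[of "x \<ominus> y"] by (subst ip_diff(1)) (simp_all del: ip_diff)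
  then have "x \<ominus> y = \<zero>" using assms ip_self_zero[of "x \<ominus> y"] by blast
  then show ?thesis using assms(1,2) diff_eq_zero by blast
qed

lemma ip_self: "x \<in> V \<Longrightarrow> ip x x = complex_of_real ((nrm x)\<^sup>2)"
  using hinner_commute[of x x] hinner_ge_zero[of x]
  by (simp add: hnorm_def complex_eq_iff)

lemma Re_ip_self: "x \<in> V \<Longrightarrow> Re (ip x x) = (nrm x)\<^sup>2"
  by (simp add: ip_self)

lemma nrm_ge_0 [simp]: "x \<in> V \<Longrightarrow> 0 \<le> nrm x"
  by (simp add: hnorm_def hinner_ge_zero)

lemma nrm_eq_0: "x \<in> V \<Longrightarrow> nrm x = 0 \<longleftrightarrow> x = \<zero>"
  using ip_self[of x] ip_self_zero[of x] by auto

lemma nrm_le_iff: "\<lbrakk>x \<in> V; y \<in> V\<rbrakk> \<Longrightarrow> nrm x \<le> nrm y \<longleftrightarrow> Re (ip x x) \<le> Re (ip y y)"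
  by (simp add: hnorm_def)

text \<open>Formulated for positive semidefinite forms because it is also applied to
  \<open>ip (T x) y\<close> with \<open>T\<close> positive, where nonzero vectors may have length
  zero.\<close>

lemma form_Cauchy_Schwarz:
  fixes B :: "'a \<Rightarrow> 'a \<Rightarrow> complex"
  assumes addl: "\<And>x y z. \<lbrakk>x \<in> V; y \<in> V; z \<in> V\<rbrakk> \<Longrightarrow> B (x \<oplus> y) z = B x z + B y z"
    and scl: "\<And>c x y. \<lbrakk>x \<in> V; y \<in> V\<rbrakk> \<Longrightarrow> B (c \<odot> x) y = c * B x y"
    and herm: "\<And>x y. \<lbrakk>x \<in> V; y \<in> V\<rbrakk> \<Longrightarrow> B y x = cnj (B x y)"
    and pos: "\<And>x. x \<in> V \<Longrightarrow> 0 \<le> Re (B x x)"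
    and x: "x \<in> V" and y: "y \<in> V"
  shows "(cmod (B x y))\<^sup>2 \<le> Re (B x x) * Re (B y y)"
proof -
  have addr: "B z (u \<oplus> v) = B z u + B z v" if "u \<in> V" "v \<in> V" "z \<in> V" for u v z
    using that addl[of u v z] herm by (metis M.add.m_closed complex_cnj_add)
  have scr: "B v (c \<odot> u) = cnj c * B v u" if "u \<in> V" "v \<in> V" for u v c
    using that scl[of u v c] herm by (metis smultV complex_cnj_mult)
  define t where "t = cmod (B x y)"
  define p q where "p = Re (B x x)" and "q = Re (B y y)"
  have imy: "B y y = of_real q" "B x x = of_real p"
    using herm[of y y] herm[of x x] x y by (auto simp: complex_eq_iff p_def q_def)
  have key: "0 \<le> Re (B x x) - 2 * r * t\<^sup>2 + r\<^sup>2 * t\<^sup>2 * Re (B y y)" for r :: real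
  proof -
    \<comment> \<open>The factor \<open>B x y\<close> rotates \<open>y\<close> so that the cross
      terms become real: along this line the form is a real quadratic in \<open>r\<close>.\<close>
    define c where "c = - of_real r * B x y"
    have "B (x \<oplus> c \<odot> y) (x \<oplus> c \<odot> y) =
       B x x + cnj c * B x y + c * cnj (B x y) + c * cnj c * B y y"
      using x y herm[of x y] by (simp add: addl addr scl scr algebra_simps)
    also have "\<dots> = B x x - 2 * of_real r * (B x y * cnj (B x y))
        + (of_real r)\<^sup>2 * (B x y * cnj (B x y)) * B y y"
      by (simp add: c_def power2_eq_square algebra_simps)
    also have "B x y * cnj (B x y) = of_real (t\<^sup>2)"
      unfolding t_def by (metis complex_norm_square)
    finally have "Re (B (x \<oplus> c \<odot> y) (x \<oplus> c \<odot> y)) =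
        Re (B x x) - 2 * r * t\<^sup>2 + r\<^sup>2 * t\<^sup>2 * Re (B y y)"
      unfolding imy by (simp flip: of_real_mult of_real_power of_real_diff of_real_add)
    moreover have "0 \<le> Re (B (x \<oplus> c \<odot> y) (x \<oplus> c \<odot> y))" using x y by (intro pos) simp
    ultimately show ?thesis by simp
  qed
  show ?thesis
  proof (cases "Re (B y y) = 0")
    \<comment> \<open>The quadratic is now affine in \<open>r\<close> and bounded below by 0, so its
      slope vanishes.\<close>
    case True
    have "t\<^sup>2 = 0"
    proof (rule ccontr)
      assume "t\<^sup>2 \<noteq> 0"
      then have "t\<^sup>2 > 0" by auto
      have "0 \<le> Re (B x x) - 2 * ((Re (B x x) + 1) / t\<^sup>2) * t\<^sup>2"
        using key[of "(Re (B x x) + 1) / t\<^sup>2"] True by simp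
      then have "0 \<le> Re (B x x) - 2 * (Re (B x x) + 1)" using \<open>t\<^sup>2 > 0\<close> by simp
      then show False using pos[OF x] by simp
    qed
    then show ?thesis using True t_def by simp
  next
    case False
    then have p: "Re (B y y) > 0" using pos[OF y] by simp
    show ?thesis using key[of "1 / Re (B y y)"] p
      by (simp add: t_def power2_eq_square field_simps)
  qed
qed

lemma Cauchy_Schwarz: "\<lbrakk>x \<in> V; y \<in> V\<rbrakk> \<Longrightarrow> cmod (ip x y) \<le> nrm x * nrm y"
proof -
  assume a: "x \<in> V" "y \<in> V"
  have "(cmod (ip x y))\<^sup>2 \<le> Re (ip x x) * Re (ip y y)"
    by (rule form_Cauchy_Schwarz) (auto simp: a hinner_ge_zero intro: hinner_commute)
  then have "(cmod (ip x y))\<^sup>2 \<le> (nrm x * nrm y)\<^sup>2"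
    using a by (simp add: Re_ip_self power_mult_distrib)
  then show ?thesis by (rule power2_le_imp_le) (use a in auto)
qed

lemma nrm_smult [simp]: "x \<in> V \<Longrightarrow> nrm (c \<odot> x) = cmod c * nrm x"
proof -
  assume a: "x \<in> V"
  have "(nrm (c \<odot> x))\<^sup>2 = Re ((c * cnj c) * ip x x)"
    using a by (simp flip: Re_ip_self add: algebra_simps)
  also have "\<dots> = (cmod c * nrm x)\<^sup>2"
    using a by (simp add: ip_self power_mult_distrib flip: complex_norm_square of_real_mult of_real_power)
  finally show ?thesis using a by (simp add: power2_eq_iff_nonneg)
qed

lemma nrm_triangle: "\<lbrakk>x \<in> V; y \<in> V\<rbrakk> \<Longrightarrow> nrm (x \<oplus> y) \<le> nrm x + nrm y"
proof -
  assume a: "x \<in> V" "y \<in> V"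
  have "(nrm (x \<oplus> y))\<^sup>2 = (nrm x)\<^sup>2 + (nrm y)\<^sup>2 + 2 * Re (ip x y)"
    using a hinner_commute[of x y] by (simp flip: Re_ip_self)
  also have "\<dots> \<le> (nrm x)\<^sup>2 + (nrm y)\<^sup>2 + 2 * (nrm x * nrm y)"
    using Cauchy_Schwarz[OF a] complex_Re_le_cmod[of "ip x y"] by simp
  also have "\<dots> = (nrm x + nrm y)\<^sup>2" by (simp add: power2_sum)
  finally show ?thesis by (rule power2_le_imp_le) (use a in auto)
qed

lemma nrm_zero [simp]: "nrm \<zero> = 0"
  by (simp add: nrm_eq_0)

lemma nrm_minus [simp]: "x \<in> V \<Longrightarrow> nrm (\<ominus> x) = nrm x"
  by (simp add: hnorm_def)

lemma nrm_diff_commute: "\<lbrakk>x \<in> V; y \<in> V\<rbrakk> \<Longrightarrow> nrm (x \<ominus> y) = nrm (y \<ominus> x)"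
  by (simp add: hnorm_def)

lemma nrm_diff_triangle: "\<lbrakk>x \<in> V; y \<in> V; z \<in> V\<rbrakk> \<Longrightarrow> nrm (x \<ominus> z) \<le> nrm (x \<ominus> y) + nrm (y \<ominus> z)"
proof -
  assume a: "x \<in> V" "y \<in> V" "z \<in> V"
  have "x \<ominus> z = (x \<ominus> y) \<oplus> (y \<ominus> z)" using a by (intro vec_eqI) auto
  then show ?thesis using nrm_triangle[of "x \<ominus> y" "y \<ominus> z"] a by simp
qed

lemma metric: "Metric_space V (hdist H)"
proof
  show "hdist H x y = hdist H y x" for x y by (simp add: hdist_def nrm_diff_commute)
  show "0 \<le> hdist H x y" for x y by (simp add: hdist_def)
  show "(hdist H x y = 0) = (x = y)" if "x \<in> V" "y \<in> V" for x y
    using that nrm_eq_0[of "x \<ominus> y"] by (simp add: hdist_def diff_eq_zero)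
  show "hdist H x z \<le> hdist H x y + hdist H y z" if "x \<in> V" "y \<in> V" "z \<in> V" for x y z
    using that nrm_diff_triangle by (simp add: hdist_def)
qed

sublocale MS: Metric_space V "hdist H" by (rule metric)

lemma parallelogram:
  "\<lbrakk>x \<in> V; y \<in> V\<rbrakk> \<Longrightarrow> (nrm (x \<oplus> y))\<^sup>2 + (nrm (x \<ominus> y))\<^sup>2 = 2 * (nrm x)\<^sup>2 + 2 * (nrm y)\<^sup>2"
  by (simp flip: Re_ip_self)

lemma complete_seq:
  assumes V: "\<And>n. s n \<in> V"
    and C: "\<And>e. e > 0 \<Longrightarrow> \<exists>N. \<forall>m\<ge>N. \<forall>n\<ge>N. nrm (s m \<ominus> s n) < e"
  shows "\<exists>l\<in>V. (\<lambda>n. nrm (s n \<ominus> l)) \<longlonglongrightarrow> 0"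
proof -
  have "MS.MCauchy s" unfolding MS.MCauchy_def using V C
    by (auto simp: hdist_def)
  then obtain l where l: "limitin MS.mtopology s l sequentially"
    using complete unfolding MS.mcomplete_def by blast
  then have lV: "l \<in> V" and "\<forall>e>0. \<forall>\<^sub>F n in sequentially. s n \<in> V \<and> hdist H (s n) l < e"
    unfolding MS.limitin_metric by auto
  then have "\<forall>e>0. \<forall>\<^sub>F n in sequentially. nrm (s n \<ominus> l) < e"
    by (simp add: hdist_def V)
  then have "(\<lambda>n. nrm (s n \<ominus> l)) \<longlonglongrightarrow> 0"
    using V lV by (auto intro!: tendstoI)
  then show ?thesis using lV by blast
qed

text \<open>Only rational multiples are used, so that the lemma applies to countable \<open>L\<close>.\<close>

lemma projection_approx:
  assumes L: "L \<subseteq> V" "L \<noteq> {}"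
    and add: "\<And>x y. \<lbrakk>x \<in> L; y \<in> L\<rbrakk> \<Longrightarrow> x \<oplus> y \<in> L"
    and sc: "\<And>x p q. \<lbrakk>x \<in> L; p \<in> \<rat>; q \<in> \<rat>\<rbrakk> \<Longrightarrow> Complex p q \<odot> x \<in> L"
    and v: "v \<in> V"
  shows "\<exists>k\<in>V. (\<forall>e>0. \<exists>x\<in>L. nrm (x \<ominus> k) < e) \<and> (\<forall>x\<in>L. ip (v \<ominus> k) x = 0)"
proof -
  define D where "D = (\<lambda>x. (nrm (v \<ominus> x))\<^sup>2) ` L"
  define d where "d = Inf D"
  have bdd: "bdd_below D" unfolding D_def by (rule bdd_belowI[of _ 0]) auto
  have dle: "d \<le> (nrm (v \<ominus> x))\<^sup>2" if "x \<in> L" for x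
    unfolding d_def using bdd that by (intro cInf_lower) (auto simp: D_def)
  have "\<exists>x\<in>L. (nrm (v \<ominus> x))\<^sup>2 < d + 1 / real (Suc n)" for n
  proof -
    have "Inf D < d + 1 / real (Suc n)" by (simp add: d_def)
    then obtain t where "t \<in> D" "t < d + 1 / real (Suc n)"
      using cInf_lessD[of D] L(2) by (auto simp: D_def)
    then show ?thesis by (auto simp: D_def)
  qed
  then obtain s where sL: "\<And>n. s n \<in> L" and s: "\<And>n. (nrm (v \<ominus> s n))\<^sup>2 < d + 1 / real (Suc n)"
    by metis
  have sV: "s n \<in> V" for n using sL L by auto
  have est: "(nrm (s m \<ominus> s n))\<^sup>2 \<le> 2 / real (Suc m) + 2 / real (Suc n)" for m n
  proof -
    \<comment> \<open>The midpoint of \<open>s m\<close> and \<open>s n\<close> lies in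
      \<open>L\<close>, so the parallelogram law makes the minimizing sequence Cauchy.\<close>
    define h where "h = Complex (1/2) 0 \<odot> (s m \<oplus> s n)"
    have hL: "h \<in> L" unfolding h_def using sL by (intro sc add) auto
    then have hV: "h \<in> V" using L by auto
    have "(nrm ((v \<ominus> s m) \<oplus> (v \<ominus> s n)))\<^sup>2 = (nrm (2 \<odot> (v \<ominus> h)))\<^sup>2"
    proof -
      have "(v \<ominus> s m) \<oplus> (v \<ominus> s n) = 2 \<odot> (v \<ominus> h)"
        using v sV hV by (intro vec_eqI) (auto simp: h_def complex_eq_iff algebra_simps)
      then show ?thesis by simp
    qed
    also have "\<dots> \<ge> 4 * d" using dle[OF hL] v hV by (simp add: power_mult_distrib)
    finally have 1: "4 * d \<le> (nrm ((v \<ominus> s m) \<oplus> (v \<ominus> s n)))\<^sup>2" .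
    have "(nrm ((v \<ominus> s m) \<ominus> (v \<ominus> s n)))\<^sup>2 = (nrm (s m \<ominus> s n))\<^sup>2"
    proof -
      have "(v \<ominus> s m) \<ominus> (v \<ominus> s n) = \<ominus> (s m \<ominus> s n)"
        using v sV by (intro vec_eqI) auto
      then show ?thesis using sV by simp
    qed
    then show ?thesis
      using parallelogram[of "v \<ominus> s m" "v \<ominus> s n"] 1 s[of m] s[of n] v sV
      by simp
  qed
  have "\<exists>N. \<forall>m\<ge>N. \<forall>n\<ge>N. nrm (s m \<ominus> s n) < e" if e: "e > 0" for e
  proof -
    obtain N where N: "4 / e\<^sup>2 < real N" using reals_Archimedean2 by blast
    have "nrm (s m \<ominus> s n) < e" if "m \<ge> N" "n \<ge> N" for m n
    proof -
      have "N > 0" using N e by (metis divide_nonneg_nonneg gr0I less_le_not_le of_nat_0 zero_le_numeral zero_le_power2)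
      have "2 / real (Suc m) \<le> 2 / real N" "2 / real (Suc n) \<le> 2 / real N"
        using that \<open>N > 0\<close> by (auto intro!: divide_left_mono)
      then have "(nrm (s m \<ominus> s n))\<^sup>2 \<le> 4 / real N" using est[of m n] by simp
      also have "\<dots> < e\<^sup>2" using N e \<open>N > 0\<close> by (simp add: field_simps)
      finally show ?thesis by (rule power2_less_imp_less) (use e in auto)
    qed
    then show ?thesis by blast
  qed
  then obtain k where k: "k \<in> V" and lim: "(\<lambda>n. nrm (s n \<ominus> k)) \<longlonglongrightarrow> 0"
    using complete_seq[of s] sV by blast
  have dk: "(nrm (v \<ominus> k))\<^sup>2 \<le> d"
  proof (rule LIMSEQ_le)
    show "(\<lambda>n. (nrm (v \<ominus> k))\<^sup>2) \<longlonglongrightarrow> (nrm (v \<ominus> k))\<^sup>2" by simp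
    have "(\<lambda>n. (sqrt (d + 1 / real (Suc n)) + nrm (s n \<ominus> k))\<^sup>2) \<longlonglongrightarrow> (sqrt (d + 0) + 0)\<^sup>2"
      by (intro tendsto_intros lim LIMSEQ_Suc lim_1_over_n)
    moreover have "0 \<le> d" unfolding d_def using L(2) by (intro cInf_greatest) (auto simp: D_def)
    ultimately show "(\<lambda>n. (sqrt (d + 1 / real (Suc n)) + nrm (s n \<ominus> k))\<^sup>2) \<longlonglongrightarrow> d"
      by simp
    show "\<exists>N. \<forall>n\<ge>N. (nrm (v \<ominus> k))\<^sup>2 \<le> (sqrt (d + 1 / real (Suc n)) + nrm (s n \<ominus> k))\<^sup>2"
    proof (intro exI allI impI)
      fix n :: nat
      have "nrm (v \<ominus> k) \<le> nrm (v \<ominus> s n) + nrm (s n \<ominus> k)"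
        using nrm_diff_triangle v sV k by blast
      also have "nrm (v \<ominus> s n) \<le> sqrt (d + 1 / real (Suc n))"
        using s[of n] by (intro real_le_rsqrt) simp
      finally show "(nrm (v \<ominus> k))\<^sup>2 \<le> (sqrt (d + 1 / real (Suc n)) + nrm (s n \<ominus> k))\<^sup>2"
        using v k by (intro power_mono) auto
    qed
  qed
  have near: "\<exists>x\<in>L. nrm (x \<ominus> k) < e" if "e > 0" for e
  proof -
    have "\<forall>\<^sub>F n in sequentially. nrm (s n \<ominus> k) < e"
      using order_tendstoD(2)[OF lim that] .
    then show ?thesis using sL by (auto simp: eventually_sequentially)
  qed
  have ort: "ip (v \<ominus> k) x = 0" if x: "x \<in> L" for x
  proof -
    have xV: "x \<in> V" using x L by auto
    define w where "w = v \<ominus> k"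
    have w: "w \<in> V" using v k by (simp add: w_def)
    \<comment> \<open>\<open>k\<close> lies only in the closure of \<open>L\<close>, so the
      competitor is \<open>s n\<close> shifted by \<open>c \<odot> x\<close>, and minimality at
      \<open>w\<close> follows in the limit.\<close>
    have min: "(nrm w)\<^sup>2 \<le> (nrm (w \<ominus> c \<odot> x))\<^sup>2" if c: "Re c \<in> \<rat>" "Im c \<in> \<rat>" for c
    proof -
      have "c \<odot> x \<in> L" using sc[OF x, of "Re c" "Im c"] c by simp
      have "d \<le> (nrm (w \<ominus> c \<odot> x) + nrm (s n \<ominus> k))\<^sup>2" for n
      proof -
        have cx: "s n \<oplus> c \<odot> x \<in> L" using sL add \<open>c \<odot> x \<in> L\<close> by blast
        have "v \<ominus> (s n \<oplus> c \<odot> x) = (w \<ominus> c \<odot> x) \<oplus> \<ominus> (s n \<ominus> k)"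
          using v k sV xV w by (intro vec_eqI) (auto simp: w_def)
        then have "nrm (v \<ominus> (s n \<oplus> c \<odot> x)) \<le> nrm (w \<ominus> c \<odot> x) + nrm (s n \<ominus> k)"
          using nrm_triangle[of "w \<ominus> c \<odot> x" "\<ominus> (s n \<ominus> k)"] w xV sV k by simp
        then have "(nrm (v \<ominus> (s n \<oplus> c \<odot> x)))\<^sup>2 \<le> (nrm (w \<ominus> c \<odot> x) + nrm (s n \<ominus> k))\<^sup>2"
          using v sV xV by (intro power_mono) auto
        then show ?thesis using dle[OF cx] by simp
      qed
      moreover have "(\<lambda>n. (nrm (w \<ominus> c \<odot> x) + nrm (s n \<ominus> k))\<^sup>2) \<longlonglongrightarrow> (nrm (w \<ominus> c \<odot> x) + 0)\<^sup>2"
        by (intro tendsto_intros lim)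
      ultimately have "d \<le> (nrm (w \<ominus> c \<odot> x) + 0)\<^sup>2"
        by (intro LIMSEQ_le_const) auto
      then show ?thesis using dk w_def by simp
    qed
    have key: "2 * Re (c * ip x w) \<le> (cmod c)\<^sup>2 * (nrm x)\<^sup>2" if "Re c \<in> \<rat>" "Im c \<in> \<rat>" for c
    proof -
      have "(nrm (w \<ominus> c \<odot> x))\<^sup>2 = (nrm w)\<^sup>2 - 2 * Re (c * ip x w) + (nrm (c \<odot> x))\<^sup>2"
      proof -
        have "(nrm (w \<ominus> c \<odot> x))\<^sup>2 = (nrm w)\<^sup>2 - Re (ip w (c \<odot> x)) - Re (ip (c \<odot> x) w) + (nrm (c \<odot> x))\<^sup>2"
          using w xV
          by (simp flip: Re_ip_self del: ip_smult_right hinner_smult_left nrm_smult)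
        moreover have "Re (ip w (c \<odot> x)) = Re (ip (c \<odot> x) w)"
          by (metis hinner_commute smultV w xV cnj.simps(1))
        moreover have "ip (c \<odot> x) w = c * ip x w" using w xV by simp
        ultimately show ?thesis by simp
      qed
      then show ?thesis using min[OF that] xV by (simp add: power_mult_distrib)
    qed
    \<comment> \<open>Four directions bound the real and imaginary parts of \<open>ip x w\<close>
      from both sides; the length \<open>r = 1 / Suc n\<close> is rational and makes the quadratic
      term negligible.\<close>
    have z: "Re (u * ip x w) \<le> 0" if u: "u \<in> {1,-1,\<i>,-\<i>}" for u
    proof (rule ccontr)
      assume "\<not> Re (u * ip x w) \<le> 0"
      then have p: "Re (u * ip x w) > 0" by simp
      have le: "2 * Re (u * ip x w) \<le> (1 / real (Suc n)) * (nrm x)\<^sup>2" for n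
      proof -
        define r where "r = 1 / real (Suc n)"
        have r: "r > 0" "r \<in> \<rat>" by (auto simp: r_def)
        have c: "Re (of_real r * u) \<in> \<rat>" "Im (of_real r * u) \<in> \<rat>" using u r by auto
        have "cmod (of_real r * u) = r" using u r by (auto simp: norm_mult)
        then have "2 * Re (of_real r * u * ip x w) \<le> r\<^sup>2 * (nrm x)\<^sup>2"
          using key[OF c] by simp
        moreover define q where "q = Re (u * ip x w)"
        moreover have "Re (of_real r * u * ip x w) = r * q" by (simp add: algebra_simps q_def)
        ultimately have "r * (2 * q) \<le> r * (r * (nrm x)\<^sup>2)"
          by (simp only: power2_eq_square mult_ac)
        then have "r * (2 * Re (u * ip x w)) \<le> r * (r * (nrm x)\<^sup>2)" unfolding q_def .
        then show ?thesis using r(1) unfolding r_def by (metis mult_le_cancel_left_pos)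
      qed
      have "(\<lambda>n. (1 / real (Suc n)) * (nrm x)\<^sup>2) \<longlonglongrightarrow> 0 * (nrm x)\<^sup>2"
        by (intro tendsto_intros LIMSEQ_Suc lim_1_over_n)
      then have "2 * Re (u * ip x w) \<le> 0"
        using le by (intro LIMSEQ_le_const) auto
      then show False using p by simp
    qed
    have "ip x w = 0"
      using z[of 1] z[of "-1"] z[of \<i>] z[of "-\<i>"] by (simp add: complex_eq_iff)
    then show ?thesis using hinner_commute[of x w] w xV by (simp add: w_def)
  qed
  show ?thesis using k near ort by blast
qed

section \<open>The algebra of bounded operators\<close>

lemma OpD:
  assumes "T \<in> Op"
  shows Op_closed: "x \<in> V \<Longrightarrow> T x \<in> V"
    and Op_add: "\<lbrakk>x \<in> V; y \<in> V\<rbrakk> \<Longrightarrow> T (x \<oplus> y) = T x \<oplus> T y"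
    and Op_smult: "x \<in> V \<Longrightarrow> T (c \<odot> x) = c \<odot> T x"
    and Op_zero: "T \<zero> = \<zero>"
    and Op_minus: "x \<in> V \<Longrightarrow> T (\<ominus> x) = \<ominus> T x"
    and Op_diff: "\<lbrakk>x \<in> V; y \<in> V\<rbrakk> \<Longrightarrow> T (x \<ominus> y) = T x \<ominus> T y"
proof -
  show c: "x \<in> V \<Longrightarrow> T x \<in> V" for x using assms by (auto simp: bounded_ops_def)
  show a: "\<lbrakk>x \<in> V; y \<in> V\<rbrakk> \<Longrightarrow> T (x \<oplus> y) = T x \<oplus> T y" for x y
    using assms by (auto simp: bounded_ops_def)
  show s: "x \<in> V \<Longrightarrow> T (c \<odot> x) = c \<odot> T x" for x c using assms by (auto simp: bounded_ops_def)
  have m1: "\<ominus> x = (-1) \<odot> x" if "x \<in> V" for x using that by (intro vec_eqI) auto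
  have z: "\<zero> = 0 \<odot> \<zero>" by (intro vec_eqI) auto
  show "T \<zero> = \<zero>"
  proof -
    have "T \<zero> = 0 \<odot> T \<zero>" using s[of \<zero> 0] z by simp
    also have "\<dots> = \<zero>" using c[of \<zero>] by (intro vec_eqI) auto
    finally show ?thesis .
  qed
  show m: "x \<in> V \<Longrightarrow> T (\<ominus> x) = \<ominus> T x" for x using m1 s c by simp
  show "\<lbrakk>x \<in> V; y \<in> V\<rbrakk> \<Longrightarrow> T (x \<ominus> y) = T x \<ominus> T y" for x y
    by (simp add: a_minus_def a m)
qed

lemma Op_bounded: "T \<in> Op \<Longrightarrow> \<exists>C\<ge>0. \<forall>x\<in>V. nrm (T x) \<le> C * nrm x"
proof -
  assume "T \<in> Op"
  then obtain C where C: "\<forall>x\<in>V. nrm (T x) \<le> C * nrm x" by (auto simp: bounded_ops_def)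
  have "nrm (T x) \<le> \<bar>C\<bar> * nrm x" if "x \<in> V" for x
  proof -
    have "C * nrm x \<le> \<bar>C\<bar> * nrm x" using that by (intro mult_right_mono) auto
    then show ?thesis using C that by fastforce
  qed
  then show ?thesis by (intro exI[of _ "\<bar>C\<bar>"]) auto
qed

lemma Op_eqI: "\<lbrakk>S \<in> Op; T \<in> Op; \<And>x. x \<in> V \<Longrightarrow> S x = T x\<rbrakk> \<Longrightarrow> S = T"
  unfolding bounded_ops_def by (auto intro: PiE_ext)

lemma OpI:
  assumes "\<And>x. x \<in> V \<Longrightarrow> f x \<in> V" "\<And>x y. \<lbrakk>x \<in> V; y \<in> V\<rbrakk> \<Longrightarrow> f (x \<oplus> y) = f x \<oplus> f y"
    "\<And>c x. x \<in> V \<Longrightarrow> f (c \<odot> x) = c \<odot> f x" "\<And>x. x \<in> V \<Longrightarrow> nrm (f x) \<le> C * nrm x"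
  shows "restrict f V \<in> Op"
  unfolding bounded_ops_def using assms by (auto intro!: exI[of _ C])

lemma op_apps [simp]:
  assumes "x \<in> V"
  shows "op_one H x = x" "op_add H S T x = S x \<oplus> T x" "op_scale H c T x = c \<odot> T x"
    "op_mult H S T x = S (T x)"
  using assms by (simp_all add: op_one_def op_add_def op_scale_def op_mult_def compose_def)

lemma op_one_Op [simp]: "op_one H \<in> Op"
  unfolding op_one_def by (rule OpI[where C = 1]) auto

lemma op_add_Op [simp]: assumes "S \<in> Op" "T \<in> Op" shows "op_add H S T \<in> Op"
proof -
  note [simp] = OpD[OF assms(1)] OpD[OF assms(2)]
  obtain C D where "\<forall>x\<in>V. nrm (S x) \<le> C * nrm x" "\<forall>x\<in>V. nrm (T x) \<le> D * nrm x"
    using assms Op_bounded by meson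
  then have "nrm (S x \<oplus> T x) \<le> (C + D) * nrm x" if "x \<in> V" for x
    using nrm_triangle[of "S x" "T x"] that by (fastforce simp: distrib_right)
  then show ?thesis unfolding op_add_def
    by (intro OpI[where C = "C + D"]) (auto intro!: vec_eqI simp: algebra_simps)
qed

lemma op_scale_Op [simp]: assumes "T \<in> Op" shows "op_scale H c T \<in> Op"
proof -
  note [simp] = OpD[OF assms(1)]
  obtain D where "\<forall>x\<in>V. nrm (T x) \<le> D * nrm x"
    using assms Op_bounded by meson
  then have "nrm (c \<odot> T x) \<le> (cmod c * D) * nrm x" if "x \<in> V" for x
    using that by (simp add: mult.assoc mult_left_mono)
  then show ?thesis unfolding op_scale_def
    by (intro OpI[where C = "cmod c * D"]) (auto intro!: vec_eqI simp: algebra_simps)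
qed

lemma op_mult_Op [simp]: assumes "S \<in> Op" "T \<in> Op" shows "op_mult H S T \<in> Op"
proof -
  note [simp] = OpD[OF assms(1)] OpD[OF assms(2)]
  obtain C D where C: "C \<ge> 0" "\<forall>x\<in>V. nrm (S x) \<le> C * nrm x" and D: "\<forall>x\<in>V. nrm (T x) \<le> D * nrm x"
    using assms Op_bounded by meson
  have "nrm (S (T x)) \<le> (C * D) * nrm x" if "x \<in> V" for x
  proof -
    have "nrm (S (T x)) \<le> C * nrm (T x)" using C that by simp
    also have "\<dots> \<le> C * (D * nrm x)" using D that C(1) by (intro mult_left_mono) auto
    finally show ?thesis by (simp add: mult.assoc)
  qed
  then show ?thesis unfolding op_mult_def compose_def
    by (intro OpI[where C = "C * D"]) auto
qed

section \<open>Orthogonal complements, projections and the Riesz theorem\<close>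

definition perp :: "'a set \<Rightarrow> 'a set" where
  "perp S = {v \<in> V. \<forall>s\<in>S. ip v s = 0}"

lemma perp_subset [simp]: "perp S \<subseteq> V"
  by (auto simp: perp_def)

lemma perpV: "v \<in> perp S \<Longrightarrow> v \<in> V"
  by (auto simp: perp_def)

lemma perp_add: "\<lbrakk>S \<subseteq> V; x \<in> perp S; y \<in> perp S\<rbrakk> \<Longrightarrow> x \<oplus> y \<in> perp S"
  by (auto simp: perp_def subset_iff)

lemma perp_diff: "\<lbrakk>S \<subseteq> V; x \<in> perp S; y \<in> perp S\<rbrakk> \<Longrightarrow> x \<ominus> y \<in> perp S"
  by (auto simp: perp_def subset_iff)

lemma perp_smult: "\<lbrakk>S \<subseteq> V; x \<in> perp S\<rbrakk> \<Longrightarrow> c \<odot> x \<in> perp S"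
  by (auto simp: perp_def subset_iff)

lemma perp_zero: "S \<subseteq> V \<Longrightarrow> \<zero> \<in> perp S"
  by (auto simp: perp_def subset_iff)

lemma ip_eq_0_commute: "\<lbrakk>x \<in> V; y \<in> V\<rbrakk> \<Longrightarrow> ip x y = 0 \<longleftrightarrow> ip y x = 0"
  using hinner_commute[of x y] by auto

lemma subset_perp2: "S \<subseteq> V \<Longrightarrow> S \<subseteq> perp (perp S)"
  by (auto simp: perp_def subset_iff ip_eq_0_commute)

lemma perp3: "S \<subseteq> V \<Longrightarrow> perp (perp (perp S)) = perp S"
  using subset_perp2[of S] subset_perp2[of "perp S"] by (auto simp: perp_def)

lemma perp_perp2: "S \<subseteq> V \<Longrightarrow> x \<in> perp S \<Longrightarrow> y \<in> perp (perp S) \<Longrightarrow> ip x y = 0 \<and> ip y x = 0"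
  by (auto simp: perp_def ip_eq_0_commute)

lemma perp_closed:
  assumes S: "S \<subseteq> V" and k: "k \<in> V" and near: "\<And>e. e > 0 \<Longrightarrow> \<exists>x\<in>perp S. nrm (x \<ominus> k) < e"
  shows "k \<in> perp S"
proof -
  have "ip k s = 0" if s: "s \<in> S" for s
  proof (rule ccontr)
    assume n: "ip k s \<noteq> 0"
    have sV: "s \<in> V" using s S by auto
    have "nrm s \<noteq> 0" using n k sV nrm_eq_0[OF sV] by auto
    then have ns: "nrm s > 0" using nrm_ge_0[OF sV] by simp
    then obtain x where x: "x \<in> perp S" "nrm (x \<ominus> k) < cmod (ip k s) / nrm s"
      using near[of "cmod (ip k s) / nrm s"] n by auto
    have xV: "x \<in> V" "ip x s = 0" using x s by (auto simp: perp_def)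
    have "cmod (ip k s) = cmod (ip (x \<ominus> k) s)" using xV k sV by simp
    also have "\<dots> \<le> nrm (x \<ominus> k) * nrm s" using xV k sV by (intro Cauchy_Schwarz) auto
    also have "\<dots> < cmod (ip k s)" using x(2) ns by (simp add: field_simps)
    finally show False by simp
  qed
  then show ?thesis using k by (simp add: perp_def)
qed

text \<open>The nearest point \<open>k\<close> to \<open>v\<close> in the closure of
  \<open>L\<close> lies in the closed set \<open>perp (perp L)\<close>, and so does
  \<open>v\<close>; the error \<open>v \<ominus> k\<close> is then orthogonal to itself.\<close>

lemma dense_in_perp2:
  assumes L: "L \<subseteq> V" "L \<noteq> {}"
    and add: "\<And>x y. \<lbrakk>x \<in> L; y \<in> L\<rbrakk> \<Longrightarrow> x \<oplus> y \<in> L"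
    and sc: "\<And>x p q. \<lbrakk>x \<in> L; p \<in> \<rat>; q \<in> \<rat>\<rbrakk> \<Longrightarrow> Complex p q \<odot> x \<in> L"
    and v: "v \<in> perp (perp L)" and e: "e > 0"
  shows "\<exists>x\<in>L. nrm (x \<ominus> v) < e"
proof -
  have vV: "v \<in> V" using v perpV by blast
  obtain k where k: "k \<in> V" "\<And>e. e > 0 \<Longrightarrow> \<exists>x\<in>L. nrm (x \<ominus> k) < e" "\<forall>x\<in>L. ip (v \<ominus> k) x = 0"
    using projection_approx[OF L add sc vV] by blast
  have "k \<in> perp (perp L)"
    using k(1,2) subset_perp2[OF L(1)] by (intro perp_closed perp_subset) blast+
  then have 1: "v \<ominus> k \<in> perp (perp L)" using v by (intro perp_diff) auto
  have "v \<ominus> k \<in> perp L" using k vV by (simp add: perp_def)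
  then have "ip (v \<ominus> k) (v \<ominus> k) = 0" using 1 perp_perp2[OF L(1)] by blast
  then have "v = k" using vV k by (simp add: ip_self_zero diff_eq_zero del: ip_diff)
  then show ?thesis using k(2) e by blast
qed

text \<open>The approximation is made from \<open>perp (perp S)\<close>, which is closed, so the
  nearest point belongs to it.\<close>

lemma decompose:
  assumes S: "S \<subseteq> V" and v: "v \<in> V"
  shows "\<exists>k\<in>perp (perp S). v \<ominus> k \<in> perp S"
proof -
  have p: "perp S \<subseteq> V" by simp
  have "perp (perp S) \<noteq> {}" using perp_zero[OF p] by blast
  then have "\<exists>k\<in>V. (\<forall>e>0. \<exists>x\<in>perp (perp S). nrm (x \<ominus> k) < e) \<and>
      (\<forall>x\<in>perp (perp S). ip (v \<ominus> k) x = 0)"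
    by (rule projection_approx[OF perp_subset]) (auto intro: perp_add[OF p] perp_smult[OF p] v)
  then obtain k where k: "k \<in> V" "\<And>e. e > 0 \<Longrightarrow> \<exists>x\<in>perp (perp S). nrm (x \<ominus> k) < e"
      "\<forall>x\<in>perp (perp S). ip (v \<ominus> k) x = 0"
    by blast
  have "k \<in> perp (perp S)" using k(1,2) by (intro perp_closed) auto
  moreover have "v \<ominus> k \<in> perp (perp (perp S))" using k v by (simp add: perp_def)
  ultimately show ?thesis using perp3[OF S] by auto
qed

text \<open>\<open>perp (perp S)\<close> is the closed linear span of \<open>S\<close>, so this is
  the orthogonal projection onto that span.\<close>

definition proj :: "'a set \<Rightarrow> 'a \<Rightarrow> 'a" where
  "proj S = (\<lambda>v\<in>V. SOME k. k \<in> perp (perp S) \<and> v \<ominus> k \<in> perp S)"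

lemma proj_mem:
  assumes "S \<subseteq> V" "v \<in> V"
  shows "proj S v \<in> perp (perp S)" "v \<ominus> proj S v \<in> perp S" "proj S v \<in> V"
proof -
  have "proj S v \<in> perp (perp S) \<and> v \<ominus> proj S v \<in> perp S"
    unfolding proj_def using assms someI_ex[of "\<lambda>k. k \<in> perp (perp S) \<and> v \<ominus> k \<in> perp S"] decompose[OF assms]
    by auto
  then show "proj S v \<in> perp (perp S)" "v \<ominus> proj S v \<in> perp S" "proj S v \<in> V"
    using perpV by auto
qed

lemma proj_unique:
  assumes S: "S \<subseteq> V" and v: "v \<in> V" and k: "k \<in> perp (perp S)" "v \<ominus> k \<in> perp S"
  shows "proj S v = k"
proof -
  note m = proj_mem[OF S v]
  have kV: "k \<in> V" using k perpV by blast
  have 1: "proj S v \<ominus> k \<in> perp (perp S)" using m k by (intro perp_diff) auto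
  have "proj S v \<ominus> k = (v \<ominus> k) \<ominus> (v \<ominus> proj S v)" using v kV m by (intro vec_eqI) auto
  then have "proj S v \<ominus> k \<in> perp S" using m k S by (auto intro: perp_diff)
  then have "ip (proj S v \<ominus> k) (proj S v \<ominus> k) = 0" using 1 perp_perp2[OF S] by blast
  then show ?thesis using m kV by (simp add: ip_self_zero diff_eq_zero del: ip_diff)
qed

lemma proj_sa:
  assumes S: "S \<subseteq> V" and "v \<in> V" "w \<in> V"
  shows "ip (proj S v) w = ip v (proj S w)"
proof -
  note m = proj_mem[OF S assms(2)] proj_mem[OF S assms(3)]
  have "ip (proj S v) (w \<ominus> proj S w) = 0" "ip (v \<ominus> proj S v) (proj S w) = 0"
    using m perp_perp2[OF S] by blast+
  then show ?thesis using m assms by simp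
qed

lemma proj_Op: assumes S: "S \<subseteq> V" shows "proj S \<in> Op"
proof -
  note m [simp] = proj_mem(3)[OF S]
  have "restrict (proj S) V \<in> Op"
  proof (rule OpI[where C = 1])
    show "proj S (x \<oplus> y) = proj S x \<oplus> proj S y" if "x \<in> V" "y \<in> V" for x y
      using that by (intro vec_eqI) (simp_all add: proj_sa[OF S])
    show "proj S (c \<odot> x) = c \<odot> proj S x" if "x \<in> V" for x c
      using that by (intro vec_eqI) (simp_all add: proj_sa[OF S])
    show "nrm (proj S x) \<le> 1 * nrm x" if x: "x \<in> V" for x
    proof -
      have "ip (x \<ominus> proj S x) (proj S x) = 0"
        using proj_mem[OF S x] perp_perp2[OF S] by blast
      then have "(nrm (proj S x))\<^sup>2 = Re (ip x (proj S x))" using x by (simp flip: Re_ip_self)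
      also have "\<dots> \<le> nrm x * nrm (proj S x)"
        using Cauchy_Schwarz[of x "proj S x"] complex_Re_le_cmod[of "ip x (proj S x)"] x by simp
      finally have "nrm (proj S x) * nrm (proj S x) \<le> nrm x * nrm (proj S x)"
        by (simp add: power2_eq_square)
      then show ?thesis using x m[OF x] nrm_ge_0[OF m[OF x]] nrm_ge_0[OF x]
        by (metis less_eq_real_def mult_le_cancel_right mult_1 not_less)
    qed
  qed simp
  moreover have "restrict (proj S) V = proj S" by (auto simp: proj_def)
  ultimately show ?thesis by simp
qed

lemma proj_id: "S \<subseteq> V \<Longrightarrow> v \<in> perp (perp S) \<Longrightarrow> proj S v = v"
proof -
  assume a: "S \<subseteq> V" "v \<in> perp (perp S)"
  then have v: "v \<in> V" by (rule_tac perpV)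
  have "v \<ominus> v = \<zero>" using v by (intro vec_eqI) simp_all
  then show ?thesis using a v by (simp add: proj_unique perp_zero)
qed

lemma proj_zero: "S \<subseteq> V \<Longrightarrow> v \<in> perp S \<Longrightarrow> proj S v = \<zero>"
proof -
  assume a: "S \<subseteq> V" "v \<in> perp S"
  have v: "v \<in> V" using a(2) by (rule perpV)
  have "v \<ominus> \<zero> = v" using v by (intro vec_eqI) simp_all
  then show ?thesis using a v by (simp add: proj_unique perp_zero)
qed

lemma Riesz:
  assumes f: "\<And>x y. \<lbrakk>x \<in> V; y \<in> V\<rbrakk> \<Longrightarrow> f (x \<oplus> y) = f x + f y" "\<And>c x. x \<in> V \<Longrightarrow> f (c \<odot> x) = c * f x"
    and b: "\<And>x. x \<in> V \<Longrightarrow> cmod (f x) \<le> C * nrm x"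
  shows "\<exists>y\<in>V. \<forall>x\<in>V. f x = ip x y"
proof (cases "\<forall>x\<in>V. f x = 0")
  case True then show ?thesis by (intro bexI[of _ \<zero>]) auto
next
  case False
  then obtain v where v: "v \<in> V" "f v \<noteq> 0" by auto
  define L where "L = {x \<in> V. f x = 0}"
  have m1: "\<ominus> x = (-1) \<odot> x" if "x \<in> V" for x using that by (intro vec_eqI) auto
  have fd: "f (x \<ominus> y) = f x - f y" if "x \<in> V" "y \<in> V" for x y
    using that by (simp add: a_minus_def f m1)
  have "f \<zero> = 0" using f(1)[of \<zero> \<zero>] by simp
  then have "L \<noteq> {}" by (auto simp: L_def)
  then obtain k where k: "k \<in> V" "\<And>e. e > 0 \<Longrightarrow> \<exists>x\<in>L. nrm (x \<ominus> k) < e"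
      "\<forall>x\<in>L. ip (v \<ominus> k) x = 0"
    using projection_approx[of L v] v by (auto simp: L_def f)
  \<comment> \<open>\<open>k\<close> is a limit of zeros of the bounded functional
    \<open>f\<close>.\<close>
  have "f k = 0"
  proof (rule ccontr)
    assume n: "f k \<noteq> 0"
    have "cmod (f k) \<le> C * nrm k" using b k by blast
    then have "C * nrm k > 0" using n by (smt (verit) zero_less_norm_iff)
    then have C: "C > 0" using nrm_ge_0[OF k(1)] by (metis mult_le_0_iff not_less order.asym)
    then obtain x where x: "x \<in> L" "nrm (x \<ominus> k) < cmod (f k) / C" using k(2)[of "cmod (f k) / C"] n by auto
    then have "x \<in> V" by (auto simp: L_def)
    then have "cmod (f k) = cmod (f (x \<ominus> k))" using x k by (simp add: L_def fd)
    also have "\<dots> \<le> C * nrm (x \<ominus> k)" using b \<open>x \<in> V\<close> k by simp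
    also have "\<dots> < cmod (f k)" using x(2) C by (simp add: field_simps)
    finally show False by simp
  qed
  define w where "w = v \<ominus> k"
  have w: "w \<in> V" "f w \<noteq> 0" using v k \<open>f k = 0\<close> by (auto simp: w_def fd)
  then have "w \<noteq> \<zero>" using \<open>f \<zero> = 0\<close> by auto
  then have ww: "ip w w \<noteq> 0" using w ip_self_zero by blast
  have wL: "ip x w = 0" if "x \<in> L" for x using k(3) that w ip_eq_0_commute by (auto simp: w_def L_def)
  \<comment> \<open>Subtracting a suitable multiple of \<open>w\<close> from \<open>x\<close> gives
    an element of the kernel, hence orthogonal to \<open>w\<close>; this fixes the scaling of
    \<open>y\<close>.\<close>
  define y where "y = cnj (f w / ip w w) \<odot> w"
  have "f x = ip x y" if x: "x \<in> V" for x
  proof -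
    have "x \<ominus> (f x / f w) \<odot> w \<in> L" using x w by (simp add: L_def fd f)
    then have "ip x w = f x / f w * ip w w" using wL x w by fastforce
    then show ?thesis using ww w x by (simp add: y_def)
  qed
  moreover have "y \<in> V" using w by (simp add: y_def)
  ultimately show ?thesis by blast
qed

text \<open>Turns a family of matrix elements into an operator. It yields adjoints and, with
  \<open>C = 1\<close>, weak cluster points of contractions.\<close>

lemma form_operator:
  fixes B :: "'a \<Rightarrow> 'a \<Rightarrow> complex"
  assumes B: "\<And>x y z. \<lbrakk>x \<in> V; y \<in> V; z \<in> V\<rbrakk> \<Longrightarrow> B (x \<oplus> y) z = B x z + B y z"
      "\<And>c x y. \<lbrakk>x \<in> V; y \<in> V\<rbrakk> \<Longrightarrow> B (c \<odot> x) y = c * B x y"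
      "\<And>x y z. \<lbrakk>x \<in> V; y \<in> V; z \<in> V\<rbrakk> \<Longrightarrow> B z (x \<oplus> y) = B z x + B z y"
      "\<And>c x y. \<lbrakk>x \<in> V; y \<in> V\<rbrakk> \<Longrightarrow> B y (c \<odot> x) = cnj c * B y x"
    and b: "\<And>x y. \<lbrakk>x \<in> V; y \<in> V\<rbrakk> \<Longrightarrow> cmod (B x y) \<le> C * nrm x * nrm y" and C: "C \<ge> 0"
  shows "\<exists>T\<in>Op. (\<forall>x\<in>V. \<forall>y\<in>V. ip (T x) y = B x y) \<and> (\<forall>x\<in>V. nrm (T x) \<le> C * nrm x)"
proof -
  \<comment> \<open>\<open>B x\<close> is antilinear in its second argument, so \<open>Riesz\<close>
    is applied to the conjugate.\<close>
  have "\<exists>t\<in>V. \<forall>y\<in>V. cnj (B x y) = ip y t" if "x \<in> V" for x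
    using that b by (intro Riesz[where C = "C * nrm x"]) (auto simp: B)
  then obtain f where f: "\<And>x. x \<in> V \<Longrightarrow> f x \<in> V" "\<And>x y. \<lbrakk>x \<in> V; y \<in> V\<rbrakk> \<Longrightarrow> cnj (B x y) = ip y (f x)"
    by metis
  have ipf: "ip (f x) y = B x y" if "x \<in> V" "y \<in> V" for x y
    using that f hinner_commute by (metis complex_cnj_cnj)
  have n: "nrm (f x) \<le> C * nrm x" if x: "x \<in> V" for x
  proof -
    have "(nrm (f x))\<^sup>2 = Re (B x (f x))" using f x by (simp flip: Re_ip_self ipf)
    also have "\<dots> \<le> cmod (B x (f x))" by (rule complex_Re_le_cmod)
    also have "\<dots> \<le> C * nrm x * nrm (f x)" using b x f by auto
    finally have "nrm (f x) * nrm (f x) \<le> C * nrm x * nrm (f x)" by (simp add: power2_eq_square)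
    moreover have "0 \<le> nrm (f x)" "0 \<le> C * nrm x" using f x C by auto
    ultimately show ?thesis by (metis less_eq_real_def mult_le_cancel_right not_less)
  qed
  have "restrict f V \<in> Op"
    using f(1) n by (intro OpI[where C = C]) (auto intro!: vec_eqI simp: ipf B)
  then show ?thesis using ipf n by (intro bexI[of _ "restrict f V"]) auto
qed

section \<open>Adjoints, commutants and generation\<close>

definition contr :: "('a \<Rightarrow> 'a) \<Rightarrow> bool" where
  "contr T \<longleftrightarrow> (\<forall>x\<in>V. nrm (T x) \<le> nrm x)"

definition adj :: "('a \<Rightarrow> 'a) \<Rightarrow> 'a \<Rightarrow> 'a" where
  "adj T = (SOME S. S \<in> Op \<and> (\<forall>x\<in>V. \<forall>y\<in>V. ip (T x) y = ip x (S y)))"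

lemma adj_props: assumes T: "T \<in> Op"
  shows adj_Op: "adj T \<in> Op"
    and ip_adj: "\<lbrakk>x \<in> V; y \<in> V\<rbrakk> \<Longrightarrow> ip x (adj T y) = ip (T x) y"
    and ip_adj_left: "\<lbrakk>x \<in> V; y \<in> V\<rbrakk> \<Longrightarrow> ip (adj T x) y = ip x (T y)"
proof -
  note [simp] = OpD[OF T]
  obtain C where C: "C \<ge> 0" "\<forall>x\<in>V. nrm (T x) \<le> C * nrm x" using Op_bounded[OF T] by blast
  have "\<exists>S\<in>Op. (\<forall>x\<in>V. \<forall>y\<in>V. ip (S x) y = ip x (T y)) \<and> (\<forall>x\<in>V. nrm (S x) \<le> C * nrm x)"
  proof (rule form_operator)
    show "cmod (ip x (T y)) \<le> C * nrm x * nrm y" if "x \<in> V" "y \<in> V" for x y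
    proof -
      have "cmod (ip x (T y)) \<le> nrm x * nrm (T y)" using that by (simp add: Cauchy_Schwarz)
      also have "\<dots> \<le> nrm x * (C * nrm y)" using that C by (intro mult_left_mono) auto
      finally show ?thesis by (simp add: mult_ac)
    qed
  qed (auto simp: C)
  then obtain S where S: "S \<in> Op" "\<forall>x\<in>V. \<forall>y\<in>V. ip (S x) y = ip x (T y)" by blast
  note [simp] = OpD[OF S(1)]
  have "\<forall>x\<in>V. \<forall>y\<in>V. ip (T x) y = ip x (S y)"
  proof (intro ballI)
    fix x y assume a: "x \<in> V" "y \<in> V"
    have "ip (T x) y = cnj (ip y (T x))" using a by (intro hinner_commute) auto
    also have "\<dots> = cnj (ip (S y) x)" using S(2) a by simp
    also have "\<dots> = ip x (S y)" using hinner_commute[of "S y" x] a by simp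
    finally show "ip (T x) y = ip x (S y)" .
  qed
  then have ex: "\<exists>S. S \<in> Op \<and> (\<forall>x\<in>V. \<forall>y\<in>V. ip (T x) y = ip x (S y))" using S(1) by blast
  have a: "adj T \<in> Op \<and> (\<forall>x\<in>V. \<forall>y\<in>V. ip (T x) y = ip x (adj T y))"
    unfolding adj_def by (rule someI_ex[OF ex])
  then show "adj T \<in> Op" by blast
  note [simp] = OpD[OF this]
  show 1: "ip x (adj T y) = ip (T x) y" if "x \<in> V" "y \<in> V" for x y using a that by simp
  show "ip (adj T x) y = ip x (T y)" if "x \<in> V" "y \<in> V" for x y
  proof -
    have "ip (adj T x) y = cnj (ip y (adj T x))" using that by (intro hinner_commute) auto
    also have "\<dots> = cnj (ip (T y) x)" using 1[of y x] that by simp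
    also have "\<dots> = ip x (T y)" using that by (intro hinner_commute[symmetric]) auto
    finally show ?thesis .
  qed
qed

lemma adj_eqI: "\<lbrakk>T \<in> Op; S \<in> Op; \<And>x y. \<lbrakk>x \<in> V; y \<in> V\<rbrakk> \<Longrightarrow> ip (T x) y = ip x (S y)\<rbrakk> \<Longrightarrow> adj T = S"
proof (rule Op_eqI)
  assume a: "T \<in> Op" "S \<in> Op" "\<And>x y. \<lbrakk>x \<in> V; y \<in> V\<rbrakk> \<Longrightarrow> ip (T x) y = ip x (S y)"
  show "adj T x = S x" if "x \<in> V" for x
  proof (rule vec_eqI)
    fix z assume z: "z \<in> V"
    have "ip z (adj T x) = ip z (S x)" using a that z by (simp add: ip_adj)
    then show "ip (adj T x) z = ip (S x) z"
      using hinner_commute a z that by (metis adj_Op Op_closed)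
  qed (use a that adj_Op Op_closed in auto)
qed (auto intro: adj_Op)

lemma adj_adj: "T \<in> Op \<Longrightarrow> adj (adj T) = T"
  by (rule adj_eqI) (auto intro: adj_Op simp: ip_adj_left)

lemma is_adjoint_iff: "is_adjoint H T S \<longleftrightarrow> T \<in> Op \<and> S = adj T"
  unfolding is_adjoint_def by (auto intro: adj_eqI[symmetric] adj_Op simp: ip_adj)

lemma adj_add: "\<lbrakk>S \<in> Op; T \<in> Op\<rbrakk> \<Longrightarrow> adj (op_add H S T) = op_add H (adj S) (adj T)"
  by (rule adj_eqI) (auto simp: adj_Op Op_closed ip_adj)

lemma adj_scale: "\<lbrakk>T \<in> Op\<rbrakk> \<Longrightarrow> adj (op_scale H c T) = op_scale H (cnj c) (adj T)"
  by (rule adj_eqI) (auto simp: adj_Op Op_closed ip_adj)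

lemma adj_mult: "\<lbrakk>S \<in> Op; T \<in> Op\<rbrakk> \<Longrightarrow> adj (op_mult H S T) = op_mult H (adj T) (adj S)"
  by (rule adj_eqI) (auto simp: adj_Op Op_closed ip_adj)

lemma adj_one: "adj (op_one H) = op_one H"
  by (rule adj_eqI) auto

lemma adj_contr: assumes T: "T \<in> Op" and c: "contr T" shows "contr (adj T)"
  unfolding contr_def
proof
  fix x assume x: "x \<in> V"
  note [simp] = OpD[OF T] OpD[OF adj_Op[OF T]]
  have "(nrm (adj T x))\<^sup>2 = Re (ip (T (adj T x)) x)" using x T by (simp flip: Re_ip_self ip_adj)
  also have "\<dots> \<le> nrm (T (adj T x)) * nrm x"
    using Cauchy_Schwarz[of "T (adj T x)" x] complex_Re_le_cmod[of "ip (T (adj T x)) x"] x by simp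
  also have "\<dots> \<le> nrm (adj T x) * nrm x"
    using c x by (intro mult_right_mono) (auto simp: contr_def)
  finally have "nrm (adj T x) * nrm (adj T x) \<le> nrm x * nrm (adj T x)" by (simp add: power2_eq_square mult.commute)
  moreover have "0 \<le> nrm (adj T x)" "0 \<le> nrm x" using x by auto
  ultimately show "nrm (adj T x) \<le> nrm x" by (metis less_eq_real_def mult_le_cancel_right not_less)
qed

lemma commutant_iff: "T \<in> commutant H X \<longleftrightarrow> T \<in> Op \<and> (\<forall>S\<in>X. \<forall>x\<in>V. T (S x) = S (T x))"
  unfolding commutant_def op_mult_def compose_def by (auto simp: fun_eq_iff restrict_def)

lemma commutant_Op: "commutant H X \<subseteq> Op"
  by (auto simp: commutant_iff)

lemma commutant_antimono: "X \<subseteq> Y \<Longrightarrow> commutant H Y \<subseteq> commutant H X"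
  unfolding commutant_def by blast

lemma commutant_adj:
  assumes X: "X \<subseteq> Op" "\<And>T. T \<in> X \<Longrightarrow> adj T \<in> X" and T: "T \<in> commutant H X"
  shows "adj T \<in> commutant H X"
proof -
  have TO: "T \<in> Op" using T commutant_Op by blast
  note [simp] = OpD[OF TO] OpD[OF adj_Op[OF TO]]
  have "adj T (S x) = S (adj T x)" if S: "S \<in> X" and x: "x \<in> V" for S x
  proof (rule vec_eqI)
    have SO: "S \<in> Op" "adj S \<in> Op" using S X by auto
    note [simp] = OpD[OF SO(1)] OpD[OF SO(2)]
    show "adj T (S x) \<in> V" "S (adj T x) \<in> V" using x by auto
    fix z assume z: "z \<in> V"
    have "T (adj S z) = adj S (T z)" using T X S z by (auto simp: commutant_iff)
    then have "ip x (T (adj S z)) = ip x (adj S (T z))" by simp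
    then show "ip (adj T (S x)) z = ip (S (adj T x)) z"
      using x z TO SO by (simp add: ip_adj_left ip_adj) (metis ip_adj ip_adj_left Op_closed adj_Op)
  qed
  then show ?thesis using TO by (auto simp: commutant_iff adj_Op)
qed

lemma commutant_star_subalgebra:
  assumes X: "X \<subseteq> Op" "\<And>T. T \<in> X \<Longrightarrow> adj T \<in> X"
  shows "star_subalgebra H (commutant H X)"
proof -
  have XO: "S \<in> X \<Longrightarrow> S \<in> Op" for S using X by auto
  have "op_one H \<in> commutant H X" using XO by (auto simp: commutant_iff Op_closed)
  moreover have "op_add H S T \<in> commutant H X" if "S \<in> commutant H X" "T \<in> commutant H X" for S T
    using that XO by (auto simp: commutant_iff OpD)
  moreover have "op_scale H c S \<in> commutant H X" if "S \<in> commutant H X" for S c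
    using that XO by (auto simp: commutant_iff OpD)
  moreover have "op_mult H S T \<in> commutant H X" if "S \<in> commutant H X" "T \<in> commutant H X" for S T
    using that XO by (auto simp: commutant_iff OpD)
  moreover have "\<exists>S\<in>commutant H X. is_adjoint H T S" if "T \<in> commutant H X" for T
    using commutant_adj[OF X that] that commutant_Op by (auto simp: is_adjoint_iff)
  ultimately show ?thesis unfolding star_subalgebra_def using commutant_Op by auto
qed

lemma subset_commutant2: "X \<subseteq> Op \<Longrightarrow> X \<subseteq> commutant H (commutant H X)"
  by (auto simp: commutant_iff)

lemma commutant3: "X \<subseteq> Op \<Longrightarrow> commutant H (commutant H (commutant H X)) = commutant H X"
  using subset_commutant2[of X] subset_commutant2[of "commutant H X"] commutant_antimono commutant_Op
  by (metis subset_antisym)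

lemma commutant_vNA:
  assumes X: "X \<subseteq> Op" "\<And>T. T \<in> X \<Longrightarrow> adj T \<in> X"
  shows "von_neumann_algebra H (commutant H X)"
  unfolding von_neumann_algebra_def
  using hilbert_space_axioms commutant_star_subalgebra[OF X] commutant3[OF X(1)] by blast

lemma vNA_D:
  assumes "von_neumann_algebra H M"
  shows vNA_Op: "M \<subseteq> Op"
    and vNA_adj: "T \<in> M \<Longrightarrow> adj T \<in> M"
    and vNA_bicomm: "commutant H (commutant H M) = M"
    and vNA_add: "\<lbrakk>S \<in> M; T \<in> M\<rbrakk> \<Longrightarrow> op_add H S T \<in> M"
    and vNA_scale: "S \<in> M \<Longrightarrow> op_scale H c S \<in> M"
    and vNA_mult: "\<lbrakk>S \<in> M; T \<in> M\<rbrakk> \<Longrightarrow> op_mult H S T \<in> M"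
    and vNA_one: "op_one H \<in> M"
proof -
  have s: "star_subalgebra H M" and b: "commutant H (commutant H M) = M"
    using assms by (auto simp: von_neumann_algebra_def)
  show "M \<subseteq> Op" "T \<in> M \<Longrightarrow> adj T \<in> M" "\<lbrakk>S \<in> M; T \<in> M\<rbrakk> \<Longrightarrow> op_add H S T \<in> M"
    "S \<in> M \<Longrightarrow> op_scale H c S \<in> M" "\<lbrakk>S \<in> M; T \<in> M\<rbrakk> \<Longrightarrow> op_mult H S T \<in> M" for S T c
    using s by (auto simp: star_subalgebra_def is_adjoint_iff)
  show "commutant H (commutant H M) = M" by fact
  have "op_one H \<in> commutant H (commutant H M)" by (auto simp: commutant_iff Op_closed)
  then show "op_one H \<in> M" using b by simp
qed

text \<open>A von Neumann algebra \<open>N\<close> containing \<open>S\<close> also contains the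
  adjoints, so \<open>c\<close> bounds its commutant by that of \<open>M\<close>; taking commutants
  once more gives \<open>M \<subseteq> N\<close>. All proofs of generation go through this
  criterion.\<close>

lemma generatesI:
  assumes M: "von_neumann_algebra H M" and S: "S \<subseteq> M"
    and c: "commutant H (S \<union> adj ` S) \<subseteq> commutant H M"
  shows "generates H S M"
  unfolding generates_def
proof (intro conjI allI impI)
  fix N assume N: "von_neumann_algebra H N \<and> S \<subseteq> N"
  then have "S \<union> adj ` S \<subseteq> N" using vNA_adj by auto
  then have "commutant H N \<subseteq> commutant H M" using c commutant_antimono by blast
  then have "commutant H (commutant H M) \<subseteq> commutant H (commutant H N)" by (rule commutant_antimono)
  then show "M \<subseteq> N" using M N vNA_bicomm by auto
qed (use M S in auto)

text \<open>The bicommutant of \<open>S\<close> and its adjoints is itself a von Neumann algebra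
  containing \<open>S\<close>, so \<open>M\<close> lies inside it by minimality.\<close>

lemma generatesD:
  assumes "generates H S M"
  shows "commutant H (S \<union> adj ` S) = commutant H M"
proof -
  have M: "von_neumann_algebra H M" "S \<subseteq> M" using assms by (auto simp: generates_def)
  define X where "X = S \<union> adj ` S"
  have SO: "S \<subseteq> Op" using M vNA_Op by blast
  have X: "X \<subseteq> Op" "\<And>T. T \<in> X \<Longrightarrow> adj T \<in> X" using SO by (auto simp: X_def adj_Op adj_adj subset_iff)
  have "von_neumann_algebra H (commutant H (commutant H X))"
    using commutant_Op X commutant_adj by (intro commutant_vNA) auto
  moreover have "S \<subseteq> commutant H (commutant H X)" using subset_commutant2[OF X(1)] by (auto simp: X_def)
  ultimately have "M \<subseteq> commutant H (commutant H X)" using assms by (auto simp: generates_def)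
  then have "commutant H (commutant H (commutant H X)) \<subseteq> commutant H M" by (rule commutant_antimono)
  moreover have "commutant H M \<subseteq> commutant H X"
    using M vNA_adj by (intro commutant_antimono) (auto simp: X_def)
  ultimately show ?thesis using commutant3[OF X(1)] by (auto simp: X_def)
qed

text \<open>\<open>X\<close> is closed under adjoints, so invariance of \<open>S\<close> passes to
  \<open>perp S\<close> and from there to \<open>perp (perp S)\<close>; each operator in
  \<open>X\<close> then respects the decomposition into these two spaces.\<close>

lemma proj_commutant:
  assumes X: "X \<subseteq> Op" "\<And>T. T \<in> X \<Longrightarrow> adj T \<in> X" and S: "S \<subseteq> V"
    and inv: "\<And>T s. \<lbrakk>T \<in> X; s \<in> S\<rbrakk> \<Longrightarrow> T s \<in> S"
  shows "proj S \<in> commutant H X"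
proof -
  have i1: "T v \<in> perp S" if "T \<in> X" "v \<in> perp S" for T v
  proof -
    have "ip (T v) s = 0" if "s \<in> S" for s
    proof -
      have "adj T s \<in> S" "s \<in> V" "v \<in> V" using \<open>T \<in> X\<close> \<open>s \<in> S\<close> inv X S \<open>v \<in> perp S\<close> perpV by auto
      then have "ip v (adj T s) = 0" using \<open>v \<in> perp S\<close> by (auto simp: perp_def)
      then show ?thesis using ip_adj[of T v s] X \<open>T \<in> X\<close> \<open>s \<in> V\<close> \<open>v \<in> V\<close> by auto
    qed
    then show ?thesis using X that by (auto simp: perp_def Op_closed)
  qed
  have i2: "T v \<in> perp (perp S)" if "T \<in> X" "v \<in> perp (perp S)" for T v
  proof -
    have "ip (T v) s = 0" if "s \<in> perp S" for s
    proof -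
      have "adj T s \<in> perp S" "s \<in> V" "v \<in> V" using \<open>T \<in> X\<close> \<open>s \<in> perp S\<close> i1 X \<open>v \<in> perp (perp S)\<close> perpV by auto
      then have "ip v (adj T s) = 0" using \<open>v \<in> perp (perp S)\<close> by (auto simp: perp_def)
      then show ?thesis using ip_adj[of T v s] X \<open>T \<in> X\<close> \<open>s \<in> V\<close> \<open>v \<in> V\<close> by auto
    qed
    then show ?thesis using X that by (auto simp: perp_def Op_closed)
  qed
  have "proj S (T x) = T (proj S x)" if T: "T \<in> X" and x: "x \<in> V" for T x
  proof (rule proj_unique[OF S])
    have TO: "T \<in> Op" using T X by auto
    show "T x \<in> V" using TO x by (simp add: Op_closed)
    show "T (proj S x) \<in> perp (perp S)" using i2 T proj_mem[OF S x] by auto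
    have "T x \<ominus> T (proj S x) = T (x \<ominus> proj S x)" using TO x proj_mem[OF S x] by (simp add: Op_diff)
    then show "T x \<ominus> T (proj S x) \<in> perp S" using i1 T proj_mem[OF S x] by auto
  qed
  then show ?thesis using proj_Op[OF S] by (auto simp: commutant_iff)
qed

end

section \<open>Weak limits and weak compactness\<close>

lemma tendsto_apply:
  fixes f :: "'i \<Rightarrow> 'k \<Rightarrow> 'c :: topological_space"
  assumes "(f \<longlongrightarrow> B) G"
  shows "((\<lambda>i. f i p) \<longlongrightarrow> B p) G"
proof (rule topological_tendstoI)
  fix U assume U: "open U" "B p \<in> U"
  have "open ((\<lambda>g :: 'k \<Rightarrow> 'c. g p) -` U)"
    by (rule open_vimage[OF U(1) continuous_on_product_coordinates])
  then have "\<forall>\<^sub>F i in G. f i \<in> (\<lambda>g. g p) -` U"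
    using U(2) by (intro topological_tendstoD[OF assms]) simp_all
  then show "\<forall>\<^sub>F i in G. f i p \<in> U" by simp
qed

context hilbert_space
begin

text \<open>Weak operator convergence, along arbitrary filters: when \<open>H\<close> is not
  separable, the unit ball is not weakly metrizable and sequences are not enough.\<close>

definition wlim :: "('i \<Rightarrow> 'a \<Rightarrow> 'a) \<Rightarrow> ('a \<Rightarrow> 'a) \<Rightarrow> 'i filter \<Rightarrow> bool" where
  "wlim T L G \<longleftrightarrow> (\<forall>x\<in>V. \<forall>y\<in>V. ((\<lambda>i. ip (T i x) y) \<longlongrightarrow> ip (L x) y) G)"

lemma wlimD: "\<lbrakk>wlim T L G; x \<in> V; y \<in> V\<rbrakk> \<Longrightarrow> ((\<lambda>i. ip (T i x) y) \<longlongrightarrow> ip (L x) y) G"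
  by (auto simp: wlim_def)

text \<open>Tychonoff's theorem, applied to the matrix elements \<open>\<langle>T x, y\<rangle>\<close>.\<close>

lemma weak_cluster:
  fixes T :: "'i \<Rightarrow> 'a \<Rightarrow> 'a"
  assumes F: "F \<noteq> bot" and T: "\<forall>\<^sub>F i in F. T i \<in> Op \<and> contr (T i)"
  obtains L G where "L \<in> Op" "contr L" "G \<le> F" "G \<noteq> bot" "wlim T L G"
proof -
  \<comment> \<open>An operator becomes the point of a product of discs given by its matrix
    elements; the value 0 off \<open>V\<close> makes the remaining factors trivial.\<close>
  define \<Phi> where "\<Phi> = (\<lambda>i (x, y). if x \<in> V \<and> y \<in> V then ip (T i x) y else 0)"
  define b where "b = (\<lambda>(x, y). if x \<in> V \<and> y \<in> V then nrm x * nrm y else 0)"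
  define K where "K = PiE UNIV (\<lambda>p. cball (0::complex) (b p))"
  have "compactin (product_topology (\<lambda>i. euclidean) UNIV) K"
    unfolding K_def by (simp add: compactin_PiE)
  then have "compact K" by (simp add: euclidean_product_topology)
  moreover have "filtermap \<Phi> F \<noteq> bot" using F by (simp add: filtermap_bot_iff)
  moreover have "eventually (\<lambda>B. B \<in> K) (filtermap \<Phi> F)"
    unfolding eventually_filtermap using T
  proof eventually_elim
    case (elim i)
    have "cmod (ip (T i x) y) \<le> nrm x * nrm y" if "x \<in> V" "y \<in> V" for x y
    proof -
      have "cmod (ip (T i x) y) \<le> nrm (T i x) * nrm y"
        using elim that by (simp add: Cauchy_Schwarz Op_closed)
      also have "\<dots> \<le> nrm x * nrm y" using elim that by (intro mult_right_mono) (auto simp: contr_def)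
      finally show ?thesis .
    qed
    then show ?case by (auto simp: K_def \<Phi>_def b_def)
  qed
  ultimately obtain B where B: "B \<in> K" "inf (nhds B) (filtermap \<Phi> F) \<noteq> bot"
    unfolding compact_filter by blast
  \<comment> \<open>The part of \<open>F\<close> along which the matrix elements converge to
    \<open>B\<close>; it is proper because \<open>B\<close> is a cluster point.\<close>
  define G where "G = inf (filtercomap \<Phi> (nhds B)) F"
  have G: "G \<noteq> bot"
  proof
    assume "G = bot"
    then have "eventually (\<lambda>_. False) G" by simp
    then obtain P Q where "eventually P (filtercomap \<Phi> (nhds B))" and Q: "eventually Q F"
        and PQ: "\<forall>x. P x \<and> Q x \<longrightarrow> False"
      unfolding G_def eventually_inf by blast
    then obtain R where R: "eventually R (nhds B)" "\<forall>x. R (\<Phi> x) \<longrightarrow> P x"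
      unfolding eventually_filtercomap by blast
    have "eventually (\<lambda>B. \<not> R B) (filtermap \<Phi> F)"
      unfolding eventually_filtermap using Q by eventually_elim (use R PQ in blast)
    then have "eventually (\<lambda>_. False) (inf (nhds B) (filtermap \<Phi> F))"
      unfolding eventually_inf using R(1) by blast
    then show False using B(2) by (simp add: trivial_limit_def)
  qed
  have "filterlim \<Phi> (nhds B) G"
    unfolding G_def by (rule filterlim_mono[OF filterlim_filtercomap order_refl inf_le1])
  have lim: "((\<lambda>i. ip (T i x) y) \<longlongrightarrow> B (x, y)) G" if "x \<in> V" "y \<in> V" for x y
  proof -
    have "((\<lambda>i. \<Phi> i (x, y)) \<longlongrightarrow> B (x, y)) G"
      using \<open>filterlim \<Phi> (nhds B) G\<close> by (rule tendsto_apply)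
    then show ?thesis using that by (simp add: \<Phi>_def)
  qed
  have TG: "\<forall>\<^sub>F i in G. T i \<in> Op"
    using T unfolding G_def by (rule eventually_mono[OF filter_leD[OF inf_le2]]) auto
  have uniq: "B p = z" if "((\<lambda>i. ip (T i (fst p)) (snd p)) \<longlongrightarrow> z) G" "fst p \<in> V" "snd p \<in> V" for p z
    using lim[OF that(2,3)] that(1) G tendsto_unique by fastforce
  have ev: "B p = z" if "(h \<longlongrightarrow> z) G" "\<forall>\<^sub>F i in G. ip (T i (fst p)) (snd p) = h i" "fst p \<in> V" "snd p \<in> V" for p z h
    using that by (intro uniq) (auto simp: tendsto_cong)
  have "\<exists>L\<in>Op. (\<forall>x\<in>V. \<forall>y\<in>V. ip (L x) y = B (x, y)) \<and> (\<forall>x\<in>V. nrm (L x) \<le> 1 * nrm x)"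
  proof (rule form_operator)
    fix x y z assume a: "x \<in> V" "y \<in> V" "z \<in> V"
    show "B (x \<oplus> y, z) = B (x, z) + B (y, z)"
      by (rule ev[OF tendsto_add[OF lim lim]]) (use a TG in \<open>auto elim!: eventually_mono simp: OpD\<close>)
    show "B (z, x \<oplus> y) = B (z, x) + B (z, y)"
      by (rule ev[OF tendsto_add[OF lim lim]]) (use a TG in \<open>auto elim!: eventually_mono simp: OpD\<close>)
  next
    fix c x y assume a: "x \<in> V" "y \<in> V"
    show "B (c \<odot> x, y) = c * B (x, y)"
      by (rule ev[OF tendsto_mult[OF tendsto_const lim]]) (use a TG in \<open>auto elim!: eventually_mono simp: OpD\<close>)
    show "B (y, c \<odot> x) = cnj c * B (y, x)"
      by (rule ev[OF tendsto_mult[OF tendsto_const lim]]) (use a TG in \<open>auto elim!: eventually_mono simp: OpD\<close>)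
  next
    fix x y assume a: "x \<in> V" "y \<in> V"
    have "B (x, y) \<in> cball 0 (b (x, y))" using B(1) by (auto simp: K_def)
    then show "cmod (B (x, y)) \<le> 1 * nrm x * nrm y" using a by (simp add: b_def)
  qed simp
  then obtain L where L: "L \<in> Op" "\<forall>x\<in>V. \<forall>y\<in>V. ip (L x) y = B (x, y)" "contr L"
    by (auto simp: contr_def)
  have "wlim T L G" using lim L by (simp add: wlim_def)
  then show ?thesis using that[of L G] L G by (simp add: G_def)
qed

lemma wlim_right:
  assumes "wlim T L G" "L \<in> Op" "\<forall>\<^sub>F i in G. T i \<in> Op" "x \<in> V" "y \<in> V"
  shows "((\<lambda>i. ip x (T i y)) \<longlongrightarrow> ip x (L y)) G"
proof -
  have "((\<lambda>i. cnj (ip (T i y) x)) \<longlongrightarrow> cnj (ip (L y) x)) G"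
    using assms by (intro tendsto_cnj wlimD)
  moreover have "cnj (ip (L y) x) = ip x (L y)"
    using assms hinner_commute by (metis Op_closed)
  moreover have "\<forall>\<^sub>F i in G. cnj (ip (T i y) x) = ip x (T i y)"
    using assms(3) by eventually_elim (use assms hinner_commute in \<open>metis Op_closed\<close>)
  ultimately show ?thesis using Lim_transform_eventually by fastforce
qed

text \<open>Moving \<open>S\<close> to the other side as its adjoint turns commutation into
  equations between matrix elements, which survive weak limits.\<close>

lemma wlim_commute:
  assumes lim: "wlim T L G" and G: "G \<noteq> bot" and L: "L \<in> Op" and T: "\<forall>\<^sub>F i in G. T i \<in> Op"
    and S: "S \<in> Op" and c: "\<forall>\<^sub>F i in G. \<forall>x\<in>V. T i (S x) = S (T i x)" and x: "x \<in> V"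
  shows "L (S x) = S (L x)"
proof (rule vec_eqI)
  note [simp] = OpD[OF L] OpD[OF S] OpD[OF adj_Op[OF S]]
  show "L (S x) \<in> V" "S (L x) \<in> V" using x by auto
  fix z assume z: "z \<in> V"
  have 1: "((\<lambda>i. ip (T i (S x)) z) \<longlongrightarrow> ip (L (S x)) z) G"
    using x z by (intro wlimD[OF lim]) auto
  have 2: "((\<lambda>i. ip (T i x) (adj S z)) \<longlongrightarrow> ip (L x) (adj S z)) G"
    using x z by (intro wlimD[OF lim]) auto
  have "\<forall>\<^sub>F i in G. ip (T i x) (adj S z) = ip (T i (S x)) z"
    using T c by eventually_elim (use x z S in \<open>simp add: Op_closed ip_adj\<close>)
  then have "((\<lambda>i. ip (T i (S x)) z) \<longlongrightarrow> ip (L x) (adj S z)) G"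
    by (rule Lim_transform_eventually[OF 2])
  then have "ip (L (S x)) z = ip (L x) (adj S z)" using 1 G tendsto_unique by blast
  then show "ip (L (S x)) z = ip (S (L x)) z" using x z S by (simp add: ip_adj)
qed

text \<open>\<open>M\<close> is a commutant, so membership amounts to commutation relations, each of
  them weakly closed.\<close>

lemma wlim_in_vNA:
  assumes M: "von_neumann_algebra H M" and lim: "wlim T L G" and G: "G \<noteq> bot" and L: "L \<in> Op"
    and T: "\<forall>\<^sub>F i in G. T i \<in> M"
  shows "L \<in> M"
proof -
  have TO: "\<forall>\<^sub>F i in G. T i \<in> Op" using T by eventually_elim (use vNA_Op[OF M] in auto)
  have "L (S x) = S (L x)" if S: "S \<in> commutant H M" and x: "x \<in> V" for S x
    by (rule wlim_commute[OF lim G L TO])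
      (use S x T in \<open>auto elim!: eventually_mono simp: commutant_iff\<close>)
  then have "L \<in> commutant H (commutant H M)" using L by (auto simp: commutant_iff)
  then show ?thesis using vNA_bicomm[OF M] by simp
qed

end

lemma limitin_topology_generated_by:
  assumes l: "l \<in> \<Union>\<S>" and e: "\<And>U. \<lbrakk>U \<in> \<S>; l \<in> U\<rbrakk> \<Longrightarrow> \<forall>\<^sub>F i in G. f i \<in> U"
  shows "limitin (topology_generated_by \<S>) f l G"
  unfolding limitin_def
proof (intro conjI allI impI)
  show "l \<in> topspace (topology_generated_by \<S>)" using l by (simp add: topology_generated_by_topspace)
  fix U assume U: "openin (topology_generated_by \<S>) U \<and> l \<in> U"
  then have "generate_topology_on \<S> U" by (simp add: openin_topology_generated_by_iff)
  then have "l \<in> U \<longrightarrow> (\<forall>\<^sub>F i in G. f i \<in> U)"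
  proof induction
    case (Int a b)
    then show ?case by (auto intro: eventually_conj)
  next
    case (UN K)
    show ?case
    proof
      assume "l \<in> \<Union>K"
      then obtain k where "k \<in> K" "l \<in> k" by blast
      then have "\<forall>\<^sub>F i in G. f i \<in> k" using UN by blast
      then show "\<forall>\<^sub>F i in G. f i \<in> \<Union>K" by eventually_elim (use \<open>k \<in> K\<close> in blast)
    qed
  qed (auto intro: e)
  then show "\<forall>\<^sub>F i in G. f i \<in> U" using U by blast
qed

context hilbert_space
begin

text \<open>For contractions the series defining a \<sigma>-weak functional are dominated by one
  summable sequence, so the limit may be taken term by term.\<close>

lemma wlim_sigma_weak:
  assumes lim: "wlim T L G" and G: "G \<noteq> bot" and L: "L \<in> Op"
    and T: "\<forall>\<^sub>F i in G. T i \<in> Op \<and> contr (T i)"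
  shows "limitin (sigma_weak_topology H) T L G"
  unfolding sigma_weak_topology_def
proof (rule limitin_topology_generated_by)
  define z where "z = (\<lambda>n::nat. \<zero>)"
  have "square_summable H z" by (simp add: square_summable_def z_def)
  then show "L \<in> \<Union> {{T \<in> Op. (\<Sum>n. ip (T (\<xi> n)) (\<eta> n)) \<in> U} |\<xi> \<eta> U.
       square_summable H \<xi> \<and> square_summable H \<eta> \<and> open U}"
    using L by (intro UnionI[of "{T \<in> Op. (\<Sum>n. ip (T (z n)) (z n)) \<in> UNIV}"]) blast+
  fix W assume "W \<in> {{T \<in> Op. (\<Sum>n. ip (T (\<xi> n)) (\<eta> n)) \<in> U} |\<xi> \<eta> U.
       square_summable H \<xi> \<and> square_summable H \<eta> \<and> open U}"
  then obtain \<xi> \<eta> U where W: "W = {T \<in> Op. (\<Sum>n. ip (T (\<xi> n)) (\<eta> n)) \<in> U}" "open U"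
    and ss: "square_summable H \<xi>" "square_summable H \<eta>" by blast
  assume "L \<in> W"
  have V: "\<xi> n \<in> V" "\<eta> n \<in> V" for n using ss by (auto simp: square_summable_def)
  define B where "B = (\<lambda>n. ((nrm (\<xi> n))\<^sup>2 + (nrm (\<eta> n))\<^sup>2) / 2)"
  have sB: "summable B" unfolding B_def using ss
    by (intro summable_divide summable_add) (auto simp: square_summable_def)
  have ev: "\<forall>\<^sub>F i in G. \<forall>n. norm (ip (T i (\<xi> n)) (\<eta> n)) \<le> B n"
    using T
  proof eventually_elim
    case (elim i)
    show ?case
    proof
      fix n
      have "cmod (ip (T i (\<xi> n)) (\<eta> n)) \<le> nrm (T i (\<xi> n)) * nrm (\<eta> n)"
        using elim V by (intro Cauchy_Schwarz) (auto simp: Op_closed)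
      also have "\<dots> \<le> nrm (\<xi> n) * nrm (\<eta> n)"
        using elim V by (intro mult_right_mono) (auto simp: contr_def)
      also have "\<dots> \<le> B n" using sum_squares_bound[of "nrm (\<xi> n)" "nrm (\<eta> n)"] by (simp add: B_def)
      finally show "norm (ip (T i (\<xi> n)) (\<eta> n)) \<le> B n" .
    qed
  qed
  have "eventually (\<lambda>(n, i). norm (ip (T i (\<xi> n)) (\<eta> n)) \<le> B n) (at_top \<times>\<^sub>F G)"
    using eventually_prodI[OF eventually_True ev, of at_top] by (rule eventually_mono) auto
  from tannerys_theorem[OF _ this sB G] lim V
  have "((\<lambda>i. \<Sum>n. ip (T i (\<xi> n)) (\<eta> n)) \<longlongrightarrow> (\<Sum>n. ip (L (\<xi> n)) (\<eta> n))) G"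
    by (auto simp: wlim_def)
  then have "\<forall>\<^sub>F i in G. (\<Sum>n. ip (T i (\<xi> n)) (\<eta> n)) \<in> U"
    using \<open>L \<in> W\<close> W by (auto intro: topological_tendstoD)
  then show "\<forall>\<^sub>F i in G. T i \<in> W" using T by eventually_elim (simp add: W)
qed

text \<open>A matrix element is the \<sigma>-weak functional of two sequences supported at index
  0.\<close>

lemma sigma_weak_imp_matrix:
  assumes lim: "limitin (sigma_weak_topology H) T L G" and x: "x \<in> V" and y: "y \<in> V"
  shows "((\<lambda>i. ip (T i x) y) \<longlongrightarrow> ip (L x) y) G"
proof (rule topological_tendstoI)
  fix U assume U: "open U" "ip (L x) y \<in> U"
  define \<xi> where "\<xi> = (\<lambda>n::nat. if n = 0 then x else \<zero>)"
  define \<eta> where "\<eta> = (\<lambda>n::nat. if n = 0 then y else \<zero>)"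
  have fin: "summable (\<lambda>n. (nrm (if n = (0::nat) then v else \<zero>))\<^sup>2)" for v
    by (rule summable_finite[of "{0}"]) auto
  then have ss: "square_summable H \<xi>" "square_summable H \<eta>"
    using x y by (auto simp: square_summable_def \<xi>_def \<eta>_def)
  have sum: "(\<Sum>n. ip (S (\<xi> n)) (\<eta> n)) = ip (S x) y" if S: "S \<in> Op" for S
  proof -
    have "(\<lambda>n. ip (S (\<xi> n)) (\<eta> n)) = (\<lambda>n. if n = 0 then ip (S x) y else 0)"
      using S x y by (auto simp: fun_eq_iff \<xi>_def \<eta>_def OpD)
    then show ?thesis using sums_single[of 0 "\<lambda>_. ip (S x) y"] by (simp add: sums_iff)
  qed
  define W where "W = {T \<in> Op. (\<Sum>n. ip (T (\<xi> n)) (\<eta> n)) \<in> U}"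
  have "openin (sigma_weak_topology H) W"
    unfolding sigma_weak_topology_def using ss U W_def by (intro topology_generated_by_Basis) blast
  moreover have "L \<in> Op"
    using lim unfolding limitin_def sigma_weak_topology_def topology_generated_by_topspace by blast
  then have "L \<in> W" using U by (simp add: W_def sum)
  ultimately have "\<forall>\<^sub>F i in G. T i \<in> W" using lim by (auto simp: limitin_def)
  then show "\<forall>\<^sub>F i in G. ip (T i x) y \<in> U" by eventually_elim (auto simp: W_def sum)
qed

section \<open>From separable action to countable generation\<close>

lemma scale_to_contr:
  assumes T: "T \<in> Op"
  obtains r :: real where "r > 0" "contr (op_scale H (of_real r) T)"
proof -
  obtain C where C: "C \<ge> 0" "\<forall>x\<in>V. nrm (T x) \<le> C * nrm x" using Op_bounded[OF T] by blast
  have "contr (op_scale H (of_real (1 / (C + 1))) T)"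
    unfolding contr_def
  proof
    fix x assume x: "x \<in> V"
    have "nrm (op_scale H (of_real (1 / (C + 1))) T x) = nrm (T x) / (C + 1)"
      using x T C by (simp add: Op_closed norm_divide del: of_real_add)
    also have "nrm (T x) \<le> (C + 1) * nrm x"
      using bspec[OF C(2) x] nrm_ge_0[OF x] by (simp add: distrib_right)
    then have "nrm (T x) / (C + 1) \<le> nrm x" using C(1) by (simp add: pos_divide_le_eq mult.commute)
    finally show "nrm (op_scale H (of_real (1 / (C + 1))) T x) \<le> nrm x" .
  qed
  then show ?thesis using that[of "1 / (C + 1)"] C by simp
qed

lemma smult_cancel: "\<lbrakk>c \<noteq> 0; c \<odot> x = c \<odot> y; x \<in> V; y \<in> V\<rbrakk> \<Longrightarrow> x = y"
proof (rule vec_eqI)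
  fix z assume a: "c \<noteq> 0" "c \<odot> x = c \<odot> y" "x \<in> V" "y \<in> V" "z \<in> V"
  then have "ip (c \<odot> x) z = ip (c \<odot> y) z" by simp
  then show "ip x z = ip y z" using a(1,3-5) by simp
qed auto

lemma dense_zero:
  assumes D: "D \<subseteq> V" "\<And>v e. \<lbrakk>v \<in> V; e > 0\<rbrakk> \<Longrightarrow> \<exists>d\<in>D. nrm (d \<ominus> v) < e"
    and k: "k \<in> V" "\<And>d. d \<in> D \<Longrightarrow> ip k d = 0"
  shows "k = \<zero>"
proof -
  have "z \<in> perp {k}" if z: "z \<in> V" for z
  proof (rule perp_closed)
    fix e :: real assume "e > 0"
    then obtain d where d: "d \<in> D" "nrm (d \<ominus> z) < e" using D(2)[OF z \<open>e > 0\<close>] by blast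
    then have "d \<in> V" "ip d k = 0" using D(1) k ip_eq_0_commute[of k d] by auto
    then have "d \<in> perp {k}" by (simp add: perp_def)
    then show "\<exists>x\<in>perp {k}. nrm (x \<ominus> z) < e" using d by blast
  qed (use k that in auto)
  from this[OF k(1)] show ?thesis using k by (simp add: perp_def ip_self_zero)
qed

end

text \<open>\<open>A\<close> carries no topology: one point is chosen over each basic open set that
  meets the image.\<close>

lemma countable_dense_image:
  fixes \<Phi> :: "'b \<Rightarrow> 'c :: second_countable_topology"
  obtains S where "countable S" "S \<subseteq> A" "\<And>a U. \<lbrakk>a \<in> A; open U; \<Phi> a \<in> U\<rbrakk> \<Longrightarrow> \<exists>s\<in>S. \<Phi> s \<in> U"
proof -
  obtain B :: "'c set set" where B: "countable B" "topological_basis B" using ex_countable_basis by blast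
  define S where "S = (\<lambda>W. SOME a. a \<in> A \<and> \<Phi> a \<in> W) ` {W \<in> B. \<exists>a\<in>A. \<Phi> a \<in> W}"
  have ch: "(SOME a. a \<in> A \<and> \<Phi> a \<in> W) \<in> A \<and> \<Phi> (SOME a. a \<in> A \<and> \<Phi> a \<in> W) \<in> W"
    if "\<exists>a\<in>A. \<Phi> a \<in> W" for W
    using someI_ex[of "\<lambda>a. a \<in> A \<and> \<Phi> a \<in> W"] that by blast
  show ?thesis
  proof
    show "countable S" using B by (simp add: S_def)
    show "S \<subseteq> A" using ch by (auto simp: S_def)
    fix a U assume a: "a \<in> A" "open U" "\<Phi> a \<in> U"
    then obtain W where W: "W \<in> B" "\<Phi> a \<in> W" "W \<subseteq> U" using B(2) topological_basisE by blast
    then have "(SOME a. a \<in> A \<and> \<Phi> a \<in> W) \<in> S" using a by (auto simp: S_def)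
    then show "\<exists>s\<in>S. \<Phi> s \<in> U" using ch[of W] a W by blast
  qed
qed

lemma separably_acting_imp_countably_generated:
  fixes H :: "'a hilbert"
  assumes M: "von_neumann_algebra H M" and sep: "separably_acting H M"
  shows "countably_generated H M"
proof -
  interpret hilbert_space H using M by (simp add: von_neumann_algebra_def)
  obtain K :: "'a hilbert" and \<pi> where sK: "separable_hilbert_space K"
    and rep: "faithful_normal_representation H M K \<pi>"
    using sep by (auto simp: separably_acting_def)
  interpret K: hilbert_space K using sK by (simp add: separable_hilbert_space_def)
  obtain D where D: "countable D" "D \<subseteq> K.V" "K.MS.mtopology closure_of D = K.V"
    using sK unfolding separable_hilbert_space_def separable_space_def by auto
  have dense: "\<exists>d\<in>D. K.nrm (d \<ominus>\<^bsub>K\<^esub> v) < e" if "v \<in> K.V" "e > 0" for v e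
  proof -
    have "v \<in> K.MS.mtopology closure_of D" using D that by simp
    then have "\<exists>d\<in>D. d \<in> K.MS.mball v e"
      unfolding K.MS.metric_closure_of using that(2) by simp
    then obtain d where "d \<in> D" "d \<in> K.MS.mball v e" by blast
    then show ?thesis using that D(2) K.nrm_diff_commute[of v d]
      by (auto simp: hdist_def intro!: bexI[of _ d])
  qed
  have "D \<noteq> {}" using dense[of "\<zero>\<^bsub>K\<^esub>" 1] by auto
  define d where "d = from_nat_into D"
  have dD: "d n \<in> D" "d n \<in> K.V" for n
    using from_nat_into[OF \<open>D \<noteq> {}\<close>] D(2) by (auto simp: d_def)
  have rd: "\<exists>n. d n = x" if "x \<in> D" for x
    unfolding d_def using from_nat_into_surj[OF D(1) that] .
  have \<pi>O: "\<pi> T \<in> K.Op" if "T \<in> M" for T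
    using rep that by (auto simp: faithful_normal_representation_def)
  define M1 where "M1 = {T \<in> M. contr T}"
  \<comment> \<open>Indexing by pairs of naturals puts the values in a countable power of the plane,
    which is second countable.\<close>
  define \<Phi> where "\<Phi> T = (\<lambda>(m::nat, n::nat). K.ip (\<pi> T (d m)) (d n))" for T
  obtain S where S: "countable S" "S \<subseteq> M1"
      "\<And>T U. \<lbrakk>T \<in> M1; open U; \<Phi> T \<in> U\<rbrakk> \<Longrightarrow> \<exists>s\<in>S. \<Phi> s \<in> U"
    using countable_dense_image[of M1 \<Phi>] by metis
  have MO: "M \<subseteq> Op" using M by (rule vNA_Op)
  \<comment> \<open>\<open>T\<close> turns out to be a weak cluster point of \<open>S\<close>: a
    cluster point \<open>L\<close> is found with \<open>\<pi> L = \<pi> T\<close>, and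
    \<open>\<pi>\<close> is injective on \<open>M\<close>.\<close>
  have key: "A (T x) = T (A x)"
    if A: "A \<in> commutant H (S \<union> adj ` S)" and T: "T \<in> M1" and x: "x \<in> V" for A T x
  proof -
    have AO: "A \<in> Op" using A commutant_Op by blast
    \<comment> \<open>Elements of \<open>S\<close> whose image under \<open>\<Phi>\<close>
      approaches that of \<open>T\<close>; proper by the choice of \<open>S\<close>.\<close>
    define F where "F = inf (filtercomap \<Phi> (nhds (\<Phi> T))) (principal S)"
    have "F \<noteq> bot"
    proof
      assume "F = bot"
      then have "eventually (\<lambda>_. False) F" by simp
      then obtain P where P: "eventually P (nhds (\<Phi> T))" "\<forall>s\<in>S. \<not> P (\<Phi> s)"
        unfolding F_def eventually_inf_principal eventually_filtercomap by blast
      then obtain U where "open U" "\<Phi> T \<in> U" "\<forall>u\<in>U. P u" unfolding eventually_nhds by blast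
      then show False using S(3)[OF T] P(2) by blast
    qed
    have FS: "\<forall>\<^sub>F s in F. s \<in> S" unfolding F_def eventually_inf_principal by simp
    then have FM: "\<forall>\<^sub>F s in F. s \<in> M \<and> s \<in> Op \<and> contr s"
      by eventually_elim (use S MO in \<open>auto simp: M1_def\<close>)
    then have "\<forall>\<^sub>F s in F. s \<in> Op \<and> contr s" by eventually_elim auto
    from weak_cluster[OF \<open>F \<noteq> bot\<close> this] obtain L G
      where L: "L \<in> Op" "contr L" and G: "G \<le> F" "G \<noteq> bot" and lim: "wlim (\<lambda>s. s) L G" by blast
    have GM: "\<forall>\<^sub>F s in G. s \<in> M \<and> s \<in> Op \<and> contr s" and GS: "\<forall>\<^sub>F s in G. s \<in> S"
      using FM FS G(1) filter_leD by blast+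
    have LM: "L \<in> M" using wlim_in_vNA[OF M lim G(2) L(1)] GM by (simp add: eventually_conj_iff)
    \<comment> \<open>On the ball, weak convergence is already \<sigma>-weak, so normality carries
      the limit \<open>L\<close> over to \<open>K\<close>.\<close>
    have sw: "limitin (subtopology (sigma_weak_topology H) M) (\<lambda>s. s) L G"
      using wlim_sigma_weak[OF lim G(2) L(1)] GM LM
      by (simp add: limitin_subtopology eventually_conj_iff)
    have "continuous_map (subtopology (sigma_weak_topology H) M) (sigma_weak_topology K) \<pi>"
      using rep by (simp add: faithful_normal_representation_def)
    from continuous_map_limit[OF this sw]
    have piL: "limitin (sigma_weak_topology K) \<pi> (\<pi> L) G" by (simp add: o_def)
    have eq: "K.ip (\<pi> L (d m)) (d n) = K.ip (\<pi> T (d m)) (d n)" for m n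
    proof -
      have 1: "((\<lambda>s. K.ip (\<pi> s (d m)) (d n)) \<longlongrightarrow> K.ip (\<pi> L (d m)) (d n)) G"
        using K.sigma_weak_imp_matrix[OF piL] dD by blast
      have "filterlim \<Phi> (nhds (\<Phi> T)) F"
        unfolding F_def by (rule filterlim_mono[OF filterlim_filtercomap order_refl inf_le1])
      then have "filterlim \<Phi> (nhds (\<Phi> T)) G" using G(1) filterlim_mono by blast
      then have "((\<lambda>s. \<Phi> s (m, n)) \<longlongrightarrow> \<Phi> T (m, n)) G"
        by (rule tendsto_apply)
      then have "((\<lambda>s. K.ip (\<pi> s (d m)) (d n)) \<longlongrightarrow> K.ip (\<pi> T (d m)) (d n)) G"
        by (simp add: \<Phi>_def)
      then show ?thesis using 1 G(2) tendsto_unique by blast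
    qed
    have TM: "T \<in> M" using T by (simp add: M1_def)
    note [simp] = K.OpD[OF \<pi>O[OF LM]] K.OpD[OF \<pi>O[OF TM]]
    have e1: "\<pi> L (d m) = \<pi> T (d m)" for m
    proof -
      have "\<pi> L (d m) \<ominus>\<^bsub>K\<^esub> \<pi> T (d m) = \<zero>\<^bsub>K\<^esub>"
        using dD D(2) dense
      proof (intro K.dense_zero[of D])
        fix x assume "x \<in> D"
        then obtain n where "x = d n" using rd by metis
        then show "K.ip (\<pi> L (d m) \<ominus>\<^bsub>K\<^esub> \<pi> T (d m)) x = 0" using eq dD by simp
      qed auto
      then show ?thesis using dD K.diff_eq_zero by simp
    qed
    have "\<pi> L = \<pi> T"
    proof (rule K.Op_eqI)
      fix v assume v: "v \<in> K.V"
      show "\<pi> L v = \<pi> T v"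
      proof (rule K.vec_eqI)
        fix z assume z: "z \<in> K.V"
        \<comment> \<open>So far \<open>\<pi> L\<close> and \<open>\<pi> T\<close> agree only on the
          dense sequence. Their adjoints at the fixed vector \<open>z\<close> differ by a vector
          orthogonal to that sequence, and density makes it vanish.\<close>
        define k where "k = K.adj (\<pi> L) z \<ominus>\<^bsub>K\<^esub> K.adj (\<pi> T) z"
        note [simp] = K.OpD[OF K.adj_Op[OF \<pi>O[OF LM]]] K.OpD[OF K.adj_Op[OF \<pi>O[OF TM]]]
          K.ip_adj_left[OF \<pi>O[OF LM]] K.ip_adj_left[OF \<pi>O[OF TM]]
          K.ip_adj[OF \<pi>O[OF LM]] K.ip_adj[OF \<pi>O[OF TM]]
        have "k = \<zero>\<^bsub>K\<^esub>"
        proof (rule K.dense_zero[of D])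
          fix x assume "x \<in> D"
          then obtain n where "x = d n" using rd by metis
          then show "K.ip k x = 0" using e1 dD z by (simp add: k_def)
        qed (use D dense z in \<open>auto simp: k_def\<close>)
        then have "K.ip v k = 0" using v by simp
        then show "K.ip (\<pi> L v) z = K.ip (\<pi> T v) z" using v z by (simp add: k_def)
      qed (use v in auto)
    qed (use \<pi>O LM TM in auto)
    then have "L = T" using rep LM TM by (auto simp: faithful_normal_representation_def dest: inj_onD)
    have "L (A x) = A (L x)"
    proof (rule wlim_commute[OF lim G(2) L(1) _ AO _ x])
      show "\<forall>\<^sub>F i in G. i \<in> Op" using GM by eventually_elim auto
      show "\<forall>\<^sub>F i in G. \<forall>x\<in>V. i (A x) = A (i x)"
        using GS by eventually_elim (use A in \<open>auto simp: commutant_iff\<close>)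
    qed
    then show ?thesis using \<open>L = T\<close> by simp
  qed
  have "generates H S M"
  proof (rule generatesI[OF M])
    show "S \<subseteq> M" using S(2) by (auto simp: M1_def)
    show "commutant H (S \<union> adj ` S) \<subseteq> commutant H M"
    proof
      fix A assume A: "A \<in> commutant H (S \<union> adj ` S)"
      then have AO: "A \<in> Op" using commutant_Op by blast
      have "A (T x) = T (A x)" if T: "T \<in> M" and x: "x \<in> V" for T x
      proof -
        have TO: "T \<in> Op" using T MO by auto
        obtain r :: real where r: "r > 0" "contr (op_scale H (of_real r) T)"
          using scale_to_contr[OF TO] by blast
        then have "op_scale H (of_real r) T \<in> M1" using vNA_scale[OF M T] by (simp add: M1_def)
        from key[OF A this x] have "of_real r \<odot>\<^bsub>H\<^esub> A (T x) = of_real r \<odot>\<^bsub>H\<^esub> T (A x)"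
          using x by (simp add: Op_closed[OF AO] Op_closed[OF TO] Op_smult[OF AO])
        then show ?thesis
          by (rule smult_cancel[rotated]) (use r(1) x in \<open>auto simp: Op_closed[OF AO] Op_closed[OF TO]\<close>)
      qed
      then show "A \<in> commutant H M" using AO by (simp add: commutant_iff)
    qed
  qed
  then show ?thesis using S(1) by (auto simp: countably_generated_def)
qed

context hilbert_space
begin

section \<open>Positive operators and symmetries\<close>

definition sa :: "('a \<Rightarrow> 'a) \<Rightarrow> bool" where
  "sa T \<longleftrightarrow> T \<in> Op \<and> (\<forall>x\<in>V. \<forall>y\<in>V. ip (T x) y = ip x (T y))"

definition pos :: "('a \<Rightarrow> 'a) \<Rightarrow> bool" where
  "pos T \<longleftrightarrow> sa T \<and> (\<forall>x\<in>V. 0 \<le> Re (ip (T x) x))"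

definition le_one :: "('a \<Rightarrow> 'a) \<Rightarrow> bool" where
  "le_one T \<longleftrightarrow> (\<forall>x\<in>V. Re (ip (T x) x) \<le> (nrm x)\<^sup>2)"

abbreviation op_sub :: "('a \<Rightarrow> 'a) \<Rightarrow> ('a \<Rightarrow> 'a) \<Rightarrow> 'a \<Rightarrow> 'a" where
  "op_sub S T \<equiv> op_add H S (op_scale H (-1) T)"

abbreviation bicomm :: "('a \<Rightarrow> 'a) set \<Rightarrow> ('a \<Rightarrow> 'a) set" where
  "bicomm X \<equiv> commutant H (commutant H X)"

lemma saO: "sa T \<Longrightarrow> T \<in> Op"
  by (simp add: sa_def)

lemma sa_ip: "\<lbrakk>sa T; x \<in> V; y \<in> V\<rbrakk> \<Longrightarrow> ip (T x) y = ip x (T y)"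
  by (simp add: sa_def)

lemma posO: "pos T \<Longrightarrow> T \<in> Op"
  by (simp add: pos_def saO)

lemma pos_sa: "pos T \<Longrightarrow> sa T"
  by (simp add: pos_def)

lemma sa_adj: "sa T \<longleftrightarrow> T \<in> Op \<and> adj T = T"
  unfolding sa_def by (metis adj_eqI ip_adj)

lemma sa_add: "\<lbrakk>sa S; sa T\<rbrakk> \<Longrightarrow> sa (op_add H S T)"
  by (simp add: sa_adj adj_add)

lemma sa_scale: "\<lbrakk>sa S; Im c = 0\<rbrakk> \<Longrightarrow> sa (op_scale H c S)"
proof -
  assume a: "sa S" "Im c = 0"
  then have "cnj c = c" by (simp add: complex_eq_iff)
  then show ?thesis using a(1) by (simp add: sa_adj adj_scale)
qed

lemma commutantD: "\<lbrakk>T \<in> commutant H X; S \<in> X; x \<in> V\<rbrakk> \<Longrightarrow> T (S x) = S (T x)"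
  by (simp add: commutant_iff[of T])

lemma sa_one: "sa (op_one H)"
  by (simp add: sa_adj adj_one)

lemma sa_mult: "\<lbrakk>sa S; sa T; \<And>x. x \<in> V \<Longrightarrow> S (T x) = T (S x)\<rbrakk> \<Longrightarrow> sa (op_mult H S T)"
  by (auto simp: sa_adj adj_mult intro!: Op_eqI)

lemma pos_form_Cauchy_Schwarz:
  assumes T: "pos T" and xy: "x \<in> V" "y \<in> V"
  shows "(cmod (ip (T x) y))\<^sup>2 \<le> Re (ip (T x) x) * Re (ip (T y) y)"
proof (rule form_Cauchy_Schwarz[where B = "\<lambda>x y. ip (T x) y", OF _ _ _ _ xy])
  note [simp] = OpD[OF posO[OF T]]
  show "ip (T y) x = cnj (ip (T x) y)" if "x \<in> V" "y \<in> V" for x y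
    using that sa_ip[OF pos_sa[OF T], of y x] hinner_commute[of "T x" y] by simp
  show "0 \<le> Re (ip (T x) x)" if "x \<in> V" for x using T that by (simp add: pos_def)
qed (use OpD[OF posO[OF T]] in simp_all)

text \<open>Cauchy-Schwarz for the form of \<open>T\<close>, applied to \<open>x\<close> and
  \<open>T x\<close>, gives \<open>T\<^sup>2 \<le> T\<close> without a square root of
  \<open>T\<close>.\<close>

lemma square_le:
  assumes T: "pos T" "le_one T" and x: "x \<in> V"
  shows "(nrm (T x))\<^sup>2 \<le> Re (ip (T x) x)"
proof -
  have c: "T x \<in> V" using posO[OF T(1)] x by (rule Op_closed)
  have "((nrm (T x))\<^sup>2)\<^sup>2 = (cmod (ip (T x) (T x)))\<^sup>2" using c by (simp add: ip_self norm_power)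
  also have "\<dots> \<le> Re (ip (T x) x) * Re (ip (T (T x)) (T x))"
    using pos_form_Cauchy_Schwarz[OF T(1) x c] .
  also have "\<dots> \<le> Re (ip (T x) x) * (nrm (T x))\<^sup>2"
    using T c x by (intro mult_left_mono) (auto simp: pos_def le_one_def)
  finally have "(nrm (T x))\<^sup>2 * (nrm (T x))\<^sup>2 \<le> Re (ip (T x) x) * (nrm (T x))\<^sup>2"
    by (simp add: power2_eq_square)
  moreover have "0 \<le> Re (ip (T x) x)" using T x by (simp add: pos_def)
  ultimately show ?thesis
    by (metis mult_le_cancel_right not_le order_le_less zero_le_power2)
qed

lemma pos_le_one_contr: "\<lbrakk>pos T; le_one T\<rbrakk> \<Longrightarrow> contr T"
  unfolding contr_def
proof
  fix x assume T: "pos T" "le_one T" and x: "x \<in> V"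
  have "(nrm (T x))\<^sup>2 \<le> (nrm x)\<^sup>2"
    using square_le[OF T x] T x unfolding le_one_def by fastforce
  then show "nrm (T x) \<le> nrm x" by (rule power2_le_imp_le) (use x in simp)
qed

text \<open>Strongly, \<open>p = \<Sum>k. p\<^sub>k\<^sup>2\<close>
  with remainders \<open>p\<^sub>n \<rightarrow> 0\<close>,
  where \<open>p\<^sub>0 = p\<close> and \<open>p\<^bsub>k+1\<^esub> = p\<^sub>k - p\<^sub>k\<^sup>2\<close>.\<close>

lemma commuting_product_pos:
  assumes s: "pos s" and p: "pos p" "le_one p"
    and com: "\<And>x. x \<in> V \<Longrightarrow> s (p x) = p (s x)" and x: "x \<in> V"
  shows "0 \<le> Re (ip (s (p x)) x)"
proof -
  define P where "P = rec_nat p (\<lambda>_ q. op_sub q (op_mult H q q))"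
  have P0: "P 0 = p" and PS: "P (Suc k) = op_sub (P k) (op_mult H (P k) (P k))" for k
    by (simp_all add: P_def)
  have inv: "pos (P k) \<and> le_one (P k) \<and> (\<forall>x\<in>V. s (P k x) = P k (s x))" for k
  proof (induction k)
    case 0
    then show ?case using p com by (simp add: P0)
  next
    case (Suc k)
    then have k: "pos (P k)" "le_one (P k)" "\<And>x. x \<in> V \<Longrightarrow> s (P k x) = P k (s x)" by auto
    note [simp] = OpD[OF posO[OF k(1)]] OpD[OF posO[OF s]]
    \<comment> \<open>The quadratic form loses exactly \<open>(nrm (P k v))\<^sup>2\<close>, and
      \<open>square_le\<close> keeps the result from going below 0.\<close>
    have e: "Re (ip (P (Suc k) v) v) = Re (ip (P k v) v) - (nrm (P k v))\<^sup>2" if "v \<in> V" for v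
      using that sa_ip[OF pos_sa[OF k(1)], of "P k v" v] by (simp add: PS Re_ip_self)
    have "sa (P (Suc k))" unfolding PS using pos_sa[OF k(1)]
      by (intro sa_add sa_scale sa_mult) auto
    then have "pos (P (Suc k))" using square_le[OF k(1,2)] by (simp add: pos_def e)
    moreover have "le_one (P (Suc k))" unfolding le_one_def
    proof
      fix v assume v: "v \<in> V"
      have "Re (ip (P (Suc k) v) v) \<le> Re (ip (P k v) v)" using v by (simp add: e)
      also have "\<dots> \<le> (nrm v)\<^sup>2" using k(2) v by (simp add: le_one_def)
      finally show "Re (ip (P (Suc k) v) v) \<le> (nrm v)\<^sup>2" .
    qed
    moreover have "\<forall>x\<in>V. s (P (Suc k) x) = P (Suc k) (s x)" using k(3) by (simp add: PS)
    ultimately show ?case by blast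
  qed
  have PO: "P k \<in> Op" for k using inv posO by blast
  note [simp] = Op_closed[OF PO] Op_closed[OF posO[OF s]]
  \<comment> \<open>\<open>a\<close> decreases and is bounded below, and its decrements are
    \<open>(nrm (P k x))\<^sup>2\<close>; so \<open>P k x\<close> tends to 0, and \<open>b\<close>
    with it. As \<open>b\<close> decreases too, \<open>b 0\<close> is nonnegative.\<close>
  define a where "a k = Re (ip (P k x) x)" for k
  define b where "b k = Re (ip (s (P k x)) x)" for k
  have aS: "a k - a (Suc k) = (nrm (P k x))\<^sup>2" for k
    using x sa_ip[OF pos_sa, of "P k" "P k x" x] inv by (simp add: a_def PS Re_ip_self)
  have a0: "0 \<le> a k" for k using inv[of k] x by (simp add: a_def pos_def)
  have "decseq a" by (rule decseq_SucI) (use aS in \<open>smt (verit) zero_le_power2\<close>)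
  then obtain l where l: "a \<longlonglongrightarrow> l" using decseq_convergent[of a 0] a0 by blast
  have "(\<lambda>k. a k - a (Suc k)) \<longlonglongrightarrow> l - l" using l by (intro tendsto_diff LIMSEQ_Suc)
  then have "(\<lambda>k. sqrt ((nrm (P k x))\<^sup>2)) \<longlonglongrightarrow> sqrt 0" unfolding aS by (intro tendsto_real_sqrt) simp
  then have Pn: "(\<lambda>k. nrm (P k x)) \<longlonglongrightarrow> 0" using x by simp
  obtain C where C: "C \<ge> 0" "\<forall>x\<in>V. nrm (s x) \<le> C * nrm x" using Op_bounded[OF posO[OF s]] by blast
  have "b \<longlonglongrightarrow> 0"
  proof (rule Lim_null_comparison)
    show "\<forall>\<^sub>F k in sequentially. norm (b k) \<le> C * nrm (P k x) * nrm x"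
    proof (intro always_eventually allI)
      fix k
      have "norm (b k) \<le> cmod (ip (s (P k x)) x)" by (simp add: b_def abs_Re_le_cmod)
      also have "\<dots> \<le> nrm (s (P k x)) * nrm x" using x by (simp add: Cauchy_Schwarz)
      also have "\<dots> \<le> C * nrm (P k x) * nrm x" using C x by (intro mult_right_mono) auto
      finally show "norm (b k) \<le> C * nrm (P k x) * nrm x" .
    qed
    have "(\<lambda>k. C * nrm (P k x) * nrm x) \<longlonglongrightarrow> C * 0 * nrm x" by (intro tendsto_intros Pn)
    then show "(\<lambda>k. C * nrm (P k x) * nrm x) \<longlonglongrightarrow> 0" by simp
  qed
  moreover have "decseq b"
  proof (rule decseq_SucI)
    fix k
    have k: "sa (P k)" "s (P k (P k x)) = P k (s (P k x))" using inv[of k] pos_sa x by auto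
    have "b k - b (Suc k) = Re (ip (s (P k (P k x))) x)"
      using x by (simp add: b_def PS OpD[OF posO[OF s]])
    also have "\<dots> = Re (ip (s (P k x)) (P k x))" using k x by (simp add: sa_ip)
    also have "\<dots> \<ge> 0" using s x by (simp add: pos_def)
    finally show "b (Suc k) \<le> b k" by simp
  qed
  ultimately have "0 \<le> b 0" using decseq_ge by blast
  then show ?thesis by (simp add: b_def P0)
qed

lemma bicomm_vNA: "sa c \<Longrightarrow> von_neumann_algebra H (bicomm {c})"
proof -
  assume c: "sa c"
  then have 1: "{c} \<subseteq> Op" "\<And>T. T \<in> {c} \<Longrightarrow> adj T \<in> {c}" by (auto simp: sa_adj)
  show ?thesis by (rule commutant_vNA[OF commutant_Op commutant_adj[OF 1]])
qed

text \<open>\<open>c\<close> commutes with itself, so its bicommutant lies in its commutant.\<close>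

lemma bicomm_abelian:
  assumes "c \<in> Op" "S \<in> bicomm {c}" "T \<in> bicomm {c}" "x \<in> V"
  shows "S (T x) = T (S x)"
proof -
  have "c \<in> commutant H {c}" using assms(1) by (auto simp: commutant_iff)
  then have "T (c x) = c (T x)" if "x \<in> V" for x
    using assms(3) that by (rule_tac commutantD)
  then have "T \<in> commutant H {c}" using assms(3) commutant_Op by (auto simp: commutant_iff[of T])
  then show ?thesis using assms by (rule_tac commutantD)
qed

lemma bicomm_mem: "c \<in> Op \<Longrightarrow> c \<in> bicomm {c}"
  using subset_commutant2[of "{c}"] by simp

lemma wlim_sa:
  assumes "wlim T L G" "G \<noteq> bot" "L \<in> Op" "\<And>i. sa (T i)"
  shows "sa L"
  unfolding sa_def
proof (intro conjI ballI)
  fix x y assume xy: "x \<in> V" "y \<in> V"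
  have "((\<lambda>i. ip x (T i y)) \<longlongrightarrow> ip x (L y)) G"
    using assms xy by (intro wlim_right) (auto simp: saO)
  then have "((\<lambda>i. ip (T i x) y) \<longlongrightarrow> ip x (L y)) G" using assms(4) xy by (simp add: sa_ip)
  then show "ip (L x) y = ip x (L y)" using wlimD[OF assms(1) xy] assms(2) tendsto_unique by blast
qed fact

text \<open>With \<open>x = 1 - c\<^sup>2\<close> the iteration
  \<open>y\<^bsub>n+1\<^esub> = (x + y\<^sub>n\<^sup>2) / 2\<close> increases strongly to a solution of \<open>(1 - y)\<^sup>2 = c\<^sup>2\<close>.\<close>

lemma abs_exists:
  assumes c: "sa c" "contr c"
  obtains d where "d \<in> bicomm {c}" "pos d" "le_one d" "\<And>v. v \<in> V \<Longrightarrow> d (d v) = c (c v)"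
proof -
  have half: "0 \<le> (p + q) / 2 \<and> (p + q) / 2 \<le> r" if "0 \<le> p" "p \<le> r" "0 \<le> q" "q \<le> r" for p q r :: real
    using that by auto
  define N where "N = bicomm {c}"
  have N: "von_neumann_algebra H N" unfolding N_def by (rule bicomm_vNA[OF c(1)])
  have NO: "T \<in> N \<Longrightarrow> T \<in> Op" for T using vNA_Op[OF N] by auto
  have cN: "c \<in> N" unfolding N_def by (rule bicomm_mem[OF saO[OF c(1)]])
  have ab: "S (T x) = T (S x)" if "S \<in> N" "T \<in> N" "x \<in> V" for S T x
    using bicomm_abelian[OF saO[OF c(1)]] that by (simp add: N_def)
  have cO: "c \<in> Op" using c saO by blast
  note [simp] = OpD[OF cO]
  define x where "x = op_sub (op_one H) (op_mult H c c)"
  define y where "y = rec_nat (op_scale H 0 (op_one H))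
      (\<lambda>_ q. op_scale H (1/2) (op_add H x (op_mult H q q)))"
  have y0: "y 0 = op_scale H 0 (op_one H)"
    and yS: "y (Suc n) = op_scale H (1/2) (op_add H x (op_mult H (y n) (y n)))" for n
    by (simp_all add: y_def)
  have xN: "x \<in> N" unfolding x_def by (intro vNA_add[OF N] vNA_scale[OF N] vNA_mult[OF N] vNA_one[OF N] cN)
  have xsa: "sa x" unfolding x_def by (intro sa_add sa_scale sa_mult sa_one c) auto
  have xv: "Re (ip (x v) v) = (nrm v)\<^sup>2 - (nrm (c v))\<^sup>2" if "v \<in> V" for v
    using that sa_ip[OF c(1), of "c v" v] by (simp add: x_def Re_ip_self)
  have x01: "0 \<le> Re (ip (x v) v)" "Re (ip (x v) v) \<le> (nrm v)\<^sup>2" if "v \<in> V" for v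
    using that c(2) by (auto simp: xv contr_def power_mono)
  note [simp] = OpD[OF saO[OF xsa]]
  have yN: "y n \<in> N" for n
  proof (induction n)
    case 0 show ?case unfolding y0 by (intro vNA_scale[OF N] vNA_one[OF N])
  next
    case (Suc n) then show ?case unfolding yS
      by (intro vNA_add[OF N] vNA_scale[OF N] vNA_mult[OF N] xN)
  qed
  have yO: "y n \<in> Op" for n using yN NO by blast
  note [simp] = OpD[OF yO]
  have ysa: "sa (y n)" for n
  proof (induction n)
    case 0 show ?case unfolding y0 by (intro sa_scale sa_one) simp
  next
    case (Suc n) then show ?case unfolding yS by (intro sa_scale sa_add sa_mult xsa) auto
  qed
  have ySv: "Re (ip (y (Suc n) v) v) = (Re (ip (x v) v) + (nrm (y n v))\<^sup>2) / 2" if "v \<in> V" for n v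
    using that sa_ip[OF ysa, of "y n v" v n] by (simp add: yS Re_ip_self)
  have y01: "pos (y n) \<and> le_one (y n)" for n
  proof (induction n)
    case 0 show ?case using ysa[of 0] by (simp add: pos_def le_one_def y0)
  next
    case (Suc n)
    then have "nrm (y n v) \<le> nrm v" if "v \<in> V" for v
      using pos_le_one_contr that by (auto simp: contr_def)
    then have sq: "(nrm (y n v))\<^sup>2 \<le> (nrm v)\<^sup>2" if "v \<in> V" for v using that by (intro power_mono) auto
    have "0 \<le> Re (ip (y (Suc n) v) v) \<and> Re (ip (y (Suc n) v) v) \<le> (nrm v)\<^sup>2" if "v \<in> V" for v
      unfolding ySv[OF that] by (rule half[OF x01[OF that] zero_le_power2 sq[OF that]])
    then show ?case using ysa[of "Suc n"] by (simp add: pos_def le_one_def)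
  qed
  have mono: "pos (op_sub (y (Suc n)) (y n))" for n
  proof (induction n)
    case 0
    have "sa (op_sub (y (Suc 0)) (y 0))" by (intro sa_add sa_scale ysa) simp
    moreover have "Re (ip (op_sub (y (Suc 0)) (y 0) v) v) = Re (ip (y (Suc 0) v) v)" if "v \<in> V" for v
      using that Op_closed[OF yO that, of "Suc 0"] by (simp only: op_apps) (simp add: y0)
    ultimately show ?case using y01[of "Suc 0"] unfolding pos_def by simp
  next
    \<comment> \<open>The next difference is half the product of \<open>s\<close> and
      \<open>p\<close>, two commuting positive operators.\<close>
    case (Suc n)
    define p where "p = op_sub (y (Suc n)) (y n)"
    define s where "s = op_add H (y (Suc n)) (y n)"
    have "le_one p" unfolding le_one_def
    proof
      fix v assume v: "v \<in> V"
      have "Re (ip (p v) v) = Re (ip (y (Suc n) v) v) - Re (ip (y n v) v)" using v by (simp add: p_def)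
      then show "Re (ip (p v) v) \<le> (nrm v)\<^sup>2" using y01[of n] y01[of "Suc n"] v
        unfolding pos_def le_one_def by fastforce
    qed
    moreover have "pos s" using y01[of n] y01[of "Suc n"] sa_add[OF ysa ysa]
      by (simp add: s_def pos_def)
    moreover have com: "y (Suc n) (y n v) = y n (y (Suc n) v)" if "v \<in> V" for v using ab yN that by blast
    have "s (p v) = p (s v)" if "v \<in> V" for v
      using that com by (intro vec_eqI) (simp_all add: s_def p_def algebra_simps)
    ultimately have sp: "0 \<le> Re (ip (s (p v)) v)" if "v \<in> V" for v
      using that Suc commuting_product_pos[of s p v] by (simp add: p_def)
    have stp: "Re (ip (op_sub (y (Suc (Suc n))) (y (Suc n)) v) v) = Re (ip (s (p v)) v) / 2" if v: "v \<in> V" for v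
    proof -
      have 1: "ip (y (Suc (Suc n)) v) v = (ip (x v) v + ip (y (Suc n) (y (Suc n) v)) v) / 2"
        using v by (subst yS) simp
      have 2: "ip (y (Suc n) v) v = (ip (x v) v + ip (y n (y n v)) v) / 2"
        using v by (subst yS) simp
      have 3: "ip (s (p v)) v = ip (y (Suc n) (y (Suc n) v)) v - ip (y n (y n v)) v"
        using v com[OF v] by (simp add: s_def p_def)
      show ?thesis using v by (simp add: 1 2 3 del: times_divide_eq_left) (simp add: field_simps)
    qed
    have "sa (op_sub (y (Suc (Suc n))) (y (Suc n)))" by (intro sa_add sa_scale ysa) simp
    moreover have "0 \<le> Re (ip (op_sub (y (Suc (Suc n))) (y (Suc n)) v) v)" if "v \<in> V" for v
      unfolding stp[OF that] using sp[OF that] by simp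
    ultimately show ?case unfolding pos_def by blast
  qed
  have "\<forall>\<^sub>F n in sequentially. y n \<in> Op \<and> contr (y n)" using yO y01 pos_le_one_contr by simp
  \<comment> \<open>A weak cluster point gives only a candidate, since squaring is not weakly
    continuous; monotonicity then upgrades it to a strong limit of the whole sequence.\<close>
  from weak_cluster[OF _ this] obtain L G where L: "L \<in> Op" "contr L"
    and G: "G \<le> sequentially" "G \<noteq> bot" and lim: "wlim y L G" by auto
  note [simp] = OpD[OF L(1)]
  have LN: "L \<in> N" using wlim_in_vNA[OF N lim G(2) L(1)] yN by simp
  have Lsa: "sa L" using wlim_sa[OF lim G(2) L(1) ysa] .
  have re: "(\<lambda>n. Re (ip (y n v) v)) \<longlonglongrightarrow> Re (ip (L v) v)"
    and up: "Re (ip (y n v) v) \<le> Re (ip (L v) v)" if v: "v \<in> V" for v n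
  proof -
    have inc: "incseq (\<lambda>n. Re (ip (y n v) v))"
      by (rule incseq_SucI) (use mono v in \<open>auto simp: pos_def\<close>)
    have "Re (ip (y n v) v) \<le> (nrm v)\<^sup>2" for n using y01[of n] v by (simp add: le_one_def)
    then obtain l where l: "(\<lambda>n. Re (ip (y n v) v)) \<longlonglongrightarrow> l" "\<forall>n. Re (ip (y n v) v) \<le> l"
      using incseq_convergent[OF inc] by metis
    have "((\<lambda>n. Re (ip (y n v) v)) \<longlongrightarrow> l) G" using l(1) G(1) tendsto_mono by blast
    moreover have "((\<lambda>n. Re (ip (y n v) v)) \<longlongrightarrow> Re (ip (L v) v)) G"
      using v by (intro tendsto_Re wlimD[OF lim])
    ultimately have "l = Re (ip (L v) v)" using G(2) tendsto_unique by blast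
    then show "(\<lambda>n. Re (ip (y n v) v)) \<longlonglongrightarrow> Re (ip (L v) v)" "Re (ip (y n v) v) \<le> Re (ip (L v) v)"
      using l by auto
  qed
  have L1: "Re (ip (L v) v) \<le> (nrm v)\<^sup>2" if "v \<in> V" for v
    using re[OF that] y01 that by (intro LIMSEQ_le_const2) (auto simp: le_one_def)
  \<comment> \<open>Since \<open>0 \<le> L - y n \<le> 1\<close>, \<open>square_le\<close> bounds
    the squared norm by the quadratic form, which tends to 0.\<close>
  have strong: "(\<lambda>n. nrm (L v \<ominus> y n v)) \<longlonglongrightarrow> 0" if v: "v \<in> V" for v
  proof -
    have D: "pos (op_sub L (y n))" "le_one (op_sub L (y n))" for n
    proof -
      have "sa (op_sub L (y n))" by (intro sa_add sa_scale ysa Lsa) simp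
      then show "pos (op_sub L (y n))" using up by (simp add: pos_def)
      show "le_one (op_sub L (y n))" unfolding le_one_def
      proof
        fix v assume v: "v \<in> V"
        have "0 \<le> Re (ip (y n v) v)" using y01[of n] v by (simp add: pos_def)
        then show "Re (ip (op_sub L (y n) v) v) \<le> (nrm v)\<^sup>2" using L1[OF v] v by simp
      qed
    qed
    have eq: "op_sub L (y n) v = L v \<ominus> y n v" for n using v by (intro vec_eqI) auto
    have sq: "(nrm (L v \<ominus> y n v))\<^sup>2 \<le> Re (ip (L v) v) - Re (ip (y n v) v)" for n
      using square_le[OF D v, of n] v by (simp only: eq) simp
    have "(\<lambda>n. Re (ip (L v) v) - Re (ip (y n v) v)) \<longlonglongrightarrow> Re (ip (L v) v) - Re (ip (L v) v)"
      by (intro tendsto_diff tendsto_const re v)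
    then have "(\<lambda>n. Re (ip (L v) v) - Re (ip (y n v) v)) \<longlonglongrightarrow> 0" by simp
    then have "(\<lambda>n. (nrm (L v \<ominus> y n v))\<^sup>2) \<longlonglongrightarrow> 0"
      by (rule Lim_null_comparison[rotated]) (use sq in auto)
    then have "(\<lambda>n. sqrt ((nrm (L v \<ominus> y n v))\<^sup>2)) \<longlonglongrightarrow> sqrt 0" by (intro tendsto_real_sqrt)
    then show ?thesis using v by simp
  qed
  have ipl: "(\<lambda>n. ip (y n v) w) \<longlonglongrightarrow> ip (L v) w" if "v \<in> V" "w \<in> V" for v w
  proof -
    have "(\<lambda>n. ip (L v) w - ip (y n v) w) \<longlonglongrightarrow> 0"
    proof (rule Lim_null_comparison)
      show "\<forall>\<^sub>F n in sequentially. norm (ip (L v) w - ip (y n v) w) \<le> nrm (L v \<ominus> y n v) * nrm w"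
        using that Cauchy_Schwarz[of "L v \<ominus> y _ v" w] by simp
      have "(\<lambda>n. nrm (L v \<ominus> y n v) * nrm w) \<longlonglongrightarrow> 0 * nrm w" by (intro tendsto_intros strong that)
      then show "(\<lambda>n. nrm (L v \<ominus> y n v) * nrm w) \<longlonglongrightarrow> 0" by simp
    qed
    from tendsto_diff[OF tendsto_const[of "ip (L v) w"] this] show ?thesis by simp
  qed
  have ipll: "(\<lambda>n. ip (y n v) (y n w)) \<longlonglongrightarrow> ip (L v) (L w)" if "v \<in> V" "w \<in> V" for v w
  proof -
    have "(\<lambda>n. ip (y n v) (L w) - ip (y n v) (y n w)) \<longlonglongrightarrow> 0"
    proof (rule Lim_null_comparison)
      show "\<forall>\<^sub>F n in sequentially. norm (ip (y n v) (L w) - ip (y n v) (y n w)) \<le> nrm v * nrm (L w \<ominus> y n w)"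
      proof (intro always_eventually allI)
        fix n
        have "norm (ip (y n v) (L w) - ip (y n v) (y n w)) \<le> nrm (y n v) * nrm (L w \<ominus> y n w)"
          using that Cauchy_Schwarz[of "y n v" "L w \<ominus> y n w"] by simp
        also have "\<dots> \<le> nrm v * nrm (L w \<ominus> y n w)"
          using that y01[of n] pos_le_one_contr[of "y n"] by (intro mult_right_mono) (auto simp: contr_def)
        finally show "norm (ip (y n v) (L w) - ip (y n v) (y n w)) \<le> nrm v * nrm (L w \<ominus> y n w)" .
      qed
      have "(\<lambda>n. nrm v * nrm (L w \<ominus> y n w)) \<longlonglongrightarrow> nrm v * 0" by (intro tendsto_intros strong that)
      then show "(\<lambda>n. nrm v * nrm (L w \<ominus> y n w)) \<longlonglongrightarrow> 0" by simp
    qed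
    from tendsto_diff[OF ipl[of v "L w"] this] show ?thesis using that by simp
  qed
  have eqn: "ip (L v) w = (ip (x v) w + ip (L (L v)) w) / 2" if "v \<in> V" "w \<in> V" for v w
  proof -
    have "ip (y (Suc n) v) w = (ip (x v) w + ip (y n v) (y n w)) / 2" for n
      using that by (simp add: yS sa_ip[OF ysa])
    moreover have "(\<lambda>n. (ip (x v) w + ip (y n v) (y n w)) / 2) \<longlonglongrightarrow> (ip (x v) w + ip (L v) (L w)) / 2"
      by (intro tendsto_intros ipll that) simp
    ultimately have "(\<lambda>n. ip (y (Suc n) v) w) \<longlonglongrightarrow> (ip (x v) w + ip (L v) (L w)) / 2"
      by (simp only:)
    then have "ip (L v) w = (ip (x v) w + ip (L v) (L w)) / 2"
      using LIMSEQ_Suc[OF ipl[OF that]] LIMSEQ_unique by blast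
    then show ?thesis using that sa_ip[OF Lsa, of "L v" w] by simp
  qed
  \<comment> \<open>Then \<open>d\<^sup>2 = 1 - 2 L + L\<^sup>2 = 1 - x = c\<^sup>2\<close>, and
    \<open>0 \<le> L \<le> 1\<close> puts \<open>d\<close> in the same range.\<close>
  define d where "d = op_sub (op_one H) L"
  have dN: "d \<in> N" unfolding d_def by (intro vNA_add[OF N] vNA_scale[OF N] vNA_one[OF N] LN)
  have "sa d" unfolding d_def by (intro sa_add sa_scale sa_one Lsa) simp
  then have "pos d" using L1 by (simp add: pos_def d_def Re_ip_self)
  moreover have "le_one d" unfolding le_one_def
  proof
    fix v assume v: "v \<in> V"
    have "0 \<le> Re (ip (y 0 v) v)" using y01[of 0] v by (simp add: pos_def)
    then have "0 \<le> Re (ip (L v) v)" using up[OF v, of 0] by simp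
    then show "Re (ip (d v) v) \<le> (nrm v)\<^sup>2" using v by (simp add: d_def Re_ip_self)
  qed
  moreover have "d (d v) = c (c v)" if v: "v \<in> V" for v
  proof (rule vec_eqI)
    fix z assume z: "z \<in> V"
    have "ip (d (d v)) z = ip v z - 2 * ip (L v) z + ip (L (L v)) z" using v z by (simp add: d_def)
    also have "\<dots> = ip v z - ip (x v) z" using eqn[OF v z] by (simp add: field_simps)
    also have "\<dots> = ip (c (c v)) z" using v z by (simp add: x_def)
    finally show "ip (d (d v)) z = ip (c (c v)) z" .
  qed (use v NO[OF dN] in \<open>auto simp: OpD\<close>)
  ultimately show ?thesis using that[of d] dN by (simp add: N_def)
qed

section \<open>Digits of self-adjoint operators\<close>

definition symmetry :: "('a \<Rightarrow> 'a) \<Rightarrow> bool" where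
  "symmetry u \<longleftrightarrow> sa u \<and> (\<forall>x\<in>V. u (u x) = x)"

lemma symmetry_isometry: "\<lbrakk>symmetry u; x \<in> V\<rbrakk> \<Longrightarrow> nrm (u x) = nrm x"
proof -
  assume a: "symmetry u" "x \<in> V"
  then have u: "sa u" "u x \<in> V" "u (u x) = x" by (auto simp: symmetry_def intro: Op_closed saO)
  have "ip (u x) (u x) = ip x x" using sa_ip[OF u(1) a(2) u(2)] u(3) by simp
  then show ?thesis by (simp add: hnorm_def)
qed

text \<open>With \<open>d\<close> the absolute value of \<open>c\<close>, the sign \<open>u\<close>
  is -1 on the closure of the range of \<open>d - c\<close> and 1 on its complement, so
  \<open>c u = d\<close>. The remainder has square \<open>4 d\<^sup>2 - 4 d + 1 \<le> 1\<close>; it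
  is again a contraction, and the next digit can be taken from it.\<close>

lemma sign_exists:
  assumes c: "sa c" "contr c"
  obtains u where "u \<in> bicomm {c}" "symmetry u"
    "sa (op_sub (op_scale H 2 c) u)" "contr (op_sub (op_scale H 2 c) u)"
proof -
  obtain d where d: "d \<in> bicomm {c}" "pos d" "le_one d" and dd: "\<And>v. v \<in> V \<Longrightarrow> d (d v) = c (c v)"
    using abs_exists[OF c] by blast
  have cO: "c \<in> Op" and dO: "d \<in> Op" using c d saO posO by auto
  note [simp] = OpD[OF cO] OpD[OF dO]
  have dsa: "sa d" using d pos_sa by blast
  have cd: "c (d v) = d (c v)" if "v \<in> V" for v
    using bicomm_abelian[OF cO bicomm_mem[OF cO] d(1) that] .
  define R where "R = (\<lambda>v. d v \<ominus> c v) ` V"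
  have RV: "R \<subseteq> V" by (auto simp: R_def)
  have perpR: "v \<in> perp R \<longleftrightarrow> v \<in> V \<and> d v = c v" for v
  proof
    assume v: "v \<in> perp R"
    then have vV: "v \<in> V" by (rule perpV)
    have "ip (d v) w = ip (c v) w" if w: "w \<in> V" for w
    proof -
      have "ip v (d w \<ominus> c w) = 0" using v w by (auto simp: perp_def R_def)
      then show ?thesis using vV w by (simp add: sa_ip[OF dsa] sa_ip[OF c(1)])
    qed
    then show "v \<in> V \<and> d v = c v" using vV by (auto intro: vec_eqI)
  next
    assume v: "v \<in> V \<and> d v = c v"
    have "ip v (d w \<ominus> c w) = 0" if w: "w \<in> V" for w
    proof -
      have "ip v (d w \<ominus> c w) = ip (d v) w - ip (c v) w"
        using v w sa_ip[OF dsa, of v w] sa_ip[OF c(1), of v w] by simp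
      then show ?thesis using v by simp
    qed
    then show "v \<in> perp R" using v by (auto simp: perp_def R_def)
  qed
  define e where "e = proj R"
  have eO: "e \<in> Op" unfolding e_def by (rule proj_Op[OF RV])
  note [simp] = OpD[OF eO]
  have esa: "sa e" unfolding sa_def using eO proj_sa[OF RV] by (simp add: e_def)
  have ee: "e (e v) = e v" if "v \<in> V" for v
    unfolding e_def using proj_mem(1)[OF RV that] by (rule proj_id[OF RV])
  have e1: "d (v \<ominus> e v) = c (v \<ominus> e v)" if "v \<in> V" for v
    using proj_mem(2)[OF RV that] unfolding perpR e_def by blast
  have e2: "d (e v) \<oplus> c (e v) = \<zero>" if v: "v \<in> V" for v
  proof (rule vec_eqI)
    fix w assume w: "w \<in> V"
    \<comment> \<open>\<open>(d - c) (d + c) = d\<^sup>2 - c\<^sup>2 = 0\<close>, so this vector is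
      orthogonal to the range of \<open>d - c\<close>.\<close>
    have "d w \<oplus> c w \<in> perp R" unfolding perpR using w dd cd by (auto intro!: vec_eqI)
    moreover have "e v \<in> perp (perp R)" unfolding e_def by (rule proj_mem(1)[OF RV v])
    ultimately have "ip (e v) (d w \<oplus> c w) = 0" using perp_perp2[OF RV] by blast
    then show "ip (d (e v) \<oplus> c (e v)) w = ip \<zero> w"
      using v w by (simp add: sa_ip[OF dsa] sa_ip[OF c(1)])
  qed (use v in auto)
  \<comment> \<open>Whatever commutes with \<open>c\<close> also commutes with \<open>d\<close>, an
    element of the bicommutant, and therefore preserves the range \<open>R\<close>.\<close>
  have eN: "e \<in> bicomm {c}" unfolding e_def
  proof (rule proj_commutant[OF commutant_Op _ RV])
    have "{c} \<subseteq> Op" "\<And>T. T \<in> {c} \<Longrightarrow> adj T \<in> {c}" using c by (auto simp: sa_adj)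
    then show "adj T \<in> commutant H {c}" if "T \<in> commutant H {c}" for T
      using that by (rule commutant_adj)
    fix T s assume T: "T \<in> commutant H {c}" and "s \<in> R"
    then obtain v where v: "v \<in> V" "s = d v \<ominus> c v" by (auto simp: R_def)
    have TO: "T \<in> Op" using T commutant_Op by blast
    have "T (c v) = c (T v)" using commutantD[OF T _ v(1)] by simp
    moreover have "d (T v) = T (d v)" using commutantD[OF d(1) T v(1)] .
    ultimately have "T s = d (T v) \<ominus> c (T v)" using v by (simp add: OpD[OF TO])
    then show "T s \<in> R" using v OpD[OF TO] by (auto simp: R_def)
  qed
  define u where "u = op_sub (op_one H) (op_scale H 2 e)"
  have "von_neumann_algebra H (bicomm {c})" by (rule bicomm_vNA[OF c(1)])
  then have uN: "u \<in> bicomm {c}" unfolding u_def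
    by (intro vNA_add vNA_scale vNA_one eN)
  have usa: "sa u" unfolding u_def by (intro sa_add sa_scale sa_one esa) auto
  have uu: "u (u v) = v" if "v \<in> V" for v
    using that by (intro vec_eqI) (simp_all add: u_def ee)
  have sym: "symmetry u" using usa uu by (simp add: symmetry_def)
  have cu: "c (u v) = d v" if v: "v \<in> V" for v
  proof (rule vec_eqI)
    fix z assume z: "z \<in> V"
    have "ip (d (v \<ominus> e v)) z = ip (c (v \<ominus> e v)) z" using e1[OF v] by simp
    moreover have "ip (d (e v) \<oplus> c (e v)) z = 0" using e2[OF v] z by simp
    then have "ip (d (e v)) z = - ip (c (e v)) z" using v z by (simp add: eq_neg_iff_add_eq_0)
    ultimately show "ip (c (u v)) z = ip (d v) z" using v z by (simp add: u_def algebra_simps)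
  qed (use v saO[OF usa] in \<open>auto simp: Op_closed\<close>)
  note [simp] = OpD[OF saO[OF usa]]
  have "contr (op_sub (op_scale H 2 c) u)" unfolding contr_def
  proof
    fix v assume v: "v \<in> V"
    have 1: "ip (c v) (c v) = ip (d v) (d v)"
      using v dd[OF v] sa_ip[OF c(1), of v "c v"] sa_ip[OF dsa, of v "d v"] by simp
    have 2: "ip (c v) (u v) = ip v (d v)" using v cu[OF v] sa_ip[OF c(1), of v "u v"] by simp
    have 3: "ip (u v) (c v) = ip (d v) v"
      using v 2 hinner_commute[of "c v" "u v"] hinner_commute[of v "d v"] by simp
    have 4: "ip (u v) (u v) = ip v v" using v uu[OF v] sa_ip[OF usa, of v "u v"] by simp
    have 5: "ip v (d v) = ip (d v) v" using v sa_ip[OF dsa v v] by simp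
    have "(nrm (op_sub (op_scale H 2 c) u v))\<^sup>2 = 4 * (nrm (d v))\<^sup>2 - 4 * Re (ip (d v) v) + (nrm v)\<^sup>2"
      using v by (simp flip: Re_ip_self add: 1 2 3 4 5)
    also have "\<dots> \<le> (nrm v)\<^sup>2" using square_le[OF d(2,3) v] by simp
    finally show "nrm (op_sub (op_scale H 2 c) u v) \<le> nrm v"
      by (rule power2_le_imp_le) (use v in simp)
  qed
  moreover have "sa (op_sub (op_scale H 2 c) u)" by (intro sa_add sa_scale usa c) auto
  ultimately show ?thesis using that uN sym by blast
qed

lemma bicomm_subset: "c \<in> bicomm X \<Longrightarrow> bicomm {c} \<subseteq> bicomm X"
  by (rule commutant_antimono) (auto simp: commutant_iff)

text \<open>The digits satisfy \<open>a = \<Sum>n. u\<^sub>n / 2\<^bsup>n+1\<^esup>\<close>.\<close>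

lemma digits_exist:
  assumes a: "sa a" "contr a"
  obtains u :: "nat \<Rightarrow> 'a \<Rightarrow> 'a" where "\<And>n. u n \<in> bicomm {a}" "\<And>n. symmetry (u n)"
    "commutant H (range u) \<subseteq> commutant H {a}"
proof -
  define P where "P c u \<longleftrightarrow> u \<in> bicomm {c} \<and> symmetry u \<and>
    sa (op_sub (op_scale H 2 c) u) \<and> contr (op_sub (op_scale H 2 c) u)" for c u
  define sg where "sg c = (SOME u. P c u)" for c
  have sg: "P c (sg c)" if c: "sa c" "contr c" for c
  proof -
    obtain u where "P c u" using sign_exists[OF c] unfolding P_def by metis
    then show ?thesis unfolding sg_def by (rule someI[of "P c"])
  qed
  \<comment> \<open>\<open>A n\<close> is the rescaled remainder
    \<open>2^n (a - \<Sum>k<n. u k / 2^(k+1))\<close>. It stays a contraction by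
    \<open>sign_exists\<close>, which keeps the recursion going.\<close>
  define A where "A = rec_nat a (\<lambda>_ c. op_sub (op_scale H 2 c) (sg c))"
  have A0: "A 0 = a" and AS: "A (Suc n) = op_sub (op_scale H 2 (A n)) (sg (A n))" for n
    by (simp_all add: A_def)
  have N: "von_neumann_algebra H (bicomm {a})" by (rule bicomm_vNA[OF a(1)])
  have inv: "sa (A n) \<and> contr (A n) \<and> A n \<in> bicomm {a}" for n
  proof (induction n)
    case 0 then show ?case using a bicomm_mem[OF saO] by (simp add: A0)
  next
    case (Suc n)
    then have "P (A n) (sg (A n))" by (intro sg) auto
    moreover from this have "sg (A n) \<in> bicomm {a}" using Suc bicomm_subset by (auto simp: P_def)
    then have "A (Suc n) \<in> bicomm {a}" unfolding AS using Suc
      by (intro vNA_add[OF N] vNA_scale[OF N]) auto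
    ultimately show ?case by (auto simp: P_def AS)
  qed
  have AO: "A n \<in> Op" for n using inv saO by blast
  define u where "u n = sg (A n)" for n
  have Pu: "P (A n) (u n)" for n unfolding u_def using inv by (intro sg) auto
  have uO: "u n \<in> Op" for n using Pu commutant_Op by (auto simp: P_def)
  show ?thesis
  proof (rule that[of u])
    show "u n \<in> bicomm {a}" for n using Pu[of n] bicomm_subset[of "A n"] inv[of n] by (auto simp: P_def)
    show "symmetry (u n)" for n using Pu by (simp add: P_def)
    show "commutant H (range u) \<subseteq> commutant H {a}"
    proof
      fix T assume T: "T \<in> commutant H (range u)"
      then have TO: "T \<in> Op" using commutant_Op by blast
      note [simp] = OpD[OF TO] OpD[OF AO] OpD[OF uO]
      obtain C where C: "C \<ge> 0" "\<forall>x\<in>V. nrm (T x) \<le> C * nrm x" using Op_bounded[OF TO] by blast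
      have "T (a v) = a (T v)" if v: "v \<in> V" for v
      proof -
        \<comment> \<open>\<open>T\<close> commutes with the digits, so its commutator with the
          remainder doubles at each step, while contractivity bounds all these commutators alike;
          hence the first one vanishes.\<close>
        define D where "D n = T (A n v) \<ominus> A n (T v)" for n
        have DV: "D n \<in> V" for n using v by (simp add: D_def)
        have uc: "T (u n v) = u n (T v)" for n using commutantD[OF T _ v] by simp
        have DS: "D (Suc n) = 2 \<odot> D n" for n
          unfolding D_def AS using v uc[of n]
          by (intro vec_eqI) (simp_all flip: u_def add: algebra_simps)
        have Dn: "nrm (D n) = 2 ^ n * nrm (D 0)" for n
          by (induction n) (simp_all add: DS DV)
        have "nrm (D n) \<le> 2 * C * nrm v" for n
        proof -
          have "nrm (D n) \<le> nrm (T (A n v)) + nrm (A n (T v))"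
            using nrm_triangle[of "T (A n v)" "\<ominus> A n (T v)"] v by (simp add: D_def a_minus_def)
          also have "nrm (T (A n v)) \<le> C * nrm (A n v)" using C v by simp
          also have "C * nrm (A n v) \<le> C * nrm v" using C inv[of n] v by (intro mult_left_mono) (auto simp: contr_def)
          also have "nrm (A n (T v)) \<le> nrm (T v)" using inv[of n] v by (simp add: contr_def)
          also have "nrm (T v) \<le> C * nrm v" using C v by simp
          finally show ?thesis by simp
        qed
        then have le: "2 ^ n * nrm (D 0) \<le> 2 * C * nrm v" for n by (simp flip: Dn)
        have "nrm (D 0) = 0"
        proof (rule ccontr)
          assume "nrm (D 0) \<noteq> 0"
          then have p: "nrm (D 0) > 0" using nrm_ge_0[OF DV[of 0]] by simp
          obtain n where "2 * C * nrm v / nrm (D 0) < 2 ^ n"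
            using real_arch_pow[of 2 "2 * C * nrm v / nrm (D 0)"] by auto
          then show False using le[of n] p by (simp add: field_simps)
        qed
        then have "D 0 = \<zero>" using DV nrm_eq_0 by blast
        then show ?thesis using v a saO by (simp add: D_def A0 diff_eq_zero Op_closed)
      qed
      then show "T \<in> commutant H {a}" using TO by (simp add: commutant_iff)
    qed
  qed
qed

text \<open>With \<open>C = [A, u]\<close> the hypothesis gives \<open>4 u C = C w - w C\<close>, hence \<open>4 \<parallel>C\<parallel> \<le> 2 \<parallel>C\<parallel>\<close>.\<close>

lemma commute_dominant_symmetry:
  assumes A: "A \<in> Op" and u: "symmetry u" and w: "w \<in> Op" "contr w"
    and uw: "\<And>x. x \<in> V \<Longrightarrow> u (w x) = w (u x)"
    and com: "\<And>x. x \<in> V \<Longrightarrow> A ((2 \<odot> u x) \<oplus> w x) = (2 \<odot> u (A x)) \<oplus> w (A x)"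
    and x: "x \<in> V"
  shows "A (u x) = u (A x)"
proof -
  have uO: "u \<in> Op" using u by (simp add: symmetry_def saO)
  have uu: "u (u x) = x" if "x \<in> V" for x using u that by (simp add: symmetry_def)
  note [simp] = OpD[OF A] OpD[OF uO] OpD[OF w(1)]
  define C where "C v = A (u v) \<ominus> u (A v)" for v
  have CV [simp]: "v \<in> V \<Longrightarrow> C v \<in> V" for v by (simp add: C_def)
  have lin: "4 * r - 4 * m = s - p - q + t" if "2 * r + p = 2 * m + t" "2 * m + s = 2 * r + q"
    for p q r s t m :: complex
  proof -
    have "p = 2 * m + t - 2 * r" "s = 2 * r + q - 2 * m" using that by (simp_all add: algebra_simps)
    then show ?thesis by simp
  qed
  \<comment> \<open>\<open>C\<close> anticommutes with \<open>u\<close>, so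
    \<open>4 u C = 2 (u C - C u)\<close>; \<open>ii\<close> and \<open>iii\<close> are the
    hypothesis multiplied by \<open>u\<close> on the left and on the right.\<close>
  have key: "4 \<odot> u (C v) = C (w v) \<ominus> w (C v)" if v: "v \<in> V" for v
  proof (rule vec_eqI)
    fix z assume z: "z \<in> V"
    have i: "2 * ip (A (u t)) s + ip (A (w t)) s = 2 * ip (u (A t)) s + ip (w (A t)) s"
      if "t \<in> V" "s \<in> V" for t s
    proof -
      have "ip (A ((2 \<odot> u t) \<oplus> w t)) s = ip ((2 \<odot> u (A t)) \<oplus> w (A t)) s" using com that by simp
      then show ?thesis using that by simp
    qed
    have "2 \<odot> A (u v) \<oplus> A (w v) = 2 \<odot> u (A v) \<oplus> w (A v)" using com[OF v] v by simp
    then have "u (2 \<odot> A (u v) \<oplus> A (w v)) = u (2 \<odot> u (A v) \<oplus> w (A v))" by simp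
    then have "ip (u (2 \<odot> A (u v) \<oplus> A (w v))) z = ip (u (2 \<odot> u (A v) \<oplus> w (A v))) z" by simp
    then have ii: "2 * ip (u (A (u v))) z + ip (u (A (w v))) z = 2 * ip (A v) z + ip (u (w (A v))) z"
      using v z by (simp add: uu)
    have iii: "2 * ip (A v) z + ip (A (w (u v))) z = 2 * ip (u (A (u v))) z + ip (w (A (u v))) z"
      using i[of "u v" z] v z by (simp add: uu)
    show "ip (4 \<odot> u (C v)) z = ip (C (w v) \<ominus> w (C v)) z"
      using lin[OF ii iii] v z uw by (simp add: C_def uu algebra_simps)
  qed (use v in auto)
  obtain K where K: "K \<ge> 0" "\<forall>x\<in>V. nrm (A x) \<le> K * nrm x" using Op_bounded[OF A] by blast
  \<comment> \<open>Each application of \<open>key\<close> halves the bound, uniformly in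
    \<open>v\<close>; the initial \<open>2 * K\<close> uses that \<open>u\<close> is
    isometric.\<close>
  have b: "nrm (C v) \<le> (2 * K / 2 ^ n) * nrm v" if "v \<in> V" for n v
    using that
  proof (induction n arbitrary: v)
    case (0 v)
    have "nrm (C v) \<le> nrm (A (u v)) + nrm (u (A v))"
      using nrm_triangle[of "A (u v)" "\<ominus> u (A v)"] 0 by (simp add: C_def a_minus_def)
    also have "nrm (A (u v)) \<le> K * nrm (u v)" using K 0 by simp
    also have "nrm (u v) = nrm v" using symmetry_isometry[OF u 0] .
    also have "nrm (u (A v)) = nrm (A v)" using symmetry_isometry[OF u, of "A v"] 0 by simp
    also have "nrm (A v) \<le> K * nrm v" using K 0 by simp
    finally show ?case by simp
  next
    case (Suc n v)
    have "4 * nrm (C v) = nrm (4 \<odot> u (C v))" using Suc symmetry_isometry[OF u, of "C v"] by simp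
    also have "\<dots> = nrm (C (w v) \<ominus> w (C v))" using key[OF Suc(2)] by simp
    also have "\<dots> \<le> nrm (C (w v)) + nrm (w (C v))"
      using nrm_triangle[of "C (w v)" "\<ominus> w (C v)"] Suc by (simp add: a_minus_def)
    also have "nrm (w (C v)) \<le> nrm (C v)" using w Suc by (simp add: contr_def)
    also have "nrm (C v) \<le> (2 * K / 2 ^ n) * nrm v" using Suc by blast
    also have "nrm (C (w v)) \<le> (2 * K / 2 ^ n) * nrm (w v)" using Suc by simp
    also have "\<dots> \<le> (2 * K / 2 ^ n) * nrm v" using w Suc K by (intro mult_left_mono) (auto simp: contr_def)
    finally have "4 * nrm (C v) \<le> 2 * ((2 * K / 2 ^ n) * nrm v)" by simp
    then show ?case by (simp add: field_simps)
  qed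
  have "nrm (C x) = 0"
  proof (rule ccontr)
    assume "nrm (C x) \<noteq> 0"
    then have p: "nrm (C x) > 0" using nrm_ge_0[OF CV[OF x]] by simp
    obtain n where "2 * K * nrm x / nrm (C x) < 2 ^ n"
      using real_arch_pow[of 2 "2 * K * nrm x / nrm (C x)"] by auto
    then show False using b[OF x, of n] p by (simp add: field_simps)
  qed
  then have "C x = \<zero>" using x nrm_eq_0 by simp
  then show ?thesis using x by (simp add: C_def diff_eq_zero)
qed

text \<open>The witness is \<open>a = \<Sum>n. (2 / 3\<^bsup>n+1\<^esup>) e\<^sub>n\<close>; at each scale the term \<open>e\<^sub>n\<close>
  dominates the remaining ones, so that it can be read off from the tail.\<close>

lemma ternary_sum:
  fixes e :: "nat \<Rightarrow> 'a \<Rightarrow> 'a"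
  assumes M: "von_neumann_algebra H M" and eM: "\<And>n. e n \<in> M" and e: "\<And>n. symmetry (e n)"
    and com: "\<And>m n x. x \<in> V \<Longrightarrow> e m (e n x) = e n (e m x)"
  obtains a where "a \<in> M" "sa a" "commutant H {a} \<subseteq> commutant H (range e)"
proof -
  have eO: "e n \<in> Op" for n using e by (simp add: symmetry_def saO)
  have esa: "sa (e n)" for n using e by (simp add: symmetry_def)
  define s where "s = rec_nat (op_scale H 0 (op_one H)) (\<lambda>n t. op_add H t (op_scale H (2 / 3 ^ Suc n) (e n)))"
  have s0: "s 0 = op_scale H 0 (op_one H)"
    and sS: "s (Suc n) = op_add H (s n) (op_scale H (2 / 3 ^ Suc n) (e n))" for n
    by (simp_all add: s_def)
  have sM: "s n \<in> M" for n
    by (induction n) (auto simp: s0 sS intro!: vNA_add[OF M] vNA_scale[OF M] vNA_one[OF M] eM)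
  have sO: "s n \<in> Op" for n using sM vNA_Op[OF M] by blast
  note [simp] = OpD[OF eO] OpD[OF sO]
  have im: "Im (2 / 3 ^ Suc n) = 0" for n
  proof -
    have "2 / 3 ^ Suc n = complex_of_real (2 / 3 ^ Suc n)" by simp
    then show ?thesis by (metis Im_complex_of_real)
  qed
  have ssa: "sa (s n)" for n
    by (induction n) (auto simp: s0 sS simp del: power_Suc intro!: sa_add sa_scale sa_one esa im)
  \<comment> \<open>The weights telescope, \<open>2 / 3^(j+1) = 1 / 3^j - 1 / 3^(j+1)\<close>, so
    the tail from \<open>n\<close> on has norm at most \<open>1 / 3^n\<close>.\<close>
  have diff: "nrm (s (n + k) v \<ominus> s n v) \<le> (1 / 3 ^ n - 1 / 3 ^ (n + k)) * nrm v" if v: "v \<in> V" for n k v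
  proof (induction k)
    case 0
    have "s n v \<ominus> s n v = \<zero>" using v by (simp add: diff_eq_zero)
    then show ?case by simp
  next
    case (Suc k)
    have eq: "s (n + Suc k) v \<ominus> s n v = (s (n + k) v \<ominus> s n v) \<oplus> (2 / 3 ^ Suc (n + k)) \<odot> e (n + k) v"
      using v by (intro vec_eqI) (simp_all add: sS)
    have "nrm (s (n + Suc k) v \<ominus> s n v) \<le> nrm (s (n + k) v \<ominus> s n v) + nrm ((2 / 3 ^ Suc (n + k)) \<odot> e (n + k) v)"
      unfolding eq using v by (intro nrm_triangle) auto
    also have "nrm ((2 / 3 ^ Suc (n + k)) \<odot> e (n + k) v) = 2 / 3 ^ Suc (n + k) * nrm v"
      using v symmetry_isometry[OF e v] by (simp add: norm_divide norm_power norm_mult)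
    also note Suc
    finally show ?case by (simp add: field_simps)
  qed
  have scontr: "contr (s n)" for n unfolding contr_def
  proof
    fix v assume v: "v \<in> V"
    have "s n v \<ominus> s 0 v = s n v" using v by (intro vec_eqI) (auto simp: s0)
    then have "nrm (s n v) \<le> (1 - 1 / 3 ^ n) * nrm v" using diff[OF v, of 0 n] by simp
    also have "\<dots> \<le> 1 * nrm v" using v by (intro mult_right_mono) auto
    finally show "nrm (s n v) \<le> nrm v" by simp
  qed
  have "\<forall>\<^sub>F n in sequentially. s n \<in> Op \<and> contr (s n)" using sO scontr by simp
  from weak_cluster[OF _ this] obtain L G where L: "L \<in> Op" "contr L"
    and G: "G \<le> sequentially" "G \<noteq> bot" and lim: "wlim s L G" by auto
  note [simp] = OpD[OF L(1)]
  have LM: "L \<in> M" using wlim_in_vNA[OF M lim G(2) L(1)] sM by simp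
  have Lsa: "sa L" using wlim_sa[OF lim G(2) L(1) ssa] .
  have tail: "nrm (L v \<ominus> s n v) \<le> 1 / 3 ^ n * nrm v" if v: "v \<in> V" for n v
  proof -
    define t where "t = L v \<ominus> s n v"
    have tV: "t \<in> V" using v by (simp add: t_def)
    have "((\<lambda>m. ip (s m v) t - ip (s n v) t) \<longlongrightarrow> ip (L v) t - ip (s n v) t) G"
      using v tV by (intro tendsto_diff tendsto_const wlimD[OF lim])
    then have l: "((\<lambda>m. cmod (ip (s m v) t - ip (s n v) t)) \<longlongrightarrow> cmod (ip (L v) t - ip (s n v) t)) G"
      by (rule tendsto_norm)
    have bd: "cmod (ip (s m v) t - ip (s n v) t) \<le> 1 / 3 ^ n * nrm v * nrm t" if mn: "n \<le> m" for m
    proof -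
      obtain k where k: "m = n + k" using le_Suc_ex[OF mn] by blast
      have "cmod (ip (s m v) t - ip (s n v) t) \<le> nrm (s m v \<ominus> s n v) * nrm t"
        using Cauchy_Schwarz[of "s m v \<ominus> s n v" t] v tV by simp
      also have "\<dots> \<le> ((1 / 3 ^ n - 1 / 3 ^ (n + k)) * nrm v) * nrm t"
        unfolding k using diff[OF v] tV by (intro mult_right_mono) auto
      also have "\<dots> \<le> 1 / 3 ^ n * nrm v * nrm t" using v tV by (intro mult_right_mono) auto
      finally show ?thesis .
    qed
    have "\<forall>\<^sub>F m in G. n \<le> m" by (rule filter_leD[OF G(1) eventually_ge_at_top])
    then have "\<forall>\<^sub>F m in G. cmod (ip (s m v) t - ip (s n v) t) \<le> 1 / 3 ^ n * nrm v * nrm t"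
      by eventually_elim (rule bd)
    then have "cmod (ip (L v) t - ip (s n v) t) \<le> 1 / 3 ^ n * nrm v * nrm t"
      using tendsto_upperbound[OF l _ G(2)] by blast
    moreover have "ip (L v) t - ip (s n v) t = ip t t" using v tV by (simp add: t_def)
    ultimately have "nrm t * nrm t \<le> (1 / 3 ^ n * nrm v) * nrm t"
      using tV by (simp add: ip_self norm_power power2_eq_square norm_mult)
    moreover have "0 \<le> nrm t" "0 \<le> 1 / 3 ^ n * nrm v" using tV v by auto
    ultimately have "nrm t \<le> 1 / 3 ^ n * nrm v" by (metis less_eq_real_def mult_le_cancel_right not_less)
    then show ?thesis by (simp add: t_def)
  qed
  \<comment> \<open>The tail from \<open>n\<close> on, rescaled to a contraction. In
    \<open>3 r n = 2 e n + r (Suc n)\<close> the digit has weight 2 against a contraction, which is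
    the situation of \<open>commute_dominant_symmetry\<close>.\<close>
  define r where "r n = op_scale H (3 ^ n) (op_sub L (s n))" for n
  have rO: "r n \<in> Op" for n using L sO by (simp add: r_def)
  have rcontr: "contr (r n)" for n unfolding contr_def
  proof
    fix v assume v: "v \<in> V"
    have "op_sub L (s n) v = L v \<ominus> s n v" using v by (intro vec_eqI) auto
    then have "nrm (r n v) = 3 ^ n * nrm (L v \<ominus> s n v)" using v by (simp add: r_def norm_power)
    also have "\<dots> \<le> 3 ^ n * (1 / 3 ^ n * nrm v)" using tail[OF v] by (intro mult_left_mono) auto
    finally show "nrm (r n v) \<le> nrm v" by simp
  qed
  have rec: "3 \<odot> r n v = 2 \<odot> e n v \<oplus> r (Suc n) v" if "v \<in> V" for n v
    using that by (intro vec_eqI) (simp_all add: r_def sS field_simps)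
  have es: "e m (s n v) = s n (e m v)" if v: "v \<in> V" for m n v
  proof (induction n)
    case 0 show ?case using v by (simp add: s0)
  next
    case (Suc n) then show ?case using v com[OF v, of m n] by (simp add: sS)
  qed
  have eL: "L (e m v) = e m (L v)" if v: "v \<in> V" for m v
    by (rule wlim_commute[OF lim G(2) L(1) _ eO _ v]) (simp_all add: sO es)
  have er: "e m (r n v) = r n (e m v)" if v: "v \<in> V" for m n v
    using v eL es by (simp add: r_def)
  have "commutant H {L} \<subseteq> commutant H (range e)"
  proof
    fix A assume A: "A \<in> commutant H {L}"
    then have AO: "A \<in> Op" using commutant_Op by blast
    note [simp] = OpD[OF AO]
    have AL: "A (L v) = L (A v)" if "v \<in> V" for v using commutantD[OF A _ that] by simp
    \<comment> \<open>Once \<open>A\<close> commutes with \<open>L\<close> and \<open>s n\<close> it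
      commutes with \<open>r n\<close>; the digit \<open>e n\<close> can then be split off, which
      leads to \<open>s (Suc n)\<close>.\<close>
    have ind: "\<forall>v\<in>V. A (s n v) = s n (A v)" for n
    proof (induction n)
      case 0 show ?case by (simp add: s0)
    next
      case (Suc n)
      have Ar: "A (r n v) = r n (A v)" if "v \<in> V" for v using Suc that AL by (simp add: r_def)
      have "A (e n v) = e n (A v)" if v: "v \<in> V" for v
      proof (rule commute_dominant_symmetry[OF AO e rO rcontr _ _ v])
        fix x assume x: "x \<in> V"
        show "e n (r (Suc n) x) = r (Suc n) (e n x)" using er x by blast
        have "A (3 \<odot> r n x) = 3 \<odot> r n (A x)" using Ar x by (simp add: Op_closed[OF rO])
        then show "A (2 \<odot> e n x \<oplus> r (Suc n) x) = 2 \<odot> e n (A x) \<oplus> r (Suc n) (A x)"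
          using rec x by simp
      qed
      then show ?case using Suc by (simp add: sS)
    qed
    have "A (e n v) = e n (A v)" if v: "v \<in> V" for n v
    proof (rule smult_cancel)
      show "(2 / 3 ^ Suc n :: complex) \<noteq> 0" by simp
      show "(2 / 3 ^ Suc n) \<odot> A (e n v) = (2 / 3 ^ Suc n) \<odot> e n (A v)"
      proof (rule vec_eqI)
        fix z assume z: "z \<in> V"
        have "A (s (Suc n) v) = s (Suc n) (A v)" using ind v by blast
        then have "ip (A (s (Suc n) v)) z = ip (s (Suc n) (A v)) z" by simp
        moreover have "A (s n v) = s n (A v)" using ind v by blast
        ultimately show "ip ((2 / 3 ^ Suc n) \<odot> A (e n v)) z = ip ((2 / 3 ^ Suc n) \<odot> e n (A v)) z"
          using v z by (simp add: sS)
      qed (use v in auto)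
    qed (use v in auto)
    then show "A \<in> commutant H (range e)" using AO by (auto simp: commutant_iff[of A])
  qed
  then show ?thesis using that LM Lsa by blast
qed

lemma single_generator:
  assumes M: "von_neumann_algebra H M" and a: "a \<in> M" "sa a" and b: "b \<in> M" "sa b"
    and gen: "commutant H {a, b} \<subseteq> commutant H M"
  shows "singly_generated H M"
proof -
  define g where "g = op_add H a (op_scale H \<i> b)"
  have aO: "a \<in> Op" and bO: "b \<in> Op" using a b saO by auto
  note [simp] = OpD[OF aO] OpD[OF bO]
  have gM: "g \<in> M" unfolding g_def by (intro vNA_add[OF M] vNA_scale[OF M] a b)
  have ga: "adj g = op_add H a (op_scale H (- \<i>) b)"
    using a(2) b(2) unfolding g_def by (simp add: adj_add adj_scale sa_adj)
  have "generates H {g} M"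
  proof (rule generatesI[OF M])
    show "{g} \<subseteq> M" using gM by simp
    have "commutant H ({g} \<union> adj ` {g}) \<subseteq> commutant H {a, b}"
    proof
      fix T assume T: "T \<in> commutant H ({g} \<union> adj ` {g})"
      then have TO: "T \<in> Op" using commutant_Op by blast
      note [simp] = OpD[OF TO]
      have "T (a v) = a (T v) \<and> T (b v) = b (T v)" if v: "v \<in> V" for v
      proof -
        have 1: "T (g v) = g (T v)" "T (adj g v) = adj g (T v)"
          using commutantD[OF T _ v] by auto
        have 2: "ip (T (a v)) z + \<i> * ip (T (b v)) z = ip (a (T v)) z + \<i> * ip (b (T v)) z"
          "ip (T (a v)) z - \<i> * ip (T (b v)) z = ip (a (T v)) z - \<i> * ip (b (T v)) z" if z: "z \<in> V" for z
        proof -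
          have "ip (T (g v)) z = ip (g (T v)) z" "ip (T (adj g v)) z = ip (adj g (T v)) z" using 1 by auto
          then show "ip (T (a v)) z + \<i> * ip (T (b v)) z = ip (a (T v)) z + \<i> * ip (b (T v)) z"
            "ip (T (a v)) z - \<i> * ip (T (b v)) z = ip (a (T v)) z - \<i> * ip (b (T v)) z"
            unfolding ga unfolding g_def using v z by simp_all
        qed
        have "ip (T (a v)) z = ip (a (T v)) z \<and> ip (T (b v)) z = ip (b (T v)) z" if z: "z \<in> V" for z
        proof -
          have "p = r \<and> q = s" if "p + \<i> * q = r + \<i> * s" "p - \<i> * q = r - \<i> * s" for p q r s
            using that by (simp add: complex_eq_iff)
          from this[OF 2[OF z]] show ?thesis .
        qed
        then show ?thesis using v by (auto intro!: vec_eqI)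
      qed
      then show "T \<in> commutant H {a, b}" using TO by (auto simp: commutant_iff[of T])
    qed
    then show "commutant H ({g} \<union> adj ` {g}) \<subseteq> commutant H M" using gen by blast
  qed
  then show ?thesis by (auto simp: singly_generated_def)
qed

section \<open>Reduced algebras\<close>

text \<open>Only the carrier changes, so the operations and the inner product are literally those of
  \<open>H\<close>. Subspaces are presented as some \<open>perp S\<close>, which makes them
  closed.\<close>

abbreviation sub :: "'a set \<Rightarrow> 'a hilbert" where
  "sub Z \<equiv> H\<lparr>carrier := Z\<rparr>"

lemma sub_abelian_group: assumes S: "S \<subseteq> V" shows "abelian_group (sub (perp S))"
proof (rule abelian_groupI)
  fix x y z assume a: "x \<in> carrier (sub (perp S))" "y \<in> carrier (sub (perp S))"
  then have xy: "x \<in> perp S" "y \<in> perp S" "x \<in> V" "y \<in> V" using perpV by auto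
  show "x \<oplus>\<^bsub>sub (perp S)\<^esub> y \<in> carrier (sub (perp S))" using xy S by (simp add: perp_add)
  show "x \<oplus>\<^bsub>sub (perp S)\<^esub> y = y \<oplus>\<^bsub>sub (perp S)\<^esub> x" using xy by (simp add: M.a_comm)
  show "x \<oplus>\<^bsub>sub (perp S)\<^esub> y \<oplus>\<^bsub>sub (perp S)\<^esub> z = x \<oplus>\<^bsub>sub (perp S)\<^esub> (y \<oplus>\<^bsub>sub (perp S)\<^esub> z)"
    if "z \<in> carrier (sub (perp S))"
    using xy perpV[of z S] that by (simp add: M.a_assoc)
  show "\<zero>\<^bsub>sub (perp S)\<^esub> \<oplus>\<^bsub>sub (perp S)\<^esub> x = x" using xy by simp
  have "\<ominus> x \<in> perp S" using xy S by (auto simp: perp_def subset_iff)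
  then show "\<exists>y\<in>carrier (sub (perp S)). y \<oplus>\<^bsub>sub (perp S)\<^esub> x = \<zero>\<^bsub>sub (perp S)\<^esub>"
    using xy by (intro bexI[of _ "\<ominus> x"]) (simp_all add: M.l_neg)
qed (use S perp_zero in auto)

text \<open>The negative is described as an element of the carrier, so a smaller carrier could in
  principle change it; uniqueness of inverses in \<open>H\<close> rules this out.\<close>

lemma sub_minus:
  assumes S: "S \<subseteq> V" and xy: "x \<in> perp S" "y \<in> perp S"
  shows "x \<ominus>\<^bsub>sub (perp S)\<^esub> y = x \<ominus> y"
proof -
  interpret Z: abelian_group "sub (perp S)" by (rule sub_abelian_group[OF S])
  have "\<ominus>\<^bsub>sub (perp S)\<^esub> y \<in> perp S" using Z.a_inv_closed[of y] xy by simp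
  moreover have "\<ominus>\<^bsub>sub (perp S)\<^esub> y \<oplus> y = \<zero>" using Z.l_neg[of y] xy by simp
  ultimately have "\<ominus> y = \<ominus>\<^bsub>sub (perp S)\<^esub> y"
    using xy perpV by (intro M.minus_equality) auto
  then show ?thesis by (simp add: a_minus_def)
qed

lemma sub_hdist:
  assumes S: "S \<subseteq> V"
  shows "hdist (sub (perp S)) x y = (if x \<in> perp S \<and> y \<in> perp S then nrm (x \<ominus> y) else 0)"
  using sub_minus[OF S] by (auto simp: hdist_def hnorm_def)

lemma sub_hilbert: assumes S: "S \<subseteq> V" shows "hilbert_space (sub (perp S))"
proof -
  let ?Z = "sub (perp S)"
  have pV: "x \<in> perp S \<Longrightarrow> x \<in> V" for x by (rule perpV)
  have mod: "module complex_ring ?Z"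
  proof (rule moduleI[OF _ sub_abelian_group[OF S]])
    show "cring complex_ring" by (rule R.is_cring)
  qed (use S pV perp_smult in \<open>auto intro!: vec_eqI simp: complex_ring_def algebra_simps\<close>)
  have met: "Metric_space (perp S) (hdist ?Z)"
  proof
    fix x y z
    show "hdist ?Z x y = hdist ?Z y x" by (simp add: sub_hdist[OF S] nrm_diff_commute pV)
    show "0 \<le> hdist ?Z x y" by (simp add: sub_hdist[OF S] pV)
    show "(hdist ?Z x y = 0) = (x = y)" if "x \<in> perp S" "y \<in> perp S"
      using that nrm_eq_0[of "x \<ominus> y"] by (simp add: sub_hdist[OF S] pV diff_eq_zero)
    show "hdist ?Z x z \<le> hdist ?Z x y + hdist ?Z y z" if "x \<in> perp S" "y \<in> perp S" "z \<in> perp S"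
      using that nrm_diff_triangle by (simp add: sub_hdist[OF S] pV)
  qed
  interpret Z: Metric_space "perp S" "hdist ?Z" by (rule met)
  have "Z.mcomplete"
    unfolding Z.mcomplete_def
  proof (intro allI impI)
    fix s assume s: "Z.MCauchy s"
    then have sZ: "s n \<in> perp S" for n by (auto simp: Z.MCauchy_def)
    have "\<exists>N. \<forall>m\<ge>N. \<forall>n\<ge>N. nrm (s m \<ominus> s n) < e" if "e > 0" for e
      using s that sZ unfolding Z.MCauchy_def by (simp add: sub_hdist[OF S])
    then obtain l where l: "l \<in> V" "(\<lambda>n. nrm (s n \<ominus> l)) \<longlonglongrightarrow> 0"
      using complete_seq[of s] sZ pV by blast
    have ev: "\<forall>\<^sub>F n in sequentially. nrm (s n \<ominus> l) < e" if "e > 0" for e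
      using order_tendstoD(2)[OF l(2) that] .
    have lZ: "l \<in> perp S"
    proof (rule perp_closed[OF S l(1)])
      fix e :: real assume "e > 0"
      then obtain n where "nrm (s n \<ominus> l) < e" using ev by (auto simp: eventually_sequentially)
      then show "\<exists>x\<in>perp S. nrm (x \<ominus> l) < e" using sZ by blast
    qed
    have "limitin Z.mtopology s l sequentially"
      unfolding Z.limitin_metric using lZ ev sZ by (simp add: sub_hdist[OF S])
    then show "\<exists>x. limitin Z.mtopology s x sequentially" by blast
  qed
  then have comp: "Metric_space.mcomplete (carrier ?Z) (hdist ?Z)" by simp
  have comm: "hinner ?Z y x = cnj (hinner ?Z x y)" if "x \<in> carrier ?Z" "y \<in> carrier ?Z" for x y
  proof -
    have "ip y x = cnj (ip x y)" by (rule hinner_commute) (use that pV in simp_all)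
    moreover have "hinner ?Z = ip" by simp
    ultimately show ?thesis by (simp only:)
  qed
  show ?thesis
  proof (rule hilbert_space.intro[OF mod], rule hilbert_space_axioms.intro)
    show "hinner ?Z y x = cnj (hinner ?Z x y)" if "x \<in> carrier ?Z" "y \<in> carrier ?Z" for x y
      using that by (rule comm)
  qed (use comp in \<open>simp_all add: pV hinner_ge_zero hinner_eq_zero\<close>)
qed

lemma restrict_bounded_ops:
  assumes S: "S \<subseteq> V" and T: "T \<in> Op" "\<And>x. x \<in> perp S \<Longrightarrow> T x \<in> perp S"
  shows "restrict T (perp S) \<in> bounded_ops (sub (perp S))"
proof -
  interpret Z: hilbert_space "sub (perp S)" by (rule sub_hilbert[OF S])
  obtain C where C: "\<forall>x\<in>V. nrm (T x) \<le> C * nrm x" using Op_bounded[OF T(1)] by blast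
  have [simp]: "hnorm (sub (perp S)) = nrm" by (simp add: hnorm_def fun_eq_iff)
  note [simp] = OpD[OF T(1)] T(2) perpV
  have "restrict T (carrier (sub (perp S))) \<in> bounded_ops (sub (perp S))"
    by (rule Z.OpI[where C = C]) (use C in simp_all)
  then show ?thesis by simp
qed

text \<open>The extension vanishes on \<open>perp S\<close>. It lifts operators found on the
  subspace back to \<open>H\<close>.\<close>

lemma extend_bounded_ops:
  assumes S: "S \<subseteq> V" and R: "R \<in> bounded_ops (sub (perp (perp S)))"
  shows "restrict (\<lambda>v. R (proj S v)) V \<in> Op"
proof -
  let ?Z = "perp (perp S)"
  interpret Z: hilbert_space "sub ?Z" by (rule sub_hilbert) simp
  note m = proj_mem[OF S]
  have [simp]: "hnorm (sub ?Z) = nrm" by (simp add: hnorm_def fun_eq_iff)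
  obtain C where C: "C \<ge> 0" "\<forall>x\<in>?Z. nrm (R x) \<le> C * nrm x" using Z.Op_bounded[OF R] by auto
  have RZ: "R x \<in> ?Z" if "x \<in> ?Z" for x using Z.Op_closed[OF R, of x] that by simp
  have n: "nrm (proj S v) \<le> nrm v" if v: "v \<in> V" for v
  proof -
    have "v = proj S v \<oplus> (v \<ominus> proj S v)" using v m by (intro vec_eqI) auto
    moreover have "ip (proj S v) (v \<ominus> proj S v) = 0" "ip (v \<ominus> proj S v) (proj S v) = 0"
      using m[OF v] perp_perp2[OF S] by blast+
    ultimately have "Re (ip v v) = Re (ip (proj S v) (proj S v)) + Re (ip (v \<ominus> proj S v) (v \<ominus> proj S v))"
      using v m[OF v] by simp
    moreover have "0 \<le> Re (ip (v \<ominus> proj S v) (v \<ominus> proj S v))" using v m[OF v] by (intro hinner_ge_zero) simp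
    ultimately show ?thesis using v m[OF v] by (simp add: nrm_le_iff)
  qed
  show ?thesis
  proof (rule OpI[where C = C])
    fix x y assume x: "x \<in> V"
    show "R (proj S x) \<in> V" using RZ m[OF x] perpV by blast
    show "R (proj S (x \<oplus> y)) = R (proj S x) \<oplus> R (proj S y)" if y: "y \<in> V"
      using Z.Op_add[OF R, of "proj S x" "proj S y"] m[OF x] m[OF y]
      by (simp add: Op_add[OF proj_Op[OF S] x y])
    show "R (proj S (c \<odot> x)) = c \<odot> R (proj S x)" for c
      using Z.Op_smult[OF R, of "proj S x" c] m[OF x] by (simp add: Op_smult[OF proj_Op[OF S] x])
    have "nrm (R (proj S x)) \<le> C * nrm (proj S x)" using C m[OF x] by simp
    also have "\<dots> \<le> C * nrm x" using C n[OF x] by (intro mult_left_mono)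
    finally show "nrm (R (proj S x)) \<le> C * nrm x" .
  qed
qed

definition reduced :: "('a \<Rightarrow> 'a) set \<Rightarrow> 'a set \<Rightarrow> ('a \<Rightarrow> 'a) set" where
  "reduced M Z = (\<lambda>T. restrict T Z) ` M"

lemma central_invariant:
  assumes M: "von_neumann_algebra H M" and S: "S \<subseteq> V" and z: "proj S \<in> M" "proj S \<in> commutant H M"
    and T: "T \<in> M \<or> T \<in> commutant H M" and x: "x \<in> perp (perp S)"
  shows "T x \<in> perp (perp S)"
proof -
  have xV: "x \<in> V" using x by (rule perpV)
  have TO: "T \<in> Op" using T vNA_Op[OF M] commutant_Op by blast
  have "T (proj S x) = proj S (T x)"
    using T commutantD[OF z(2) _ xV] commutantD[OF _ z(1) xV] by auto
  then have "T x = proj S (T x)" using proj_id[OF S x] by simp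
  then show ?thesis using proj_mem(1)[OF S Op_closed[OF TO xV]] by simp
qed

text \<open>For the bicommutant, an operator \<open>R\<close> on the subspace is extended by 0 to
  \<open>R'\<close>. Elements of \<open>commutant H M\<close> restrict to elements commuting with
  the reduced algebra, so \<open>R\<close> commutes with them; hence \<open>R'\<close> lies in
  \<open>M\<close>, and it restricts to \<open>R\<close>.\<close>

lemma reduced_vNA:
  assumes M: "von_neumann_algebra H M" and S: "S \<subseteq> V" and z: "proj S \<in> M" "proj S \<in> commutant H M"
  shows "von_neumann_algebra (sub (perp (perp S))) (reduced M (perp (perp S)))"
proof -
  define Z where "Z = perp (perp S)"
  define N where "N = reduced M Z"
  interpret Z: hilbert_space "sub Z" unfolding Z_def by (rule sub_hilbert) simp
  have ZV: "x \<in> Z \<Longrightarrow> x \<in> V" for x using perpV by (auto simp: Z_def)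
  have MO: "T \<in> M \<Longrightarrow> T \<in> Op" for T using vNA_Op[OF M] by blast
  have inv: "T x \<in> Z" if "T \<in> M" "x \<in> Z" for T x using central_invariant[OF M S z] that by (auto simp: Z_def)
  have inv': "T x \<in> Z" if "T \<in> commutant H M" "x \<in> Z" for T x
    using central_invariant[OF M S z] that by (auto simp: Z_def)
  have rO: "restrict T Z \<in> bounded_ops (sub Z)" if "T \<in> Op" "\<And>x. x \<in> Z \<Longrightarrow> T x \<in> Z" for T
    using restrict_bounded_ops[of "perp S" T] that by (simp add: Z_def)
  have NI: "T \<in> M \<Longrightarrow> restrict T Z \<in> N" for T by (auto simp: N_def reduced_def)
  have NE: "\<exists>T\<in>M. S = restrict T Z" if "S \<in> N" for S using that by (auto simp: N_def reduced_def)
  have star: "star_subalgebra (sub Z) N"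
    unfolding star_subalgebra_def
  proof (intro conjI ballI allI)
    show "N \<subseteq> bounded_ops (sub Z)" using NE rO MO inv by fastforce
    show "N \<noteq> {}" using vNA_one[OF M] by (auto simp: N_def reduced_def)
  next
    fix S T assume "S \<in> N" "T \<in> N"
    then obtain S' T' where S: "S' \<in> M" "S = restrict S' Z" and T: "T' \<in> M" "T = restrict T' Z" using NE by metis
    have "op_add (sub Z) S T = restrict (op_add H S' T') Z"
      using ZV by (auto simp: S T fun_eq_iff op_add_def)
    then show "op_add (sub Z) S T \<in> N" using NI[OF vNA_add[OF M S(1) T(1)]] by simp
    have "op_mult (sub Z) S T = restrict (op_mult H S' T') Z"
      using ZV inv[OF T(1)] by (auto simp: S T fun_eq_iff op_mult_def compose_def)
    then show "op_mult (sub Z) S T \<in> N" using NI[OF vNA_mult[OF M S(1) T(1)]] by simp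
  next
    fix c T assume "T \<in> N"
    then obtain T' where T: "T' \<in> M" "T = restrict T' Z" using NE by metis
    have "op_scale (sub Z) c T = restrict (op_scale H c T') Z"
      using ZV by (auto simp: T fun_eq_iff op_scale_def)
    then show "op_scale (sub Z) c T \<in> N" using NI[OF vNA_scale[OF M T(1)]] by simp
  next
    fix T assume "T \<in> N"
    then obtain T' where T: "T' \<in> M" "T = restrict T' Z" using NE by metis
    have a: "adj T' \<in> M" using vNA_adj[OF M T(1)] .
    have "is_adjoint (sub Z) T (restrict (adj T') Z)"
      unfolding is_adjoint_def T(2)
      using rO[OF MO[OF T(1)] inv[OF T(1)]] rO[OF MO[OF a] inv[OF a]] ZV
      by (simp add: ip_adj[OF MO[OF T(1)]])
    then show "\<exists>S\<in>N. is_adjoint (sub Z) T S" using NI[OF a] by blast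
  qed
  have "R \<in> N" if R: "R \<in> commutant (sub Z) (commutant (sub Z) N)" for R
  proof -
    have RO: "R \<in> bounded_ops (sub Z)" using R Z.commutant_Op by blast
    define R' where "R' = restrict (\<lambda>v. R (proj S v)) V"
    have R'O: "R' \<in> Op" unfolding R'_def using extend_bounded_ops[OF S] RO by (simp add: Z_def)
    have "R' (s v) = s (R' v)" if s: "s \<in> commutant H M" and v: "v \<in> V" for s v
    proof -
      have sO: "s \<in> Op" using s commutant_Op by blast
      have pv: "proj S v \<in> Z" using proj_mem[OF S v] by (simp add: Z_def)
      have "restrict s Z \<in> commutant (sub Z) N"
      proof (subst Z.commutant_iff, intro conjI ballI)
        show "restrict s Z \<in> bounded_ops (sub Z)" by (rule rO[OF sO inv'[OF s]])
        fix T x assume "T \<in> N" "x \<in> carrier (sub Z)"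
        then obtain T' where T: "T' \<in> M" "T = restrict T' Z" and x: "x \<in> Z" using NE by auto
        show "restrict s Z (T x) = T (restrict s Z x)"
          using inv[OF T(1) x] inv'[OF s x] x commutantD[OF s T(1) ZV[OF x]] by (simp add: T)
      qed
      then have "R (restrict s Z (proj S v)) = restrict s Z (R (proj S v))"
        using Z.commutantD[OF R, of "restrict s Z" "proj S v"] pv by (simp del: restrict_apply)
      moreover have "R (proj S v) \<in> Z" using Z.Op_closed[OF RO] pv by simp
      ultimately have "R (s (proj S v)) = s (R (proj S v))" using pv by simp
      moreover have "s (proj S v) = proj S (s v)" using commutantD[OF s z(1) v] .
      ultimately show ?thesis using v Op_closed[OF sO v] by (simp add: R'_def)
    qed
    then have "R' \<in> M" using R'O vNA_bicomm[OF M] by (auto simp: commutant_iff[of R'])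
    moreover have "R = restrict R' Z"
    proof
      fix v show "R v = restrict R' Z v"
      proof (cases "v \<in> Z")
        case True then show ?thesis using ZV proj_id[OF S] by (simp add: R'_def Z_def)
      next
        case False
        then show ?thesis using RO by (auto simp: bounded_ops_def PiE_def extensional_def)
      qed
    qed
    ultimately show ?thesis using NI by simp
  qed
  then have "commutant (sub Z) (commutant (sub Z) N) = N"
    using Z.subset_commutant2[of N] star by (auto simp: star_subalgebra_def)
  then show ?thesis
    unfolding von_neumann_algebra_def using star Z.hilbert_space_axioms by (simp add: N_def Z_def)
qed

section \<open>Countable generating monoids and separable subspaces\<close>

lemma op_mult_assoc: "\<lbrakk>R \<in> Op; S \<in> Op; T \<in> Op\<rbrakk> \<Longrightarrow> op_mult H (op_mult H R S) T = op_mult H R (op_mult H S T)"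
  by (rule Op_eqI) (auto simp: Op_closed)

lemma op_mult_one: "T \<in> Op \<Longrightarrow> op_mult H (op_one H) T = T" "T \<in> Op \<Longrightarrow> op_mult H T (op_one H) = T"
  by (rule Op_eqI; auto simp: Op_closed)+

text \<open>The witness is the set of words in the generators and their adjoints.\<close>

lemma countable_star_monoid:
  assumes S: "countable S" "generates H S M"
  obtains A where "countable A" "A \<subseteq> M" "op_one H \<in> A" "commutant H A = commutant H M"
    "\<And>a b. \<lbrakk>a \<in> A; b \<in> A\<rbrakk> \<Longrightarrow> op_mult H a b \<in> A" "\<And>a. a \<in> A \<Longrightarrow> adj a \<in> A"
proof -
  have M: "von_neumann_algebra H M" "S \<subseteq> M" using S by (auto simp: generates_def)
  define X where "X = S \<union> adj ` S"
  have XM: "X \<subseteq> M" using M vNA_adj[OF M(1)] by (auto simp: X_def)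
  have MO: "M \<subseteq> Op" using vNA_Op[OF M(1)] .
  have XO: "x \<in> X \<Longrightarrow> x \<in> Op" for x using XM MO by auto
  have Xa: "adj x \<in> X" if "x \<in> X" for x
    using that M(2) MO adj_adj by (auto simp: X_def)
  define w where "w xs = foldr (op_mult H) xs (op_one H)" for xs
  define A where "A = w ` lists X"
  have wM: "w xs \<in> M" if "xs \<in> lists X" for xs
    using that by (induction xs) (use XM vNA_mult[OF M(1)] vNA_one[OF M(1)] in \<open>auto simp: w_def\<close>)
  have wO: "w xs \<in> Op" if "xs \<in> lists X" for xs using wM[OF that] MO by auto
  have app: "w (xs @ ys) = op_mult H (w xs) (w ys)" if "xs \<in> lists X" "ys \<in> lists X" for xs ys
    using that(1)
  proof (induction xs)
    case Nil show ?case using wO[OF that(2)] op_mult_one by (simp add: w_def)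
  next
    case (Cons x xs)
    have "op_mult H x (op_mult H (w xs) (w ys)) = op_mult H (op_mult H x (w xs)) (w ys)"
      using Cons that(2) wO XO by (intro op_mult_assoc[symmetric]) auto
    then show ?case using Cons by (simp add: w_def)
  qed
  have mult: "op_mult H a b \<in> A" if ab: "a \<in> A" "b \<in> A" for a b
  proof -
    obtain xs ys where "xs \<in> lists X" "ys \<in> lists X" "a = w xs" "b = w ys" using ab by (auto simp: A_def)
    then show ?thesis using app[of xs ys] by (auto simp: A_def intro!: image_eqI[of _ w "xs @ ys"])
  qed
  have one: "op_one H \<in> A" unfolding A_def w_def by (rule image_eqI[of _ _ "[]"]) auto
  have XA: "x \<in> A" if "x \<in> X" for x
    unfolding A_def w_def using that op_mult_one XO by (intro image_eqI[of _ _ "[x]"]) auto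
  have adjA: "adj (w xs) \<in> A" if "xs \<in> lists X" for xs
    using that
  proof (induction xs)
    case Nil show ?case using one by (simp add: w_def adj_one)
  next
    case (Cons x xs)
    have "adj (w (x # xs)) = op_mult H (adj (w xs)) (adj x)"
      using Cons wO XO by (simp add: w_def adj_mult)
    then show ?case using Cons mult XA Xa by auto
  qed
  have AM: "A \<subseteq> M" using wM by (auto simp: A_def)
  have "commutant H A \<subseteq> commutant H X" using XA by (intro commutant_antimono) auto
  also have "commutant H X = commutant H M" using generatesD[OF S(2)] by (simp add: X_def)
  finally have "commutant H A = commutant H M" using commutant_antimono[OF AM] by blast
  moreover have "countable A" using S(1) by (simp add: A_def X_def)
  moreover have "adj a \<in> A" if "a \<in> A" for a using that adjA by (auto simp: A_def)
  ultimately show ?thesis using AM one mult by (intro that[of A])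
qed

text \<open>The rational linear combinations are dense.\<close>

lemma separable_sub:
  assumes K: "countable K" "K \<subseteq> V"
  shows "separable_hilbert_space (sub (perp (perp K)))"
proof -
  let ?Z = "perp (perp K)"
  interpret Z: hilbert_space "sub ?Z" by (rule sub_hilbert) simp
  \<comment> \<open>An entry \<open>(p, q, k)\<close> stands for the term
    \<open>Complex p q \<odot> k\<close>; lists over a countable set are countable.\<close>
  define f where "f = (\<lambda>ws. foldr (\<lambda>(p, q, k) v. (Complex p q \<odot> k) \<oplus> v) ws \<zero>)"
  define I :: "(real \<times> real \<times> 'a) list set" where "I = lists (\<rat> \<times> \<rat> \<times> K)"
  define L where "L = f ` I"
  have fV: "f ws \<in> V" if "ws \<in> I" for ws
    using that unfolding I_def by (induction ws) (use K in \<open>auto simp: f_def\<close>)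
  have app: "f (xs @ ys) = f xs \<oplus> f ys" if xs: "xs \<in> I" and ys: "ys \<in> I" for xs ys
    using xs unfolding I_def
  proof (induction xs)
    case Nil show ?case using fV[OF ys] by (simp add: f_def)
  next
    case (Cons w xs)
    obtain p q k where w: "w = (p, q, k)" by (cases w)
    have kV: "k \<in> V" using Cons K by (auto simp: w)
    have "f xs \<in> V" using fV Cons by (simp add: I_def)
    then have "f xs \<in> V" "f ys \<in> V" using fV[OF ys] by auto
    then show ?case using Cons kV by (simp add: f_def w M.a_assoc)
  qed
  have sc: "\<exists>ys\<in>I. f ys = Complex p q \<odot> f xs" if xs: "xs \<in> I" and pq: "p \<in> \<rat>" "q \<in> \<rat>" for xs p q
    using xs unfolding I_def
  proof (induction xs)
    case Nil show ?case by (intro bexI[of _ "[]"] vec_eqI) (auto simp: f_def)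
  next
    case (Cons w xs)
    obtain r t k where w: "w = (r, t, k)" by (cases w)
    have k: "k \<in> K" "k \<in> V" "r \<in> \<rat>" "t \<in> \<rat>" using Cons K by (auto simp: w)
    obtain ys where ys: "ys \<in> lists (\<rat> \<times> \<rat> \<times> K)" "f ys = Complex p q \<odot> f xs" using Cons by blast
    have "f xs \<in> V" using fV Cons by (simp add: I_def)
    have e: "f (w # xs) = Complex r t \<odot> k \<oplus> f xs" by (simp add: f_def w)
    have "f ((p * r - q * t, p * t + q * r, k) # ys) = (Complex p q * Complex r t) \<odot> k \<oplus> f ys"
    proof -
      have "Complex (p * r - q * t) (p * t + q * r) = Complex p q * Complex r t"
        by (simp add: complex_eq_iff)
      then show ?thesis by (simp add: f_def)
    qed
    also have "\<dots> = Complex p q \<odot> f (w # xs)"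
      using k \<open>f xs \<in> V\<close> by (intro vec_eqI) (simp_all add: e ys(2) distrib_left)
    finally show ?case using ys k pq by (intro bexI[of _ "(p * r - q * t, p * t + q * r, k) # ys"]) auto
  qed
  have KL: "K \<subseteq> L"
  proof
    fix k assume k: "k \<in> K"
    have "f [(1, 0, k)] = k" using k K by (intro vec_eqI) (auto simp: f_def complex_eq_iff)
    moreover have "[(1, 0, k)] \<in> I" using k by (simp add: I_def)
    ultimately show "k \<in> L" unfolding L_def by (intro image_eqI[of _ f "[(1, 0, k)]"]) simp_all
  qed
  have LV: "L \<subseteq> V" using fV by (auto simp: L_def)
  have ip0: "ip v (f ws) = 0" if v: "v \<in> perp K" and "ws \<in> I" for v ws
    using that(2) unfolding I_def
  proof (induction ws)
    case Nil show ?case using perpV[OF v] by (simp add: f_def)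
  next
    case (Cons w ws)
    obtain p q k where w: "w = (p, q, k)" by (cases w)
    have k: "k \<in> K" "k \<in> V" using Cons K by (auto simp: w)
    have "f ws \<in> V" using fV Cons by (simp add: I_def)
    moreover have "f (w # ws) = (Complex p q \<odot> k) \<oplus> f ws" by (simp add: f_def w)
    moreover have "ip v k = 0" using v k by (simp add: perp_def)
    ultimately show ?case using Cons k perpV[OF v] by simp
  qed
  have perpL: "perp L = perp K" using KL ip0 by (auto simp: perp_def L_def)
  have "L \<subseteq> ?Z" using subset_perp2[OF LV] perpL by simp
  have "countable L" unfolding L_def I_def using K(1) countable_rat
    by (intro countable_image countable_lists countable_SIGMA)
  have dense: "\<exists>x\<in>L. nrm (x \<ominus> v) < e" if v: "v \<in> ?Z" and e: "e > 0" for v e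
  proof (rule dense_in_perp2[OF LV])
    show "L \<noteq> {}" by (auto simp: L_def I_def)
    show "x \<oplus> y \<in> L" if xy: "x \<in> L" "y \<in> L" for x y
    proof -
      obtain xs ys where "xs \<in> I" "ys \<in> I" "x = f xs" "y = f ys" using xy by (auto simp: L_def)
      then show ?thesis using app[of xs ys] by (auto simp: L_def I_def intro!: image_eqI[of _ f "xs @ ys"])
    qed
    show "Complex p q \<odot> x \<in> L" if x: "x \<in> L" and pq: "p \<in> \<rat>" "q \<in> \<rat>" for x p q
    proof -
      obtain xs where xs: "xs \<in> I" "x = f xs" using x by (auto simp: L_def)
      obtain ys where "ys \<in> I" "f ys = Complex p q \<odot> f xs" using sc[OF xs(1) pq] by blast
      then show ?thesis unfolding L_def xs(2) by (intro image_eqI[of _ f ys]) simp_all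
    qed
  qed (use v e perpL in auto)
  have near: "\<exists>y\<in>L. y \<in> Z.MS.mball v r" if v: "v \<in> ?Z" and r: "r > 0" for v and r :: real
  proof -
    obtain x where x: "x \<in> L" "nrm (x \<ominus> v) < r" using dense[OF v r] by blast
    have "x \<in> ?Z" using x \<open>L \<subseteq> ?Z\<close> by auto
    have "hdist (sub ?Z) v x = (if v \<in> ?Z \<and> x \<in> ?Z then nrm (v \<ominus> x) else 0)"
      by (rule sub_hdist[OF perp_subset])
    also have "\<dots> = nrm (x \<ominus> v)"
      using v \<open>x \<in> ?Z\<close> nrm_diff_commute[OF perpV[OF v] perpV[OF \<open>x \<in> ?Z\<close>]] by (simp only: if_True simp_thms)
    finally have "hdist (sub ?Z) v x < r" using x(2) by (simp only:)
    then have "x \<in> Z.MS.mball v r" unfolding Z.MS.in_mball using v \<open>x \<in> ?Z\<close> by simp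
    then show ?thesis using x(1) by blast
  qed
  have "Z.MS.mtopology closure_of L = carrier (sub ?Z)"
    unfolding Z.MS.metric_closure_of using near by auto
  moreover have "L \<subseteq> topspace Z.MS.mtopology" using \<open>L \<subseteq> ?Z\<close> unfolding Z.MS.topspace_mtopology by simp
  ultimately have "separable_space Z.MS.mtopology"
    unfolding separable_space_def Z.MS.topspace_mtopology using \<open>countable L\<close> by blast
  then show ?thesis unfolding separable_hilbert_space_def using Z.hilbert_space_axioms by blast
qed

end

section \<open>Central decomposition\<close>

text \<open>\<open>A\<close> is a countable stand-in for \<open>M\<close>: invariance is checked on
  \<open>A\<close>, and equality of the commutants turns it into a statement about
  \<open>M\<close>.\<close>

locale generating_monoid = hilbert_space +
  fixes M :: "('a \<Rightarrow> 'a) set" and A :: "('a \<Rightarrow> 'a) set"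
  assumes M: "von_neumann_algebra H M" and A_countable: "countable A" and AM: "A \<subseteq> M"
    and A_one: "op_one H \<in> A" and A_comm: "commutant H A = commutant H M"
    and A_mult: "\<And>a b. \<lbrakk>a \<in> A; b \<in> A\<rbrakk> \<Longrightarrow> op_mult H a b \<in> A"
    and A_adj: "\<And>a. a \<in> A \<Longrightarrow> adj a \<in> A"
begin

abbreviation M' :: "('a \<Rightarrow> 'a) set" where "M' \<equiv> commutant H M"

text \<open>\<open>Z x\<close> is the closed span of \<open>M' A x\<close> and \<open>cz x\<close> the projection onto it. It is a central
  projection of \<open>M\<close>, and the restriction of the reduced algebra to the separable closed span of
  \<open>A x\<close> is faithful.\<close>

definition corb :: "'a \<Rightarrow> 'a set" where "corb x = {s (a x) |s a. s \<in> M' \<and> a \<in> A}"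
definition orb :: "'a \<Rightarrow> 'a set" where "orb x = (\<lambda>a. a x) ` A"
definition cz :: "'a \<Rightarrow> 'a \<Rightarrow> 'a" where "cz x = proj (corb x)"
definition Z :: "'a \<Rightarrow> 'a set" where "Z x = perp (perp (corb x))"

lemma MO: "T \<in> M \<Longrightarrow> T \<in> Op"
  using vNA_Op[OF M] by blast

lemma AO: "a \<in> A \<Longrightarrow> a \<in> Op"
  using AM MO by blast

lemma M'O: "s \<in> M' \<Longrightarrow> s \<in> Op"
  using commutant_Op by blast

lemma M'_one: "op_one H \<in> M'"
  by (auto simp: commutant_iff Op_closed[OF MO])

lemma M'_vNA: "von_neumann_algebra H M'"
  using commutant_vNA[OF vNA_Op[OF M] vNA_adj[OF M]] .

lemma M'_commute: "\<lbrakk>s \<in> M'; T \<in> M; x \<in> V\<rbrakk> \<Longrightarrow> s (T x) = T (s x)"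
  by (rule commutantD)

lemma corbI: "\<lbrakk>s \<in> M'; a \<in> A\<rbrakk> \<Longrightarrow> s (a x) \<in> corb x"
  by (auto simp: corb_def)

lemma corbE:
  assumes "v \<in> corb x"
  obtains s a where "s \<in> M'" "a \<in> A" "v = s (a x)"
  using assms by (auto simp: corb_def)

lemma corbV: "x \<in> V \<Longrightarrow> corb x \<subseteq> V"
  using Op_closed[OF AO] Op_closed[OF M'O] by (auto simp: corb_def)

lemma orb_subset_corb: "x \<in> V \<Longrightarrow> orb x \<subseteq> corb x"
proof
  fix v assume x: "x \<in> V" and "v \<in> orb x"
  then obtain a where a: "a \<in> A" "v = a x" by (auto simp: orb_def)
  then show "v \<in> corb x" using corbI[OF M'_one a(1), of x] x Op_closed[OF AO[OF a(1)] x] by simp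
qed

lemma orbV: "x \<in> V \<Longrightarrow> orb x \<subseteq> V"
  using orb_subset_corb corbV by blast

lemma self_orb: "x \<in> V \<Longrightarrow> x \<in> orb x"
  unfolding orb_def using A_one by (metis image_eqI op_apps(1))

lemma corb_M': "\<lbrakk>x \<in> V; t \<in> M'; v \<in> corb x\<rbrakk> \<Longrightarrow> t v \<in> corb x"
proof (erule corbE)
  fix s a assume a: "x \<in> V" "t \<in> M'" "s \<in> M'" "a \<in> A" "v = s (a x)"
  have "op_mult H t s \<in> M'" using a vNA_mult[OF M'_vNA] by blast
  from corbI[OF this a(4), of x] show "t v \<in> corb x" using a Op_closed[OF AO[OF a(4)] a(1)] by simp
qed

lemma corb_A: "\<lbrakk>x \<in> V; b \<in> A; v \<in> corb x\<rbrakk> \<Longrightarrow> b v \<in> corb x"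
proof (erule corbE)
  fix s a assume a: "x \<in> V" "b \<in> A" "s \<in> M'" "a \<in> A" "v = s (a x)"
  have aV: "a x \<in> V" using Op_closed[OF AO[OF a(4)] a(1)] .
  have "b v = s (b (a x))" using M'_commute[OF a(3) _ aV, of b] AM a by auto
  then show "b v \<in> corb x" using corbI[OF a(3) A_mult[OF a(2,4)], of x] a by simp
qed

text \<open>Invariance of \<open>corb x\<close> under \<open>M'\<close> puts the projection into
  \<open>commutant H M'\<close>, which is \<open>M\<close>; invariance under \<open>A\<close> puts
  it into \<open>M'\<close>.\<close>

lemma cz_mem: "x \<in> V \<Longrightarrow> cz x \<in> M" "x \<in> V \<Longrightarrow> cz x \<in> M'"
proof -
  assume x: "x \<in> V"
  have "cz x \<in> commutant H M'" unfolding cz_def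
    by (rule proj_commutant[OF commutant_Op _ corbV[OF x]])
      (use vNA_adj[OF M'_vNA] corb_M'[OF x] in auto)
  then show "cz x \<in> M" using vNA_bicomm[OF M] by simp
  have "cz x \<in> commutant H A" unfolding cz_def
    by (rule proj_commutant[OF _ _ corbV[OF x]]) (use AO A_adj corb_A[OF x] in auto)
  then show "cz x \<in> M'" using A_comm by simp
qed

lemma ZV: "v \<in> Z x \<Longrightarrow> v \<in> V"
  unfolding Z_def by (rule perpV)

lemma corb_Z: "x \<in> V \<Longrightarrow> corb x \<subseteq> Z x"
  unfolding Z_def by (rule subset_perp2[OF corbV])

lemma Z_invariant: "\<lbrakk>x \<in> V; T \<in> M \<or> T \<in> M'; v \<in> Z x\<rbrakk> \<Longrightarrow> T v \<in> Z x"
  unfolding Z_def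
  by (rule central_invariant[OF M corbV cz_mem(1)[unfolded cz_def] cz_mem(2)[unfolded cz_def]])

lemma cz_id: "\<lbrakk>x \<in> V; v \<in> Z x\<rbrakk> \<Longrightarrow> cz x v = v"
  unfolding cz_def Z_def by (rule proj_id[OF corbV])

lemma cz_Z: "\<lbrakk>x \<in> V; v \<in> V\<rbrakk> \<Longrightarrow> cz x v \<in> Z x"
  unfolding cz_def Z_def by (rule proj_mem(1)[OF corbV])

lemma cz_sa: "\<lbrakk>x \<in> V; v \<in> V; w \<in> V\<rbrakk> \<Longrightarrow> ip (cz x v) w = ip v (cz x w)"
  unfolding cz_def by (rule proj_sa[OF corbV])

lemma reduced_separably_acting:
  assumes x: "x \<in> V"
  shows "separably_acting (sub (Z x)) (reduced M (Z x))"
proof -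
  define K where "K = perp (perp (orb x))"
  have KZ: "v \<in> Z x" if "v \<in> K" for v
  proof -
    have "perp (corb x) \<subseteq> perp (orb x)" using orb_subset_corb[OF x] by (auto simp: perp_def)
    then show ?thesis using that unfolding K_def Z_def by (auto simp: perp_def)
  qed
  have KV: "v \<in> K \<Longrightarrow> v \<in> V" for v using KZ ZV by blast
  interpret K: hilbert_space "sub K" unfolding K_def by (rule sub_hilbert) simp
  interpret Z: hilbert_space "sub (Z x)" unfolding Z_def by (rule sub_hilbert) simp
  have sep: "separable_hilbert_space (sub K)" unfolding K_def
    by (rule separable_sub) (use A_countable orbV[OF x] in \<open>auto simp: orb_def\<close>)
  have inv: "b v \<in> orb x" if b: "b \<in> A" and v: "v \<in> orb x" for b v
  proof -
    obtain a where a: "a \<in> A" "v = a x" using v by (auto simp: orb_def)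
    then have "b v = op_mult H b a x" using x by simp
    then show ?thesis using A_mult[OF b a(1)] by (auto simp: orb_def)
  qed
  have "proj (orb x) \<in> commutant H A"
    by (rule proj_commutant[OF _ _ orbV[OF x]]) (use AO A_adj inv in auto)
  then have k: "proj (orb x) \<in> M'" using A_comm by simp
  have Kinv: "T v \<in> K" if T: "T \<in> M" and v: "v \<in> K" for T v
  proof -
    have "proj (orb x) (T v) = T (proj (orb x) v)" using commutantD[OF k T KV[OF v]] .
    also have "\<dots> = T v" using proj_id[OF orbV[OF x]] v by (simp add: K_def)
    finally show ?thesis
      using proj_mem(1)[OF orbV[OF x] Op_closed[OF MO[OF T] KV[OF v]]] by (simp add: K_def)
  qed
  define \<pi> where "\<pi> = (\<lambda>T :: 'a \<Rightarrow> 'a. restrict T K)"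
  define N where "N = reduced M (Z x)"
  have NE: "\<exists>T\<in>M. S = restrict T (Z x)" if "S \<in> N" for S using that by (auto simp: N_def reduced_def)
  have \<pi>r: "\<pi> (restrict T (Z x)) = restrict T K" for T using KZ by (auto simp: \<pi>_def fun_eq_iff)
  have rK: "restrict T K \<in> bounded_ops (sub K)" if "T \<in> M" for T
    using restrict_bounded_ops[of "perp (orb x)" T] Kinv[OF that] MO[OF that] by (simp add: K_def)
  have \<pi>O: "\<pi> S \<in> bounded_ops (sub K)" if "S \<in> N" for S using NE[OF that] \<pi>r rK by auto
  have NK: "S v \<in> K" if "S \<in> N" "v \<in> K" for S v using NE[OF that(1)] KZ[OF that(2)] Kinv that(2) by auto
  \<comment> \<open>\<open>T\<close> commutes with \<open>M'\<close>, so vanishing on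
    \<open>A x\<close> spreads to \<open>M' A x\<close>; orthogonality of \<open>adj T w\<close> to
    \<open>corb x\<close> then carries it to the closed span.\<close>
  have zero: "T v = \<zero>" if T: "T \<in> M" and T0: "\<And>w. w \<in> K \<Longrightarrow> T w = \<zero>" and v: "v \<in> Z x" for T v
  proof (rule vec_eqI)
    fix w assume w: "w \<in> V"
    note [simp] = OpD[OF MO[OF T]] OpD[OF adj_Op[OF MO[OF T]]]
    have "adj T w \<in> perp (corb x)" unfolding perp_def
    proof (intro CollectI conjI ballI)
      fix u assume "u \<in> corb x"
      then obtain s a where u: "s \<in> M'" "a \<in> A" "u = s (a x)" by (rule corbE)
      have ax: "a x \<in> K" "a x \<in> V"
        using subset_perp2[OF orbV[OF x]] u(2) KV by (auto simp: K_def orb_def)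
      have "T u = s (T (a x))" using M'_commute[OF u(1) T ax(2)] u(3) by simp
      also have "\<dots> = \<zero>" using T0[OF ax(1)] Op_zero[OF M'O[OF u(1)]] by simp
      finally have "T u = \<zero>" .
      then show "ip (adj T w) u = 0"
        using ip_adj_left[OF MO[OF T] w, of u] Op_closed[OF M'O[OF u(1)] ax(2)] u(3) w by simp
    qed (use w in auto)
    then have "ip v (adj T w) = 0" using v perp_perp2[OF corbV[OF x]] unfolding Z_def by blast
    then show "ip (T v) w = ip \<zero> w" using ip_adj[OF MO[OF T] ZV[OF v] w] w by simp
  qed (use Op_closed[OF MO[OF T]] ZV[OF v] in auto)
  have "faithful_normal_representation (sub (Z x)) N (sub K) \<pi>"
    unfolding faithful_normal_representation_def
  proof (intro conjI ballI allI impI)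
    show "\<pi> ` N \<subseteq> bounded_ops (sub K)" using \<pi>O by blast
    show "\<pi> (op_one (sub (Z x))) = op_one (sub K)"
      using KZ by (auto simp: \<pi>_def op_one_def fun_eq_iff)
    fix S T assume ST: "S \<in> N" "T \<in> N"
    show "\<pi> (op_add (sub (Z x)) S T) = op_add (sub K) (\<pi> S) (\<pi> T)"
      using KZ by (auto simp: \<pi>_def op_add_def fun_eq_iff)
    show "\<pi> (op_mult (sub (Z x)) S T) = op_mult (sub K) (\<pi> S) (\<pi> T)"
      using KZ NK[OF ST(2)] by (auto simp: \<pi>_def op_mult_def compose_def fun_eq_iff)
    assume "is_adjoint (sub (Z x)) T S"
    then have "ip (T u) v = ip u (S v)" if "u \<in> K" "v \<in> K" for u v
      using that KZ by (simp add: is_adjoint_def)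
    then show "is_adjoint (sub K) (\<pi> T) (\<pi> S)"
      using \<pi>O ST unfolding is_adjoint_def by (simp add: \<pi>_def)
  next
    fix c T
    show "\<pi> (op_scale (sub (Z x)) c T) = op_scale (sub K) c (\<pi> T)"
      using KZ by (auto simp: \<pi>_def op_scale_def fun_eq_iff)
  next
    show "inj_on \<pi> N"
    proof (rule inj_onI)
      fix S T assume a: "S \<in> N" "T \<in> N" "\<pi> S = \<pi> T"
      obtain S' T' where S: "S' \<in> M" "S = restrict S' (Z x)" and T: "T' \<in> M" "T = restrict T' (Z x)"
        using NE a by metis
      have D: "op_sub S' T' \<in> M" using S T by (intro vNA_add[OF M] vNA_scale[OF M])
      note [simp] = OpD[OF MO[OF S(1)]] OpD[OF MO[OF T(1)]]
      have "restrict S' K = restrict T' K" using a(3) unfolding S(2) T(2) \<pi>r .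
      then have eq: "S' w = T' w" if "w \<in> K" for w using that by (metis restrict_apply')
      have "op_sub S' T' w = \<zero>" if w: "w \<in> K" for w
        using eq[OF w] KV[OF w] by (intro vec_eqI) auto
      then have "op_sub S' T' v = \<zero>" if "v \<in> Z x" for v using zero[OF D] that by blast
      then have "S' v = T' v" if v: "v \<in> Z x" for v
      proof -
        have "S' v \<ominus> T' v = op_sub S' T' v" using ZV[OF v] by (intro vec_eqI) auto
        then show ?thesis
          using \<open>\<And>v. v \<in> Z x \<Longrightarrow> op_sub S' T' v = \<zero>\<close>[OF v] ZV[OF v] diff_eq_zero[of "S' v" "T' v"] by simp
      qed
      then show "S = T" by (auto simp: S T fun_eq_iff)
    qed
  next
    have hn: "hnorm (sub B) = nrm" for B by (simp add: hnorm_def fun_eq_iff)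
    have NO: "N \<subseteq> bounded_ops (sub (Z x))"
      using reduced_vNA[OF M corbV[OF x]] cz_mem[OF x] Z.vNA_Op unfolding N_def Z_def cz_def by blast
    show "continuous_map (subtopology (sigma_weak_topology (sub (Z x))) N) (sigma_weak_topology (sub K)) \<pi>"
      unfolding sigma_weak_topology_def[of "sub K"]
    proof (rule continuous_on_generated_topo)
      fix W assume "W \<in> {{T \<in> bounded_ops (sub K). (\<Sum>n. hinner (sub K) (T (\<xi> n)) (\<eta> n)) \<in> U} |\<xi> \<eta> U.
          square_summable (sub K) \<xi> \<and> square_summable (sub K) \<eta> \<and> open U}"
      then obtain \<xi> \<eta> U where W: "W = {T \<in> bounded_ops (sub K). (\<Sum>n. ip (T (\<xi> n)) (\<eta> n)) \<in> U}"
        and ss: "square_summable (sub K) \<xi>" "square_summable (sub K) \<eta>" "open U" by auto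
      \<comment> \<open>Sequences in \<open>K\<close> are sequences in \<open>Z x\<close> with the
        same sums, so a defining set for \<open>K\<close> pulls back to a defining set for
        \<open>Z x\<close>.\<close>
      define W' where "W' = {T \<in> bounded_ops (sub (Z x)). (\<Sum>n. hinner (sub (Z x)) (T (\<xi> n)) (\<eta> n)) \<in> U}"
      have xK: "\<xi> n \<in> K" for n using ss(1) by (auto simp: square_summable_def)
      have "square_summable (sub (Z x)) \<xi>" "square_summable (sub (Z x)) \<eta>"
        using ss KZ by (auto simp: square_summable_def hn)
      then have "openin (sigma_weak_topology (sub (Z x))) W'"
        unfolding sigma_weak_topology_def W'_def using ss(3) by (intro topology_generated_by_Basis) blast
      moreover have "\<pi> -` W \<inter> topspace (subtopology (sigma_weak_topology (sub (Z x))) N) = W' \<inter> N"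
      proof -
        have "topspace (sigma_weak_topology (sub (Z x))) = bounded_ops (sub (Z x))"
        proof
          show "topspace (sigma_weak_topology (sub (Z x))) \<subseteq> bounded_ops (sub (Z x))"
            unfolding sigma_weak_topology_def topology_generated_by_topspace by blast
          have "bounded_ops (sub (Z x)) = {T \<in> bounded_ops (sub (Z x)).
              (\<Sum>n. hinner (sub (Z x)) (T ((\<lambda>_::nat. \<zero>) n)) ((\<lambda>_::nat. \<zero>) n)) \<in> UNIV}" by simp
          moreover have "square_summable (sub (Z x)) (\<lambda>_. \<zero>)"
            using Z.M.zero_closed by (auto simp: square_summable_def hn)
          ultimately show "bounded_ops (sub (Z x)) \<subseteq> topspace (sigma_weak_topology (sub (Z x)))"
            unfolding sigma_weak_topology_def topology_generated_by_topspace
            by (intro Union_upper CollectI exI[of _ "\<lambda>_. \<zero>"] exI[of _ UNIV]) auto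
        qed
        then show ?thesis using \<pi>O NO xK by (auto simp: W W'_def \<pi>_def)
      qed
      ultimately show "openin (subtopology (sigma_weak_topology (sub (Z x))) N)
          (\<pi> -` W \<inter> topspace (subtopology (sigma_weak_topology (sub (Z x))) N))"
        by (auto simp: openin_subtopology)
    next
      have "square_summable (sub K) (\<lambda>_. \<zero>)"
        using K.M.zero_closed by (auto simp: square_summable_def hn)
      then have "bounded_ops (sub K) \<subseteq> \<Union> {{T \<in> bounded_ops (sub K). (\<Sum>n. hinner (sub K) (T (\<xi> n)) (\<eta> n)) \<in> U} |\<xi> \<eta> U.
          square_summable (sub K) \<xi> \<and> square_summable (sub K) \<eta> \<and> open U}"
        by (intro Union_upper CollectI exI[of _ "\<lambda>_. \<zero>"] exI[of _ UNIV]) auto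
      then show "\<pi> ` topspace (subtopology (sigma_weak_topology (sub (Z x))) N) \<subseteq>
          \<Union> {{T \<in> bounded_ops (sub K). (\<Sum>n. hinner (sub K) (T (\<xi> n)) (\<eta> n)) \<in> U} |\<xi> \<eta> U.
          square_summable (sub K) \<xi> \<and> square_summable (sub K) \<eta> \<and> open U}"
        using \<pi>O by auto
    qed
  qed
  then show ?thesis unfolding separably_acting_def using sep N_def by blast
qed

text \<open>The generator is lifted from the piece to \<open>M\<close> and scaled to a contraction,
  since gluing needs a common norm bound; scaling by a positive number does not change commutants.
  The last conclusion restates generation for operators \<open>Q\<close> on all of \<open>H\<close>
  that preserve the piece.\<close>

lemma local_generator:
  assumes x: "x \<in> V" and sg: "singly_generated (sub (Z x)) (reduced M (Z x))"
  obtains T where "T \<in> M" "contr T"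
    "\<And>Q m v. \<lbrakk>Q \<in> Op; \<And>v. v \<in> Z x \<Longrightarrow> Q v \<in> Z x \<and> Q (T v) = T (Q v) \<and> Q (adj T v) = adj T (Q v);
        m \<in> M; v \<in> Z x\<rbrakk> \<Longrightarrow> Q (m v) = m (Q v)"
proof -
  interpret Z: hilbert_space "sub (Z x)" unfolding Z_def by (rule sub_hilbert) simp
  obtain G where G: "generates (sub (Z x)) {G} (reduced M (Z x))"
    using sg by (auto simp: singly_generated_def)
  have "G \<in> reduced M (Z x)" using G by (auto simp: generates_def)
  then obtain R where R: "R \<in> M" "G = restrict R (Z x)" by (auto simp: reduced_def)
  have RO: "R \<in> Op" and aO: "adj R \<in> Op" using MO[OF R(1)] adj_Op by auto
  have inv: "T v \<in> Z x" if "T \<in> M" "v \<in> Z x" for T v using Z_invariant[OF x] that by blast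
  have rO: "restrict T (Z x) \<in> bounded_ops (sub (Z x))" if "T \<in> Op" "\<And>v. v \<in> Z x \<Longrightarrow> T v \<in> Z x" for T
    using restrict_bounded_ops[of "perp (corb x)" T] that by (simp add: Z_def)
  have aM: "adj R \<in> M" using vNA_adj[OF M R(1)] .
  have "is_adjoint (sub (Z x)) G (restrict (adj R) (Z x))"
    unfolding is_adjoint_def R(2) using rO[OF RO inv[OF R(1)]] rO[OF aO inv[OF aM]]
    by (simp add: ip_adj[OF RO] ZV)
  then have Ga: "Z.adj G = restrict (adj R) (Z x)" using Z.is_adjoint_iff by simp
  obtain r :: real where r: "r > 0" "contr (op_scale H (of_real r) R)" using scale_to_contr[OF RO] by blast
  define T where "T = op_scale H (of_real r) R"
  have Ta: "adj T = op_scale H (of_real r) (adj R)" using RO by (simp add: T_def adj_scale)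
  show ?thesis
  proof (rule that)
    show "T \<in> M" unfolding T_def by (rule vNA_scale[OF M R(1)])
    show "contr T" using r by (simp add: T_def)
    fix Q m v assume Q: "Q \<in> Op"
      and QT: "\<And>v. v \<in> Z x \<Longrightarrow> Q v \<in> Z x \<and> Q (T v) = T (Q v) \<and> Q (adj T v) = adj T (Q v)"
      and m: "m \<in> M" and v: "v \<in> Z x"
    note [simp] = OpD[OF Q] OpD[OF RO] OpD[OF aO]
    have Qi: "Q w \<in> Z x" if "w \<in> Z x" for w using QT that by blast
    have QR: "Q (R w) = R (Q w)" "Q (adj R w) = adj R (Q w)" if w: "w \<in> Z x" for w
    proof -
      have "of_real r \<odot> Q (R w) = of_real r \<odot> R (Q w)" "of_real r \<odot> Q (adj R w) = of_real r \<odot> adj R (Q w)"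
        using QT[OF w] ZV[OF w] by (simp_all add: T_def Ta[unfolded T_def])
      then show "Q (R w) = R (Q w)" "Q (adj R w) = adj R (Q w)"
        using smult_cancel[of "of_real r"] r(1) ZV[OF w] by simp_all
    qed
    have "restrict Q (Z x) \<in> commutant (sub (Z x)) ({G} \<union> Z.adj ` {G})"
    proof (subst Z.commutant_iff, intro conjI ballI)
      show "restrict Q (Z x) \<in> bounded_ops (sub (Z x))" by (rule rO[OF Q Qi])
      fix S w assume S: "S \<in> {G} \<union> Z.adj ` {G}" and "w \<in> carrier (sub (Z x))"
      then have w: "w \<in> Z x" by simp
      from S have "S = restrict R (Z x) \<or> S = restrict (adj R) (Z x)" using R(2) Ga by auto
      then show "restrict Q (Z x) (S w) = S (restrict Q (Z x) w)"
        using w QR[OF w] Qi[OF w] inv[OF R(1) w] inv[OF aM w] by auto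
    qed
    then have "restrict Q (Z x) \<in> commutant (sub (Z x)) (reduced M (Z x))"
      using Z.generatesD[OF G] by simp
    moreover have "restrict m (Z x) \<in> reduced M (Z x)" unfolding reduced_def using m by (rule imageI)
    ultimately have "restrict Q (Z x) (restrict m (Z x) v) = restrict m (Z x) (restrict Q (Z x) v)"
      by (rule Z.commutantD) (use v in simp)
    then show "Q (m v) = m (Q v)" using v inv[OF m v] Qi[OF v] by simp
  qed
qed

text \<open>Zorn's lemma is applied with the weak condition that \<open>y\<close> is orthogonal to
  \<open>corb x\<close>, which passes to unions of chains. It gives \<open>cz x y = \<zero>\<close>,
  and as \<open>cz x\<close> is central it then kills \<open>corb y\<close>, so whole pieces are
  orthogonal.\<close>

lemma maximal_family:
  obtains X where "X \<subseteq> V" "\<And>x y u v. \<lbrakk>x \<in> X; y \<in> X; x \<noteq> y; u \<in> Z x; v \<in> Z y\<rbrakk> \<Longrightarrow> ip u v = 0"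
    "\<And>v. \<lbrakk>v \<in> V; \<And>x u. \<lbrakk>x \<in> X; u \<in> Z x\<rbrakk> \<Longrightarrow> ip u v = 0\<rbrakk> \<Longrightarrow> v = \<zero>" "\<zero> \<notin> X"
proof -
  define P where "P X \<longleftrightarrow> X \<subseteq> V - {\<zero>} \<and> (\<forall>x\<in>X. \<forall>y\<in>X. x \<noteq> y \<longrightarrow> (\<forall>w\<in>corb x. ip w y = 0))" for X
  have "\<exists>X\<in>{X. P X}. \<forall>Y\<in>{X. P X}. X \<subseteq> Y \<longrightarrow> Y = X"
  proof (rule subset_Zorn_nonempty)
    have "P {}" by (simp add: P_def)
    then show "{X. P X} \<noteq> {}" by blast
    fix C assume C: "C \<noteq> {}" "subset.chain {X. P X} C"
    have PC: "P X" if "X \<in> C" for X using C(2) that by (auto simp: subset_chain_def)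
    have "ip w y = 0" if xy: "x \<in> \<Union>C" "y \<in> \<Union>C" "x \<noteq> y" and w: "w \<in> corb x" for x y w
    proof -
      obtain X Y where XY: "X \<in> C" "x \<in> X" "Y \<in> C" "y \<in> Y" using xy by blast
      then have "X \<subseteq> Y \<or> Y \<subseteq> X" using C(2) by (auto simp: subset_chain_def)
      then obtain W where "W \<in> C" "x \<in> W" "y \<in> W" using XY by blast
      then show ?thesis using PC[of W] xy w by (auto simp: P_def)
    qed
    moreover have "\<Union>C \<subseteq> V - {\<zero>}" using PC by (auto simp: P_def)
    ultimately show "\<Union>C \<in> {X. P X}" by (simp add: P_def)
  qed
  then obtain X where X: "P X" and max: "\<And>Y. \<lbrakk>P Y; X \<subseteq> Y\<rbrakk> \<Longrightarrow> Y = X" by auto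
  have XV: "x \<in> X \<Longrightarrow> x \<in> V" for x using X by (auto simp: P_def)
  have ort: "ip u v = 0" if xy: "x \<in> X" "y \<in> X" "x \<noteq> y" and u: "u \<in> Z x" and v: "v \<in> Z y" for x y u v
  proof -
    have "y \<in> perp (corb x)"
    proof -
      have "ip y w = 0" if w: "w \<in> corb x" for w
      proof -
        have "w \<in> V" using w corbV[OF XV[OF xy(1)]] by blast
        moreover have "ip w y = 0" using X xy w by (auto simp: P_def)
        ultimately show ?thesis using ip_eq_0_commute XV[OF xy(2)] by blast
      qed
      then show ?thesis using XV[OF xy(2)] by (simp add: perp_def)
    qed
    then have 0: "cz x y = \<zero>" unfolding cz_def by (rule proj_zero[OF corbV[OF XV[OF xy(1)]]])
    have "u \<in> perp (corb y)" unfolding perp_def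
    proof (intro CollectI conjI ballI)
      show "u \<in> V" using u by (rule ZV)
      fix w assume "w \<in> corb y"
      then obtain s a where w: "s \<in> M'" "a \<in> A" "w = s (a y)" by (rule corbE)
      have aV: "a y \<in> V" "w \<in> V" using Op_closed[OF AO[OF w(2)] XV[OF xy(2)]] Op_closed[OF M'O[OF w(1)]] w(3) by auto
      have cM: "cz x \<in> M" "cz x \<in> M'" using cz_mem[OF XV[OF xy(1)]] by auto
      have "cz x w = s (cz x (a y))" using M'_commute[OF w(1) cM(1) aV(1)] w(3) by simp
      also have "cz x (a y) = a (cz x y)" using M'_commute[OF cM(2) _ XV[OF xy(2)], of a] w(2) AM by auto
      also have "\<dots> = \<zero>" using 0 Op_zero[OF AO[OF w(2)]] by simp
      also have "s \<zero> = \<zero>" using Op_zero[OF M'O[OF w(1)]] .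
      finally have "ip u (cz x w) = 0" using ZV[OF u] by simp
      then show "ip u w = 0"
        using cz_sa[OF XV[OF xy(1)] ZV[OF u] aV(2)] cz_id[OF XV[OF xy(1)] u] by simp
    qed
    then show ?thesis using v perp_perp2[OF corbV[OF XV[OF xy(2)]]] unfolding Z_def by blast
  qed
  \<comment> \<open>A nonzero \<open>v\<close> orthogonal to all pieces could be added to
    \<open>X\<close>; by maximality it would already belong to \<open>X\<close>, lie in its own
    piece and be orthogonal to itself.\<close>
  have tot: "v = \<zero>" if v: "v \<in> V" and v0: "\<And>x u. \<lbrakk>x \<in> X; u \<in> Z x\<rbrakk> \<Longrightarrow> ip u v = 0" for v
  proof (rule ccontr)
    assume nz: "v \<noteq> \<zero>"
    have "P (insert v X)" unfolding P_def
    proof (intro conjI ballI impI)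
      show "insert v X \<subseteq> V - {\<zero>}" using X v nz by (auto simp: P_def)
      fix x y w assume xy: "x \<in> insert v X" "y \<in> insert v X" "x \<noteq> y" and w: "w \<in> corb x"
      consider "x \<in> X" "y \<in> X" | "x \<in> X" "y = v" | "x = v" "y \<in> X" using xy by auto
      then show "ip w y = 0"
      proof cases
        case 1 then show ?thesis using X xy w by (auto simp: P_def)
      next
        case 2 then show ?thesis using v0[of x w] corb_Z[OF XV] w by blast
      next
        \<comment> \<open>With the new vector in first position, \<open>s\<close> and
          \<open>a\<close> are moved across the inner product onto \<open>y\<close>, where they
          produce an element of \<open>Z y\<close>.\<close>
        case 3
        obtain s a where w': "s \<in> M'" "a \<in> A" "w = s (a v)" using w 3 by (auto elim: corbE)
        have yV: "y \<in> V" using XV 3 by blast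
        have aV: "a v \<in> V" using Op_closed[OF AO[OF w'(2)] v] .
        have s: "adj s \<in> M'" using vNA_adj[OF M'_vNA w'(1)] .
        have a: "adj a \<in> A" using A_adj[OF w'(2)] .
        have sy: "adj s y \<in> V" using Op_closed[OF M'O[OF s] yV] .
        have "ip w y = ip (a v) (adj s y)" using w'(3) ip_adj[OF M'O[OF w'(1)] aV yV] by simp
        also have "\<dots> = ip v (adj a (adj s y))" using ip_adj[OF AO[OF w'(2)] v sy] by simp
        also have "adj a (adj s y) = adj s (adj a y)" using M'_commute[OF s _ yV, of "adj a"] a AM by auto
        also have "ip v \<dots> = 0"
        proof -
          have u: "adj s (adj a y) \<in> Z y" using corbI[OF s a] corb_Z[OF yV] by blast
          have "ip (adj s (adj a y)) v = 0" by (rule v0[OF _ u]) (use 3 in simp)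
          then show ?thesis using ip_eq_0_commute v ZV[OF u] by blast
        qed
        finally show ?thesis .
      qed
    qed
    then have "v \<in> X" using max[of "insert v X"] by blast
    then have "v \<in> Z v" using self_orb orb_subset_corb corb_Z v by blast
    then have "ip v v = 0" using v0 \<open>v \<in> X\<close> by blast
    then show False using nz v ip_self_zero by blast
  qed
  show ?thesis
    by (rule that[of X]) (use X ort tot in \<open>auto simp: P_def\<close>)
qed

text \<open>If \<open>\<langle>a x, x\<rangle> = \<langle>a y, y\<rangle>\<close> for all \<open>a\<close>, then \<open>x\<close> projects to \<open>(x + y) / 2\<close> in the closed span of
  \<open>A (x + y)\<close>; that projection lies in \<open>M'\<close>.\<close>

lemma states_separate:
  assumes x: "x \<in> V" and y: "y \<in> V" "y \<noteq> \<zero>"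
    and ort: "\<And>u v. \<lbrakk>u \<in> Z x; v \<in> Z y\<rbrakk> \<Longrightarrow> ip u v = 0"
  shows "\<exists>a\<in>A. ip (a x) x \<noteq> ip (a y) y"
proof (rule ccontr)
  assume "\<not> (\<exists>a\<in>A. ip (a x) x \<noteq> ip (a y) y)"
  then have eq: "\<And>a. a \<in> A \<Longrightarrow> ip (a x) x = ip (a y) y" by blast
  have oZ: "a x \<in> Z x" "a y \<in> Z y" if "a \<in> A" for a
    using that orb_subset_corb corb_Z x y unfolding orb_def by blast+
  have sZ: "x \<in> Z x" "y \<in> Z y" using self_orb orb_subset_corb corb_Z x y by blast+
  define w where "w = x \<oplus> y"
  define k where "k = (1/2) \<odot> w"
  have wV: "w \<in> V" using x y by (simp add: w_def)
  have oV: "orb w \<subseteq> V" by (rule orbV[OF wV])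
  have "proj (orb w) x = k"
  proof (rule proj_unique[OF oV x])
    have "w \<in> perp (perp (orb w))" using self_orb[OF wV] subset_perp2[OF oV] by blast
    then show "k \<in> perp (perp (orb w))" unfolding k_def by (rule perp_smult[OF perp_subset])
    \<comment> \<open>The vector is \<open>(x - y) / 2\<close>. Against \<open>a (x + y)\<close> the
      cross terms vanish because the pieces are orthogonal, and the diagonal terms cancel because
      the states agree.\<close>
    show "x \<ominus> k \<in> perp (orb w)" unfolding perp_def
    proof (intro CollectI conjI ballI)
      show "x \<ominus> k \<in> V" using x wV by (simp add: k_def)
      fix t assume "t \<in> orb w"
      then obtain a where a: "a \<in> A" "t = a w" by (auto simp: orb_def)
      note [simp] = OpD[OF AO[OF a(1)]]
      have c1: "ip x (a y) = 0" using ort[OF sZ(1) oZ(2)[OF a(1)]] .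
      have "ip (a x) y = 0" using ort[OF oZ(1)[OF a(1)] sZ(2)] .
      then have c2: "ip y (a x) = 0" using ip_eq_0_commute[of y "a x"] x y by simp
      have "ip x (a x) = cnj (ip (a x) x)" by (rule hinner_commute) (use x in auto)
      moreover have "ip y (a y) = cnj (ip (a y) y)" by (rule hinner_commute) (use y in auto)
      ultimately have c3: "ip x (a x) = ip y (a y)" using eq[OF a(1)] by simp
      show "ip (x \<ominus> k) t = 0"
        using x y c1 c2 c3 by (simp add: a(2) k_def w_def)
    qed
  qed
  moreover have "proj (orb w) \<in> M'"
  proof -
    have inv: "b v \<in> orb w" if b: "b \<in> A" and v: "v \<in> orb w" for b v
    proof -
      obtain a where a: "a \<in> A" "v = a w" using v by (auto simp: orb_def)
      then have "b v = op_mult H b a w" using wV by simp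
      then show ?thesis using A_mult[OF b a(1)] by (auto simp: orb_def)
    qed
    have "proj (orb w) \<in> commutant H A"
      by (rule proj_commutant[OF _ _ oV]) (use AO A_adj inv in auto)
    then show ?thesis using A_comm by simp
  qed
  \<comment> \<open>An element of \<open>M'\<close> preserves \<open>Z x\<close>, so
    \<open>(x + y) / 2\<close> lies there and is orthogonal to \<open>y\<close>; this forces
    \<open>y = \<zero>\<close>.\<close>
  then have "proj (orb w) x \<in> Z x" using Z_invariant[OF x _ sZ(1)] by blast
  ultimately have "ip k y = 0" using ort[OF _ sZ(2)] by simp
  moreover have "ip x y = 0" using ort[OF sZ] .
  ultimately have "ip y y = 0" using x y by (simp add: k_def w_def)
  then show False using y ip_self_zero by blast
qed

end

section \<open>Gluing over the central pieces\<close>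

locale central_decomposition = generating_monoid +
  fixes X :: "'a set"
  assumes XV: "X \<subseteq> V"
    and X_orth: "\<And>x y u v. \<lbrakk>x \<in> X; y \<in> X; x \<noteq> y; u \<in> Z x; v \<in> Z y\<rbrakk> \<Longrightarrow> ip u v = 0"
    and X_total: "\<And>v. \<lbrakk>v \<in> V; \<And>x u. \<lbrakk>x \<in> X; u \<in> Z x\<rbrakk> \<Longrightarrow> ip u v = 0\<rbrakk> \<Longrightarrow> v = \<zero>"
    and X_nonzero: "\<zero> \<notin> X"
begin

lemma XmemV: "x \<in> X \<Longrightarrow> x \<in> V"
  using XV by blast

text \<open>The adjoints differ at each vector by something orthogonal to all pieces, hence by 0; no
  infinite sums over the pieces are formed.\<close>

lemma Op_eq_on_Z:
  assumes S: "S \<in> Op" and T: "T \<in> Op" and eq: "\<And>x v. \<lbrakk>x \<in> X; v \<in> Z x\<rbrakk> \<Longrightarrow> S v = T v"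
    and v: "v \<in> V"
  shows "S v = T v"
proof (rule vec_eqI)
  note [simp] = OpD[OF S] OpD[OF T] OpD[OF adj_Op[OF S]] OpD[OF adj_Op[OF T]]
  fix w assume w: "w \<in> V"
  have "adj S w \<ominus> adj T w = \<zero>"
  proof (rule X_total)
    fix x u assume x: "x \<in> X" and u: "u \<in> Z x"
    have "ip (S u) w = ip (T u) w" using eq[OF x u] by simp
    then show "ip u (adj S w \<ominus> adj T w) = 0"
      using ip_adj[OF S ZV[OF u] w] ip_adj[OF T ZV[OF u] w] ZV[OF u] w by simp
  qed (use w in simp)
  then have "adj S w = adj T w" using w diff_eq_zero by simp
  then show "ip (S v) w = ip (T v) w" using ip_adj[OF S v w] ip_adj[OF T v w] by simp
qed (use v S T in \<open>simp_all add: Op_closed\<close>)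

lemma cz_other: "\<lbrakk>x \<in> X; y \<in> X; x \<noteq> y; v \<in> Z x\<rbrakk> \<Longrightarrow> cz y v = \<zero>"
proof -
  assume a: "x \<in> X" "y \<in> X" "x \<noteq> y" "v \<in> Z x"
  have "ip v u = 0" if "u \<in> corb y" for u
    using X_orth[OF a(1,2,3,4)] that corb_Z[OF XmemV[OF a(2)]] by blast
  then have "v \<in> perp (corb y)" using ZV[OF a(4)] by (simp add: perp_def)
  then show ?thesis unfolding cz_def by (rule proj_zero[OF corbV[OF XmemV[OF a(2)]]])
qed

text \<open>With \<open>z\<close> the central projection of the new piece,
  \<open>R (1 - z) + T y z\<close> changes \<open>R\<close> only on that piece. The two summands
  have orthogonal values, so Pythagoras keeps the norm at most 1.\<close>

lemma glue_finite:
  assumes T: "\<And>x. x \<in> X \<Longrightarrow> T x \<in> M \<and> contr (T x)" and F: "finite F" "F \<subseteq> X"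
  shows "\<exists>R\<in>M. contr R \<and> (\<forall>x\<in>F. \<forall>v\<in>Z x. R v = T x v)"
  using F
proof (induction F rule: finite_induct)
  case empty
  show ?case using vNA_one[OF M] by (intro bexI[of _ "op_one H"]) (auto simp: contr_def)
next
  case (insert y F)
  then obtain R where R: "R \<in> M" "contr R" "\<forall>x\<in>F. \<forall>v\<in>Z x. R v = T x v" by auto
  have y: "y \<in> X" "y \<in> V" using insert XmemV by auto
  define z where "z = cz y"
  have zM: "z \<in> M" "z \<in> M'" using cz_mem[OF y(2)] by (auto simp: z_def)
  have TM: "T y \<in> M" "contr (T y)" using T y by auto
  note [simp] = OpD[OF MO[OF R(1)]] OpD[OF MO[OF zM(1)]] OpD[OF MO[OF TM(1)]]
  define R' where "R' = op_add H (op_mult H R (op_sub (op_one H) z)) (op_mult H (T y) z)"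
  have "R' \<in> M" unfolding R'_def
    by (intro vNA_add[OF M] vNA_mult[OF M] vNA_scale[OF M] vNA_one[OF M] R zM TM)
  moreover have "contr R'" unfolding contr_def
  proof
    fix v assume v: "v \<in> V"
    define p where "p = v \<ominus> z v"
    define q where "q = z v"
    have zz: "z (z v) = z v" using cz_id[OF y(2) cz_Z[OF y(2) v]] by (simp add: z_def)
    have pq: "p \<in> V" "q \<in> V" "z p = \<zero>" "z q = q" using v zz by (auto simp: p_def q_def diff_eq_zero)
    have zsa: "ip (z s) t = ip s (z t)" if "s \<in> V" "t \<in> V" for s t
      using cz_sa[OF y(2) that] by (simp add: z_def)
    have o1: "ip (R p) (T y q) = 0"
    proof -
      have "T y q = z (T y q)" using M'_commute[OF zM(2) TM(1) pq(2)] pq(4) by simp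
      then have "ip (R p) (T y q) = ip (z (R p)) (T y q)" using zsa[of "R p" "T y q"] pq by simp
      also have "z (R p) = \<zero>" using M'_commute[OF zM(2) R(1) pq(1)] pq(3) by simp
      finally show ?thesis using pq by simp
    qed
    then have o2: "ip (T y q) (R p) = 0" using ip_eq_0_commute[of "R p" "T y q"] pq by simp
    have o3: "ip p q = 0" using zsa[of p q] pq by simp
    then have o4: "ip q p = 0" using ip_eq_0_commute[of p q] pq by simp
    have "R' v = R p \<oplus> T y q" unfolding R'_def p_def q_def
      using v by (intro vec_eqI) (simp_all del: op_apps add: op_apps(2-4)[OF v] op_apps(1)[OF v])
    then have "(nrm (R' v))\<^sup>2 = (nrm (R p))\<^sup>2 + (nrm (T y q))\<^sup>2"
      using pq o1 o2 by (simp flip: Re_ip_self)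
    also have "\<dots> \<le> (nrm p)\<^sup>2 + (nrm q)\<^sup>2"
      using R(2) TM(2) pq by (intro add_mono power_mono) (auto simp: contr_def)
    also have "\<dots> = (nrm (p \<oplus> q))\<^sup>2" using pq o3 o4 by (simp flip: Re_ip_self)
    also have "p \<oplus> q = v" unfolding p_def q_def using v by (intro vec_eqI) auto
    finally show "nrm (R' v) \<le> nrm v" by (rule power2_le_imp_le) (use v in simp)
  qed
  moreover have "R' v = T x v" if x: "x \<in> insert y F" and v: "v \<in> Z x" for x v
  proof (cases "x = y")
    case True
    then have "z v = v" using cz_id[OF y(2)] v by (simp add: z_def)
    then show ?thesis unfolding R'_def using ZV[OF v] True
      by (intro vec_eqI) simp_all
  next
    case False
    then have xF: "x \<in> F" "x \<in> X" using x insert by auto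
    then have "z v = \<zero>" using cz_other[OF xF(2) y(1) False v] by (simp add: z_def)
    moreover have "R v = T x v" using R(3) xF v by blast
    ultimately show ?thesis unfolding R'_def using ZV[OF v] Op_closed[OF MO[OF R(1)] ZV[OF v]]
      by (intro vec_eqI) simp_all
  qed
  ultimately show ?case by (intro bexI[of _ R']) auto
qed

text \<open>The finite gluings form a net of contractions, so compactness provides a cluster point,
  and on each piece the net is eventually constant. The common norm bound is what makes compactness
  available.\<close>

lemma glue:
  assumes T: "\<And>x. x \<in> X \<Longrightarrow> T x \<in> M \<and> contr (T x)"
  obtains R where "R \<in> M" "contr R" "\<And>x v. \<lbrakk>x \<in> X; v \<in> Z x\<rbrakk> \<Longrightarrow> R v = T x v"
proof -
  define F where "F = finite_subsets_at_top X"
  have F: "F \<noteq> bot" by (simp add: F_def)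
  have "\<forall>E. \<exists>R. finite E \<and> E \<subseteq> X \<longrightarrow> R \<in> M \<and> contr R \<and> (\<forall>x\<in>E. \<forall>v\<in>Z x. R v = T x v)"
    using glue_finite[of T, OF T] by blast
  then obtain R where R: "\<And>E. \<lbrakk>finite E; E \<subseteq> X\<rbrakk> \<Longrightarrow> R E \<in> M \<and> contr (R E) \<and> (\<forall>x\<in>E. \<forall>v\<in>Z x. R E v = T x v)"
    by metis
  have evM: "\<forall>\<^sub>F E in F. R E \<in> M \<and> R E \<in> Op \<and> contr (R E)"
    unfolding F_def by (rule eventually_finite_subsets_at_top_weakI) (use R MO in blast)
  then have "\<forall>\<^sub>F E in F. R E \<in> Op \<and> contr (R E)" by eventually_elim blast
  from weak_cluster[OF F this] obtain L G where L: "L \<in> Op" "contr L" and G: "G \<le> F" "G \<noteq> bot"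
    and lim: "wlim R L G" by blast
  have "\<forall>\<^sub>F E in G. R E \<in> M" using filter_leD[OF G(1) evM] by eventually_elim blast
  then have LM: "L \<in> M" by (rule wlim_in_vNA[OF M lim G(2) L(1)])
  have "L v = T x v" if x: "x \<in> X" and v: "v \<in> Z x" for x v
  proof (rule vec_eqI)
    have TO: "T x \<in> Op" using T[OF x] MO by blast
    show "L v \<in> V" "T x v \<in> V" using Op_closed[OF L(1) ZV[OF v]] Op_closed[OF TO ZV[OF v]] .
    fix w assume w: "w \<in> V"
    have l: "((\<lambda>E. ip (R E v) w) \<longlongrightarrow> ip (L v) w) G" by (rule wlimD[OF lim ZV[OF v] w])
    have "\<forall>\<^sub>F E in F. finite E \<and> {x} \<subseteq> E \<and> E \<subseteq> X"
      unfolding F_def eventually_finite_subsets_at_top using x by (intro exI[of _ "{x}"]) auto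
    then have "\<forall>\<^sub>F E in G. finite E \<and> {x} \<subseteq> E \<and> E \<subseteq> X" by (rule filter_leD[OF G(1)])
    then have "\<forall>\<^sub>F E in G. ip (R E v) w = ip (T x v) w"
      by eventually_elim (use R v in auto)
    from Lim_transform_eventually[OF l this]
    have "((\<lambda>E. ip (T x v) w) \<longlongrightarrow> ip (L v) w) G" .
    then show "ip (L v) w = ip (T x v) w"
      using tendsto_const_iff[OF G(2), of "ip (T x v) w" "ip (L v) w"] by simp
  qed
  then show ?thesis using that LM L(2) by blast
qed

text \<open>A yes/no question about the pieces becomes an element of the centre, in the same form as
  a digit. Its properties are checked piece by piece, where \<open>c\<close> is a scalar.\<close>

lemma central_symmetry:
  obtains c where "c \<in> M" "symmetry c" "\<And>x v. \<lbrakk>x \<in> X; v \<in> Z x\<rbrakk> \<Longrightarrow> c v = (if p x then v else \<ominus> v)"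
    "\<And>m v. \<lbrakk>m \<in> M; v \<in> V\<rbrakk> \<Longrightarrow> c (m v) = m (c v)"
proof -
  define T where "T x = (if p x then op_one H else op_scale H (-1) (op_one H))" for x
  have "T x \<in> M \<and> contr (T x)" for x
    unfolding T_def using vNA_one[OF M] vNA_scale[OF M vNA_one[OF M]] by (auto simp: contr_def)
  then obtain c where c: "c \<in> M" "\<And>x v. \<lbrakk>x \<in> X; v \<in> Z x\<rbrakk> \<Longrightarrow> c v = T x v" using glue[of T] by metis
  have cO: "c \<in> Op" using c MO by blast
  note [simp] = OpD[OF cO] OpD[OF adj_Op[OF cO]]
  have cv: "c v = (if p x then v else \<ominus> v)" if x: "x \<in> X" and v: "v \<in> Z x" for x v
  proof -
    have "c v = T x v" by (rule c(2)[OF x v])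
    also have "\<dots> = (if p x then v else \<ominus> v)" using ZV[OF v] by (auto simp: T_def intro!: vec_eqI)
    finally show ?thesis .
  qed
  have cinv: "c v \<in> Z x" if x: "x \<in> X" and v: "v \<in> Z x" for x v
    using Z_invariant[OF XmemV[OF x] _ v] c(1) by blast
  have cc: "c (c v) = v" if x: "x \<in> X" and v: "v \<in> Z x" for x v
  proof -
    have "c (\<ominus> v) = \<ominus> c v" using ZV[OF v] by simp
    then show ?thesis using cv[OF x v] ZV[OF v] by (auto intro!: vec_eqI)
  qed
  have "op_mult H c c v = op_one H v" if "v \<in> V" for v
    by (rule Op_eq_on_Z[OF _ _ _ that]) (use cO cc ZV in auto)
  then have 1: "c (c v) = v" if "v \<in> V" for v using that by force
  have ad: "adj c v = c v" if v0: "v \<in> V" for v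
  proof (rule Op_eq_on_Z[OF adj_Op[OF cO] cO _ v0])
    fix x v assume x: "x \<in> X" and v: "v \<in> Z x"
    show "adj c v = c v"
    proof (rule vec_eqI)
      fix w assume w: "w \<in> V"
      define z where "z = cz x"
      have zM: "z \<in> M" "z \<in> M'" using cz_mem[OF XmemV[OF x]] by (auto simp: z_def)
      have zO: "z \<in> Op" using MO zM by blast
      note [simp] = OpD[OF zO]
      have zsa: "ip (z s) t = ip s (z t)" if "s \<in> V" "t \<in> V" for s t
        using cz_sa[OF XmemV[OF x] that] by (simp add: z_def)
      have zv: "z v = v" using cz_id[OF XmemV[OF x] v] by (simp add: z_def)
      have zw: "z w \<in> Z x" using cz_Z[OF XmemV[OF x] w] by (simp add: z_def)
      have "ip (adj c v) w = ip v (c w)" using ip_adj_left[OF cO ZV[OF v] w] .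
      also have "\<dots> = ip v (z (c w))" using zsa[of v "c w"] zv ZV[OF v] w by simp
      also have "z (c w) = c (z w)" using M'_commute[OF zM(2) c(1) w] .
      also have "ip v (c (z w)) = ip (c v) (z w)" using cv[OF x v] cv[OF x zw] ZV[OF v] w by simp
      also have "\<dots> = ip (z (c v)) w" using zsa[of "c v" w] ZV[OF v] w by simp
      also have "z (c v) = c v" using cz_id[OF XmemV[OF x] cinv[OF x v]] by (simp add: z_def)
      finally show "ip (adj c v) w = ip (c v) w" .
    qed (use ZV[OF v] in auto)
  qed
  have "adj c = c" by (rule Op_eqI[OF adj_Op[OF cO] cO ad])
  then have sym: "symmetry c" using 1 cO by (simp add: symmetry_def sa_adj)
  have com: "c (m v) = m (c v)" if m: "m \<in> M" and v: "v \<in> V" for m v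
  proof -
    have mO: "m \<in> Op" using MO m by blast
    have "op_mult H c m v = op_mult H m c v"
    proof (rule Op_eq_on_Z[OF _ _ _ v])
      fix x u assume x: "x \<in> X" and u: "u \<in> Z x"
      have mu: "m u \<in> Z x" using Z_invariant[OF XmemV[OF x] _ u] m by blast
      show "op_mult H c m u = op_mult H m c u"
        using cv[OF x u] cv[OF x mu] ZV[OF u] Op_minus[OF mO ZV[OF u]] by auto
    qed (use mO cO in auto)
    then show ?thesis using v by simp
  qed
  show ?thesis by (rule that[OF c(1) sym cv com])
qed

section \<open>Assembly of the single generator\<close>

lemma singly_generated_if_reduced:
  assumes sg: "\<And>x. x \<in> X \<Longrightarrow> singly_generated (sub (Z x)) (reduced M (Z x))"
  shows "singly_generated H M"
proof -
  have "\<forall>x. \<exists>T. x \<in> X \<longrightarrow> T \<in> M \<and> contr T \<and>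
    (\<forall>Q m v. Q \<in> Op \<and> (\<forall>v\<in>Z x. Q v \<in> Z x \<and> Q (T v) = T (Q v) \<and> Q (adj T v) = adj T (Q v)) \<and> m \<in> M \<and> v \<in> Z x
        \<longrightarrow> Q (m v) = m (Q v))"
  proof
    fix x
    show "\<exists>T. x \<in> X \<longrightarrow> T \<in> M \<and> contr T \<and>
    (\<forall>Q m v. Q \<in> Op \<and> (\<forall>v\<in>Z x. Q v \<in> Z x \<and> Q (T v) = T (Q v) \<and> Q (adj T v) = adj T (Q v)) \<and> m \<in> M \<and> v \<in> Z x
        \<longrightarrow> Q (m v) = m (Q v))"
    proof (cases "x \<in> X")
      case True
      obtain T where T: "T \<in> M" "contr T"
        "\<And>Q m v. \<lbrakk>Q \<in> Op; \<And>v. v \<in> Z x \<Longrightarrow> Q v \<in> Z x \<and> Q (T v) = T (Q v) \<and> Q (adj T v) = adj T (Q v);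
        m \<in> M; v \<in> Z x\<rbrakk> \<Longrightarrow> Q (m v) = m (Q v)"
        using local_generator[OF XmemV[OF True] sg[OF True]] by blast
      show ?thesis
      proof (intro exI[of _ T] impI conjI allI)
        show "T \<in> M" "contr T" by fact+
        fix Q m v
        assume q: "Q \<in> Op \<and> (\<forall>v\<in>Z x. Q v \<in> Z x \<and> Q (T v) = T (Q v) \<and> Q (adj T v) = adj T (Q v)) \<and> m \<in> M \<and> v \<in> Z x"
        show "Q (m v) = m (Q v)" by (rule T(3)) (use q in blast)+
      qed
    qed simp
  qed
  then obtain T where T: "\<And>x. x \<in> X \<Longrightarrow> T x \<in> M \<and> contr (T x)"
    and Tgen: "\<And>x Q m v. \<lbrakk>x \<in> X; Q \<in> Op;
        \<forall>v\<in>Z x. Q v \<in> Z x \<and> Q (T x v) = T x (Q v) \<and> Q (adj (T x) v) = adj (T x) (Q v);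
        m \<in> M; v \<in> Z x\<rbrakk> \<Longrightarrow> Q (m v) = m (Q v)"
    by metis
  obtain R where R: "R \<in> M" "contr R" "\<And>x v. \<lbrakk>x \<in> X; v \<in> Z x\<rbrakk> \<Longrightarrow> R v = T x v"
    using glue[of T, OF T] by blast
  have RO: "R \<in> Op" "adj R \<in> Op" using R MO adj_Op by auto
  note [simp] = OpD[OF RO(1)] OpD[OF RO(2)]
  have aR: "adj R \<in> M" "contr (adj R)" using vNA_adj[OF M R(1)] adj_contr[OF RO(1) R(2)] by auto
  \<comment> \<open>The generator condition on a piece also involves the adjoint of
    \<open>T x\<close>, so \<open>R\<close> has to agree with \<open>T x\<close> in this respect
    too; it does because both commute with \<open>cz x\<close>.\<close>
  have Radj: "adj R v = adj (T x) v" if x: "x \<in> X" and v: "v \<in> Z x" for x v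
  proof (rule vec_eqI)
    have TM: "T x \<in> M" and TO: "T x \<in> Op" using T[OF x] MO by auto
    show "adj R v \<in> V" "adj (T x) v \<in> V"
      using Op_closed[OF RO(2) ZV[OF v]] Op_closed[OF adj_Op[OF TO] ZV[OF v]] .
    fix w assume w: "w \<in> V"
    define z where "z = cz x"
    have zM: "z \<in> M" "z \<in> M'" using cz_mem[OF XmemV[OF x]] by (auto simp: z_def)
    have zsa: "ip (z s) t = ip s (z t)" if "s \<in> V" "t \<in> V" for s t
      using cz_sa[OF XmemV[OF x] that] by (simp add: z_def)
    have zv: "z v = v" using cz_id[OF XmemV[OF x] v] by (simp add: z_def)
    have zw: "z w \<in> Z x" using cz_Z[OF XmemV[OF x] w] by (simp add: z_def)
    have ipz: "ip v (S w) = ip v (S (z w))" if S: "S \<in> M" for S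
    proof -
      have Sw: "S w \<in> V" using Op_closed[OF MO[OF S] w] .
      have "ip v (S w) = ip v (z (S w))" using zsa[OF ZV[OF v] Sw] zv by simp
      then show ?thesis using M'_commute[OF zM(2) S w] by simp
    qed
    have "ip (adj R v) w = ip v (R w)" using ip_adj_left[OF RO(1) ZV[OF v] w] .
    also have "\<dots> = ip v (R (z w))" by (rule ipz[OF R(1)])
    also have "R (z w) = T x (z w)" by (rule R(3)[OF x zw])
    also have "ip v (T x (z w)) = ip v (T x w)" using ipz[OF TM] by simp
    also have "\<dots> = ip (adj (T x) v) w" using ip_adj_left[OF TO ZV[OF v] w] by simp
    finally show "ip (adj R v) w = ip (adj (T x) v) w" .
  qed
  define a where "a = op_scale H (1/2) (op_add H R (adj R))"
  define b where "b = op_scale H (- \<i> / 2) (op_sub R (adj R))"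
  have aM: "a \<in> M" unfolding a_def by (intro vNA_add[OF M] vNA_scale[OF M] R aR)
  have bM: "b \<in> M" unfolding b_def by (intro vNA_add[OF M] vNA_scale[OF M] R aR)
  have "adj a = a" unfolding a_def using RO
    by (intro Op_eqI) (auto intro!: vec_eqI adj_Op simp: adj_scale adj_add adj_adj add.commute)
  then have asa: "sa a" using MO[OF aM] by (simp add: sa_adj)
  have "adj b = b" unfolding b_def using RO
    by (intro Op_eqI) (auto intro!: vec_eqI adj_Op simp: adj_scale adj_add adj_adj algebra_simps)
  then have bsa: "sa b" using MO[OF bM] by (simp add: sa_adj)
  have acontr: "contr a" unfolding contr_def
  proof
    fix v assume v: "v \<in> V"
    have "nrm (a v) = nrm (R v \<oplus> adj R v) / 2" using v by (simp add: a_def)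
    also have "\<dots> \<le> (nrm (R v) + nrm (adj R v)) / 2" using v nrm_triangle[of "R v" "adj R v"] by simp
    also have "\<dots> \<le> nrm v" using R(2) aR(2) v by (simp add: contr_def) (smt (verit, best) field_sum_of_halves)
    finally show "nrm (a v) \<le> nrm v" .
  qed
  obtain u :: "nat \<Rightarrow> 'a \<Rightarrow> 'a" where u: "\<And>n. u n \<in> bicomm {a}" "\<And>n. symmetry (u n)"
    "commutant H (range u) \<subseteq> commutant H {a}"
    using digits_exist[OF asa acontr] by blast
  have "bicomm {a} \<subseteq> bicomm M" using bicomm_subset[of a M] vNA_bicomm[OF M] aM by simp
  then have uM: "u n \<in> M" for n using u(1) vNA_bicomm[OF M] by blast
  obtain B :: "complex set set" where B: "countable B" "topological_basis B" using ex_countable_basis by blast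
  \<comment> \<open>An index \<open>(h, W)\<close> asks whether the state of a piece takes
    \<open>h\<close> into the basic open set \<open>W\<close>; countably many such questions
    distinguish any two different states.\<close>
  define J where "J = from_nat_into (A \<times> B)"
  have cJ: "countable (A \<times> B)" using A_countable B(1) by simp
  have "\<forall>n. \<exists>c. c \<in> M \<and> symmetry c \<and>
      (\<forall>x\<in>X. \<forall>v\<in>Z x. c v = (if ip (fst (J n) x) x \<in> snd (J n) then v else \<ominus> v)) \<and>
      (\<forall>m\<in>M. \<forall>v\<in>V. c (m v) = m (c v))"
  proof
    fix n
    show "\<exists>c. c \<in> M \<and> symmetry c \<and>
      (\<forall>x\<in>X. \<forall>v\<in>Z x. c v = (if ip (fst (J n) x) x \<in> snd (J n) then v else \<ominus> v)) \<and>
      (\<forall>m\<in>M. \<forall>v\<in>V. c (m v) = m (c v))"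
    proof (rule central_symmetry[of "\<lambda>x. ip (fst (J n) x) x \<in> snd (J n)"])
      fix c assume "c \<in> M" "symmetry c"
        "\<And>x v. \<lbrakk>x \<in> X; v \<in> Z x\<rbrakk> \<Longrightarrow> c v = (if ip (fst (J n) x) x \<in> snd (J n) then v else \<ominus> v)"
        "\<And>m v. \<lbrakk>m \<in> M; v \<in> V\<rbrakk> \<Longrightarrow> c (m v) = m (c v)"
      then show ?thesis by blast
    qed
  qed
  from choice[OF this] obtain c where c: "\<forall>n. c n \<in> M \<and> symmetry (c n) \<and>
      (\<forall>x\<in>X. \<forall>v\<in>Z x. c n v = (if ip (fst (J n) x) x \<in> snd (J n) then v else \<ominus> v)) \<and>
      (\<forall>m\<in>M. \<forall>v\<in>V. c n (m v) = m (c n v))" by blast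
  have cM: "\<And>n. c n \<in> M" and csym: "\<And>n. symmetry (c n)"
    and cv: "\<And>n x v. \<lbrakk>x \<in> X; v \<in> Z x\<rbrakk> \<Longrightarrow> c n v = (if ip (fst (J n) x) x \<in> snd (J n) then v else \<ominus> v)"
    and ccom: "\<And>n m v. \<lbrakk>m \<in> M; v \<in> V\<rbrakk> \<Longrightarrow> c n (m v) = m (c n v)"
    using c by blast+
  \<comment> \<open>Digits of \<open>a\<close> at even positions, labels at odd ones. They commute:
    the \<open>u n\<close> lie in an abelian algebra and the \<open>c n\<close> are central.\<close>
  define e where "e n = (if even n then u (n div 2) else c (n div 2))" for n
  have eu: "e (2 * n) = u n" and ec: "e (2 * n + 1) = c n" for n by (auto simp: e_def)
  have eM: "e n \<in> M" for n using uM cM by (simp add: e_def)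
  have esym: "symmetry (e n)" for n using u(2) csym by (simp add: e_def)
  have ecom: "e m (e n v) = e n (e m v)" if "v \<in> V" for m n v
    using bicomm_abelian[OF MO[OF aM] u(1) u(1) that] ccom[OF uM that] ccom[OF cM that]
    by (simp add: e_def)
  obtain t where t: "t \<in> M" "sa t" "commutant H {t} \<subseteq> commutant H (range e)"
    using ternary_sum[of M e, OF M eM esym ecom] by blast
  show ?thesis
  proof (rule single_generator[OF M t(1,2) bM bsa])
    show "commutant H {t, b} \<subseteq> commutant H M"
    proof
      fix Q assume Q: "Q \<in> commutant H {t, b}"
      then have QO: "Q \<in> Op" using commutant_Op by blast
      note [simp] = OpD[OF QO]
      have Qb: "Q (b v) = b (Q v)" if "v \<in> V" for v using commutantD[OF Q _ that] by simp
      have "Q \<in> commutant H {t}" using Q commutant_antimono[of "{t}" "{t, b}"] by blast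
      then have Qe: "Q \<in> commutant H (range e)" using t(3) by blast
      have Qc: "Q (c n v) = c n (Q v)" if "v \<in> V" for n v
        using commutantD[OF Qe _ that, of "c n"] ec[of n] by (metis rangeI)
      have Qu: "Q (u n v) = u n (Q v)" if "v \<in> V" for n v
        using commutantD[OF Qe _ that, of "u n"] eu[of n] by (metis rangeI)
      have "Q \<in> commutant H (range u)" using Qu QO by (auto simp: commutant_iff[of Q])
      then have Qa: "Q (a v) = a (Q v)" if "v \<in> V" for v using u(3) commutantD[of Q "{a}" a v] that by blast
      have QR: "Q (R v) = R (Q v)" "Q (adj R v) = adj R (Q v)" if v: "v \<in> V" for v
      proof -
        have 1: "R s = a s \<oplus> \<i> \<odot> b s" "adj R s = a s \<oplus> (- \<i>) \<odot> b s" if "s \<in> V" for s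
          using that by (auto intro!: vec_eqI simp: a_def b_def field_simps)
        note [simp] = Op_closed[OF MO[OF aM]] Op_closed[OF MO[OF bM]]
        show "Q (R v) = R (Q v)" "Q (adj R v) = adj R (Q v)"
          unfolding 1[OF v] 1[OF Op_closed[OF QO v]] using v Qa Qb by simp_all
      qed
      \<comment> \<open>This is what the labels are for: the generator condition on a piece applies
        only to operators that preserve it.\<close>
      have Qinv: "Q v \<in> Z x" if x: "x \<in> X" and v: "v \<in> Z x" for x v
      proof -
        have vV: "v \<in> V" using ZV[OF v] .
        have far: "ip y' (Q v) = 0" if y: "y \<in> X" "y \<noteq> x" and y': "y' \<in> Z y" for y y'
        proof -
          have "\<exists>a\<in>A. ip (a x) x \<noteq> ip (a y) y"
          proof (rule states_separate[OF XmemV[OF x] XmemV[OF y(1)]])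
            show "y \<noteq> \<zero>" using y X_nonzero by blast
            show "ip s t = 0" if "s \<in> Z x" "t \<in> Z y" for s t using X_orth[OF x y(1) _ that] y(2) by blast
          qed
          then obtain h where h: "h \<in> A" "ip (h x) x \<noteq> ip (h y) y" by blast
          obtain W where W: "W \<in> B" "ip (h x) x \<in> W" "W \<subseteq> - {ip (h y) y}"
            using topological_basisE[OF B(2), of "- {ip (h y) y}" "ip (h x) x"] h(2) by auto
          obtain n where n: "J n = (h, W)"
            using from_nat_into_surj[OF cJ, of "(h, W)"] h(1) W(1) by (auto simp: J_def)
          \<comment> \<open>The label \<open>c n\<close> is 1 on \<open>Z x\<close> and -1 on
            \<open>Z y\<close>, and it commutes with \<open>Q\<close>; so \<open>ip y' (Q v)\<close>
            equals its own negative.\<close>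
          have 1: "c n v = v" using cv[OF x v, of n] W(2) by (simp add: n)
          have 2: "c n y' = \<ominus> y'" using cv[OF y(1) y', of n] W(3) by (auto simp: n)
          have y'V: "y' \<in> V" using ZV[OF y'] .
          have "ip y' (Q v) = ip y' (c n (Q v))" using Qc[OF vV, of n] 1 by simp
          also have "\<dots> = ip (c n y') (Q v)"
            using csym[of n] vV y'V by (simp add: symmetry_def sa_def)
          also have "\<dots> = - ip y' (Q v)" using vV y'V by (simp add: 2)
          finally show ?thesis by simp
        qed
        have zV: "cz x (Q v) \<in> V" using cz_Z[OF XmemV[OF x]] ZV vV by (meson Op_closed QO)
        have "Q v \<ominus> cz x (Q v) = \<zero>"
        proof (rule X_total)
          show "Q v \<ominus> cz x (Q v) \<in> V" using vV zV by simp
          fix y y' assume y: "y \<in> X" "y' \<in> Z y"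
          show "ip y' (Q v \<ominus> cz x (Q v)) = 0"
          proof (cases "y = x")
            case True
            then have "cz x y' = y'" using cz_id[OF XmemV[OF x]] y(2) by simp
            then have "ip y' (cz x (Q v)) = ip y' (Q v)"
              using cz_sa[OF XmemV[OF x] ZV[OF y(2)], of "Q v"] vV by simp
            then show ?thesis using vV zV ZV[OF y(2)] by simp
          next
            case False
            have "Q v \<in> V" using vV by simp
            then have "ip y' (cz x (Q v)) = 0"
              using X_orth[OF y(1) x False y(2) cz_Z[OF XmemV[OF x]]] by blast
            then show ?thesis using far[OF y(1) False y(2)] vV zV ZV[OF y(2)] by simp
          qed
        qed
        then have "Q v = cz x (Q v)" using diff_eq_zero[OF _ zV, of "Q v"] vV by simp
        moreover have "cz x (Q v) \<in> Z x" by (rule cz_Z[OF XmemV[OF x]]) (use vV in simp)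
        ultimately show ?thesis by simp
      qed
      have "Q (m v) = m (Q v)" if m: "m \<in> M" and v: "v \<in> V" for m v
      proof -
        have mO: "m \<in> Op" using MO m by blast
        have "op_mult H Q m v = op_mult H m Q v"
        proof (rule Op_eq_on_Z[OF _ _ _ v])
          fix x s assume x: "x \<in> X" and s: "s \<in> Z x"
          have "Q (m s) = m (Q s)"
          proof (rule Tgen[OF x QO _ m s], intro ballI conjI)
            fix w assume w: "w \<in> Z x"
            show qz: "Q w \<in> Z x" by (rule Qinv[OF x w])
            show "Q (T x w) = T x (Q w)"
              using QR(1)[OF ZV[OF w]] R(3)[OF x w] R(3)[OF x qz] by simp
            show "Q (adj (T x) w) = adj (T x) (Q w)"
              using QR(2)[OF ZV[OF w]] Radj[OF x w] Radj[OF x qz] by simp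
          qed
          then show "op_mult H Q m s = op_mult H m Q s" using ZV[OF s] by simp
        qed (use mO QO in auto)
        then show ?thesis using v by simp
      qed
      then show "Q \<in> commutant H M" using QO by (simp add: commutant_iff[of Q])
    qed
  qed
qed

end

text \<open>The hypothesis speaks only of spaces over the type of \<open>H\<close>. This suffices
  because every piece, and the separable space on which it is represented, is carried by a subset of
  that type.\<close>

lemma countably_generated_imp_singly_generated:
  fixes H :: "'a hilbert"
  assumes hyp: "\<And>(K :: 'a hilbert) N. von_neumann_algebra K N \<Longrightarrow> separably_acting K N \<Longrightarrow> singly_generated K N"
    and M: "von_neumann_algebra H M" and cg: "countably_generated H M"
  shows "singly_generated H M"
proof -
  interpret hilbert_space H using M by (simp add: von_neumann_algebra_def)
  obtain S where S: "countable S" "generates H S M" using cg by (auto simp: countably_generated_def)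
  obtain A where A: "countable A" "A \<subseteq> M" "op_one H \<in> A" "commutant H A = commutant H M"
    "\<And>a b. \<lbrakk>a \<in> A; b \<in> A\<rbrakk> \<Longrightarrow> op_mult H a b \<in> A" "\<And>a. a \<in> A \<Longrightarrow> adj a \<in> A"
    using countable_star_monoid[OF S] by blast
  interpret generating_monoid H M A
    by (rule generating_monoid.intro[OF hilbert_space_axioms], rule generating_monoid_axioms.intro) (fact M A)+
  show ?thesis
  proof (rule maximal_family)
    fix X assume X: "X \<subseteq> V" "\<And>x y u v. \<lbrakk>x \<in> X; y \<in> X; x \<noteq> y; u \<in> Z x; v \<in> Z y\<rbrakk> \<Longrightarrow> ip u v = 0"
      "\<And>v. \<lbrakk>v \<in> V; \<And>x u. \<lbrakk>x \<in> X; u \<in> Z x\<rbrakk> \<Longrightarrow> ip u v = 0\<rbrakk> \<Longrightarrow> v = \<zero>\<^bsub>H\<^esub>" "\<zero>\<^bsub>H\<^esub> \<notin> X"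
    interpret central_decomposition H M A X
      by (rule central_decomposition.intro[OF generating_monoid_axioms], rule central_decomposition_axioms.intro) (fact X)+
    show ?thesis
    proof (rule singly_generated_if_reduced)
      fix x assume "x \<in> X"
      then have x: "x \<in> V" by (rule XmemV)
      have "von_neumann_algebra (sub (Z x)) (reduced M (Z x))"
        unfolding Z_def using reduced_vNA[OF M corbV[OF x]] cz_mem[OF x] unfolding cz_def by blast
      then show "singly_generated (sub (Z x)) (reduced M (Z x))"
        using reduced_separably_acting[OF x] by (rule hyp)
    qed
  qed
qed

theorem theorem3p4:
  shows "(\<forall>(H :: 'a hilbert) M. von_neumann_algebra H M \<and> separably_acting H M
            \<longrightarrow> singly_generated H M)
     \<longleftrightarrow> (\<forall>(H :: 'a hilbert) M. von_neumann_algebra H M \<and> countably_generated H M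
            \<longrightarrow> singly_generated H M)"
  using countably_generated_imp_singly_generated separably_acting_imp_countably_generated by metis

end
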